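(* Let $s\in\mathbb{Z}$ and let $D\ge1$ be a fixed number of frequency channels $\nu_1,\dots,\nu_D$. Suppose that one observes on $\mathbb{S}^2$ the spin-$s$ fields $P_{\nu_r}(x)=P(x)+N_{\nu_r}(x)$, $r=1,\dots,D$, where $P,N_{\nu_1},\dots,N_{\nu_D}$ are independent zero-mean Gaussian isotropic spin-$s$ random fields. Assume that the angular power spectrum $(C_l)$ of $P$ satisfies $C_l=l^{-\alpha}g(l)>0$, $c_0^{-1}\le g(l)\le c_0$, $\alpha>2$, and for every $n\in\mathbb{N}$ there is $c_n>0$ with $|\frac{d^n}{du^n}g(u)|\le c_nu^{-n}$ for $u\in(|s|,\infty)$; and that for each $r$ the angular power spectrum $(C_{lN_r})$ of $N_{\nu_r}$ satisfies $C_{lN_r}=l^{-\gamma}g_{N_r}(l)>0$, $c_{0N}^{-1}\le g_{N_r}(l)\le c_{0N}$, $\gamma>2$, and for every $n\in\mathbb{N}$ there is $c_{nN}>0$ with $|\frac{d^n}{du^n}g_{N_r}(u)|\le c_{nN}u^{-n}$ for $u\in(|s|,\infty)$. Let $$\beta_{jk;sr}=\int_{\mathbb{S}^2}P_{\nu_r}\overline{\psi_{jk;s}}\,dx,\quad \beta_{jk;sP}=\int_{\mathbb{S}^2}P\,\overline{\psi_{jk;s}}\,dx,\quad \beta_{jk;sN_r}=\int_{\mathbb{S}^2}N_{\nu_r}\overline{\psi_{jk;s}}\,dx,$$ $$\widetilde{\Gamma}^{AP}_j:=\frac1D\sum_k\sum_{r=1}^D\big\{|\beta_{jk;sr}|^2-E|\beta_{jk;sN_r}|^2\big\},\qquad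 \Gamma_j:=\sum_kE|\beta_{jk;sP}|^2 .$$ Then, as $j\to\infty$, $$\frac{\widetilde{\Gamma}^{AP}_j-\Gamma_j}{\sqrt{\mathrm{Var}\{\widetilde{\Gamma}^{AP}_j\}}}\longrightarrow_dN(0,1),\qquad\text{where}\quad \mathrm{Var}\{\widetilde{\Gamma}^{AP}_j\}=O\big(B^{2(1-\min(\alpha,\gamma))j}\big).$$
   Context: $dx$ is surface measure on the unit sphere $\mathbb{S}^2$. Spin harmonics. For $s\in\mathbb{Z}$, $l\ge|s|$, $m=-l,\dots,l$, in the fixed chart with spherical coordinates $(\vartheta,\varphi)$ on $\mathbb{S}^2\setminus\{\text{poles}\}$, the spin-$s$ spherical harmonics are $Y_{l;ms}(\vartheta,\varphi)=(-1)^m\sqrt{\frac{2l+1}{4\pi}}\,e^{im\varphi}d^l_{-m,s}(\vartheta)$, where $d^l_{mn}$ are the Wigner (small) $d$-functions, i.e. the Wigner matrices of $SO(3)$ are $D^l_{mn}(\alpha,\beta,\gamma)=e^{-im\alpha}d^l_{mn}(\beta)e^{-in\gamma}$. They are orthonormal in $L^2(\mathbb{S}^2)$ and $\sum_m|Y_{l;ms}|^2=\frac{2l+1}{4\pi}$. A change of chart only multiplies spin-$s$ quantities by a unimodular phase, so the quadratic quantities considered do not depend on the chart. Put $e_{ls}=(l-s)(l+s+1)$. Sums over $l$ run over $l\ge|s|$ (and $l\geq 1$). Spin needlets. Fix $B>1$ and a nonnegative $b\in C^\infty$ with compact support in $[1/B,B]$, and $\sum_{j\in\mathbb{Z}}b^2(u/B^j)=1$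 for all $u>0$. For each $j\ge0$ there are finitely many cubature points $\xi_{jk}\in\mathbb{S}^2$ and weights $\lambda_{jk}>0$ (nested in $j$), with $\sum_k\lambda_{jk}=4\pi$ and $\sum_k\lambda_{jk}Y_{l;ms}(\xi_{jk})\overline{Y_{l';m's}(\xi_{jk})}=\delta_l^{l'}\delta_m^{m'}$ for all $l,l'$ with $\sqrt{e_{ls}},\sqrt{e_{l's}}\le B^{j+1}$; with constants independent of $j$, $cB^{-2j}\le\lambda_{jk}\le c'B^{-2j}$, the number of points is bounded above and below by constants times $B^{2j}$, distinct points are at distance $\ge\kappa'B^{-j}$, and each point of $\mathbb{S}^2$ is within $\kappa B^{-j}$ of some $\xi_{jk}$. The spin needlets are $\psi_{jk;s}(x)=\sqrt{\lambda_{jk}}\sum_l b\big(\frac{\sqrt{e_{ls}}}{B^j}\big)\sum_{m=-l}^lY_{l;ms}(x)\overline{Y_{l;ms}(\xi_{jk})}$. Sums over $k$ run over all cubature points of level $j$. Random fields. A Gaussian isotropic spin-$s$ field with (total) angular power spectrum $(C_l)$ is $\sum_{l}\sum_{m=-l}^l a_{l;ms}Y_{l;ms}$ (convergence in mean square), where $(a_{l;ms})$ are jointly Gaussian, zero-mean, complex with $E\,a_{l;ms}\overline{a_{l';m's}}=C_l\delta_l^{l'}\delta_m^{m'}$ and $E\,a_{l;ms}a_{l';m's}=0$. *)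

theory Defs
  imports "HOL-Probability.Probability" "HOL-Library.Landau_Symbols"
begin

definition sphere_point :: "real \<Rightarrow> real \<Rightarrow> real ^ 3" where
  "sphere_point \<theta> \<phi> = vector [sin \<theta> * cos \<phi>, sin \<theta> * sin \<phi>, cos \<theta>]"

text \<open>Surface measure, with area element \<open>sin \<theta> d\<theta> d\<phi>\<close> in spherical coordinates.\<close>

definition sphere_measure :: "(real ^ 3) measure" where
  "sphere_measure =
     distr (density (restrict_space lborel ({0..pi} \<times> {0..2 * pi})) (\<lambda>(\<theta>, \<phi>). ennreal (sin \<theta>)))
       (restrict_space borel (sphere 0 1)) (\<lambda>(\<theta>, \<phi>). sphere_point \<theta> \<phi>)"

definition geodesic_dist :: "real ^ 3 \<Rightarrow> real ^ 3 \<Rightarrow> real" where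
  "geodesic_dist x y = arccos (x \<bullet> y)"

definition colatitude :: "real ^ 3 \<Rightarrow> real" where
  "colatitude x = arccos (x $ 3)"

definition longitude :: "real ^ 3 \<Rightarrow> real" where
  "longitude x = Arg (Complex (x $ 1) (x $ 2))"

text \<open>
  Wigner's explicit formula for the matrix entries \<open>d l m n\<close> of \<open>exp (- i \<beta> J_y)\<close> in the basis of
  eigenvectors of \<open>J_z\<close>, so that the Wigner matrices are
  \<open>D l m n (\<alpha>, \<beta>, \<gamma>) = exp (- i m \<alpha>) * d l m n \<beta> * exp (- i n \<gamma>)\<close>.
  It is meant for \<open>\<bar>m\<bar> \<le> l\<close> and \<open>\<bar>n\<bar> \<le> l\<close>; the summation range is exactly the one for which
  all factorials have nonnegative arguments.
\<close>

definition wigner_d :: "nat \<Rightarrow> int \<Rightarrow> int \<Rightarrow> real \<Rightarrow> real" where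
  "wigner_d l m n \<beta> =
     (\<Sum>k = max 0 (n - m)..min (int l + n) (int l - m).
        (-1) powi (m - n + k) *
        sqrt (fact (nat (int l + m)) * fact (nat (int l - m)) *
              fact (nat (int l + n)) * fact (nat (int l - n))) /
        (fact (nat (int l + n - k)) * fact (nat k) *
         fact (nat (m - n + k)) * fact (nat (int l - m - k))) *
        cos (\<beta> / 2) ^ nat (2 * int l + n - m - 2 * k) *
        sin (\<beta> / 2) ^ nat (m - n + 2 * k))"

text \<open>
  The harmonics are written in the chart given by spherical coordinates. At the two poles, where
  the longitude is undefined, \<^const>\<open>Arg\<close> takes the value 0; any other choice would multiply
  all spin-\<open>s\<close> harmonics at that pole by one common unimodular factor.
\<close>

definition spin_harmonic :: "int \<Rightarrow> nat \<Rightarrow> int \<Rightarrow> real ^ 3 \<Rightarrow> complex" where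
  "spin_harmonic s l m x =
     (-1) powi m * of_real (sqrt ((2 * real l + 1) / (4 * pi))) *
     cis (of_int m * longitude x) * of_real (wigner_d l (- m) s (colatitude x))"

definition spin_eigenvalue :: "int \<Rightarrow> nat \<Rightarrow> real" where
  "spin_eigenvalue s l = of_int ((int l - s) * (int l + s + 1))"

text \<open>The first multipole of all expansions: \<open>l \<ge> \<bar>s\<bar>\<close> and \<open>l \<ge> 1\<close>.\<close>

definition first_multipole :: "int \<Rightarrow> nat" where
  "first_multipole s = max 1 (nat \<bar>s\<bar>)"

definition needlet_window :: "real \<Rightarrow> (real \<Rightarrow> real) \<Rightarrow> bool" where
  "needlet_window B b \<longleftrightarrow>
     (\<forall>u. 0 \<le> b u) \<and>
     (\<forall>n u. (deriv ^^ n) b field_differentiable (at u)) \<and>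
     (\<forall>u. u \<notin> {1 / B..B} \<longrightarrow> b u = 0) \<and>
     (\<forall>u>0. ((\<lambda>j::int. (b (u / B powi j))\<^sup>2) has_sum 1) UNIV)"

text \<open>
  At level \<open>j\<close> the cubature points and weights are \<open>\<xi> j k\<close> and \<open>w j k\<close> for \<open>k < K j\<close>;
  all constants are uniform in \<open>j\<close>.
\<close>

definition cubature_system ::
    "real \<Rightarrow> int \<Rightarrow> (nat \<Rightarrow> nat) \<Rightarrow> (nat \<Rightarrow> nat \<Rightarrow> real ^ 3) \<Rightarrow> (nat \<Rightarrow> nat \<Rightarrow> real) \<Rightarrow> bool" where
  "cubature_system B s K \<xi> w \<longleftrightarrow>
     (\<forall>j. \<forall>k<K j. \<xi> j k \<in> sphere 0 1 \<and> 0 < w j k) \<and>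
     (\<forall>j. \<xi> j ` {..<K j} \<subseteq> \<xi> (Suc j) ` {..<K (Suc j)}) \<and>
     (\<forall>j. (\<Sum>k<K j. w j k) = 4 * pi) \<and>
     (\<forall>j l l' m m'.
        nat \<bar>s\<bar> \<le> l \<longrightarrow> nat \<bar>s\<bar> \<le> l' \<longrightarrow> \<bar>m\<bar> \<le> int l \<longrightarrow> \<bar>m'\<bar> \<le> int l' \<longrightarrow>
        sqrt (spin_eigenvalue s l) \<le> B ^ (j + 1) \<longrightarrow>
        sqrt (spin_eigenvalue s l') \<le> B ^ (j + 1) \<longrightarrow>
        (\<Sum>k<K j. of_real (w j k) * spin_harmonic s l m (\<xi> j k) *
           cnj (spin_harmonic s l' m' (\<xi> j k))) = (if l = l' \<and> m = m' then 1 else 0)) \<and>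
     (\<exists>c>0. \<exists>c'>0. \<forall>j. \<forall>k<K j. c / B ^ (2 * j) \<le> w j k \<and> w j k \<le> c' / B ^ (2 * j)) \<and>
     (\<exists>c>0. \<exists>c'>0. \<forall>j. c * B ^ (2 * j) \<le> real (K j) \<and> real (K j) \<le> c' * B ^ (2 * j)) \<and>
     (\<exists>\<kappa>'>0. \<forall>j. \<forall>k<K j. \<forall>k'<K j. k \<noteq> k' \<longrightarrow> \<kappa>' / B ^ j \<le> geodesic_dist (\<xi> j k) (\<xi> j k')) \<and>
     (\<exists>\<kappa>>0. \<forall>j. \<forall>x\<in>sphere 0 1. \<exists>k<K j. geodesic_dist x (\<xi> j k) \<le> \<kappa> / B ^ j)"

definition spin_needlet ::
    "real \<Rightarrow> (real \<Rightarrow> real) \<Rightarrow> (nat \<Rightarrow> nat \<Rightarrow> real ^ 3) \<Rightarrow> (nat \<Rightarrow> nat \<Rightarrow> real) \<Rightarrow> int \<Rightarrow>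
     nat \<Rightarrow> nat \<Rightarrow> real ^ 3 \<Rightarrow> complex" where
  "spin_needlet B b \<xi> w s j k x =
     of_real (sqrt (w j k)) *
     (\<Sum>\<^sub>\<infinity>l\<in>{first_multipole s..}.
        of_real (b (sqrt (spin_eigenvalue s l) / B ^ j)) *
        (\<Sum>m = - int l..int l. spin_harmonic s l m x * cnj (spin_harmonic s l m (\<xi> j k))))"

definition needlet_coeff ::
    "real \<Rightarrow> (real \<Rightarrow> real) \<Rightarrow> (nat \<Rightarrow> nat \<Rightarrow> real ^ 3) \<Rightarrow> (nat \<Rightarrow> nat \<Rightarrow> real) \<Rightarrow> int \<Rightarrow>
     (real ^ 3 \<Rightarrow> 'w \<Rightarrow> complex) \<Rightarrow> nat \<Rightarrow> nat \<Rightarrow> 'w \<Rightarrow> complex" where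
  "needlet_coeff B b \<xi> w s T j k \<omega> =
     (LINT x|sphere_measure. T x \<omega> * cnj (spin_needlet B b \<xi> w s j k x))"

text \<open>Constants count as (degenerate) normal random variables.\<close>

definition normal_rv :: "'w measure \<Rightarrow> ('w \<Rightarrow> real) \<Rightarrow> bool" where
  "normal_rv M X \<longleftrightarrow>
     X \<in> borel_measurable M \<and>
     ((\<exists>\<mu> \<sigma>. 0 < \<sigma> \<and> distributed M lborel X (normal_density \<mu> \<sigma>)) \<or>
      (\<exists>\<mu>. AE \<omega> in M. X \<omega> = \<mu>))"

text \<open>
  A complex family is jointly Gaussian if its real and imaginary parts are. As
  \<open>Re (c * z) = Re c * Re z - Im c * Im z\<close>, the sums below are all the finite real linear
  combinations of real and imaginary parts.
\<close>

definition jointly_gaussian :: "'w measure \<Rightarrow> 'i set \<Rightarrow> ('i \<Rightarrow> 'w \<Rightarrow> complex) \<Rightarrow> bool" where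
  "jointly_gaussian M I X \<longleftrightarrow>
     (\<forall>i\<in>I. X i \<in> borel_measurable M) \<and>
     (\<forall>F c. finite F \<longrightarrow> F \<subseteq> I \<longrightarrow> normal_rv M (\<lambda>\<omega>. \<Sum>i\<in>F. Re (c i * X i \<omega>)))"

definition spin_indices :: "int \<Rightarrow> (nat \<times> int) set" where
  "spin_indices s = {(l, m). first_multipole s \<le> l \<and> \<bar>m\<bar> \<le> int l}"

definition gaussian_spin_coeffs ::
    "'w measure \<Rightarrow> int \<Rightarrow> (nat \<Rightarrow> real) \<Rightarrow> (nat \<times> int \<Rightarrow> 'w \<Rightarrow> complex) \<Rightarrow> bool" where
  "gaussian_spin_coeffs M s C a \<longleftrightarrow>
     jointly_gaussian M (spin_indices s) a \<and>
     (\<forall>p\<in>spin_indices s. (LINT \<omega>|M. a p \<omega>) = 0) \<and>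
     (\<forall>p\<in>spin_indices s. \<forall>q\<in>spin_indices s.
        (LINT \<omega>|M. a p \<omega> * cnj (a q \<omega>)) = (if p = q then of_real (C (fst p)) else 0) \<and>
        (LINT \<omega>|M. a p \<omega> * a q \<omega>) = 0)"

text \<open>
  The expansion converges in mean square at every point. Joint measurability of the field makes
  the integrals of its sample paths over the sphere random variables.
\<close>

definition gaussian_isotropic_spin_field ::
    "'w measure \<Rightarrow> int \<Rightarrow> (nat \<Rightarrow> real) \<Rightarrow> (real ^ 3 \<Rightarrow> 'w \<Rightarrow> complex) \<Rightarrow> bool" where
  "gaussian_isotropic_spin_field M s C T \<longleftrightarrow>
     (\<lambda>(\<omega>, x). T x \<omega>) \<in> borel_measurable (M \<Otimes>\<^sub>M sphere_measure) \<and>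
     (\<exists>a. gaussian_spin_coeffs M s C a \<and>
        (\<forall>x\<in>sphere 0 1.
           (\<lambda>L. \<integral>\<^sup>+\<omega>. ennreal ((cmod (T x \<omega> -
              (\<Sum>l = first_multipole s..L. \<Sum>m = - int l..int l.
                 a (l, m) \<omega> * spin_harmonic s l m x)))\<^sup>2) \<partial>M) \<longlonglongrightarrow> 0))"

definition field_element :: "(real ^ 3 \<Rightarrow> 'w \<Rightarrow> complex) \<Rightarrow> 'w \<Rightarrow> real ^ 3 \<Rightarrow> complex" where
  "field_element T \<omega> = (\<lambda>x\<in>sphere 0 1. T x \<omega>)"

definition regular_spectrum ::
    "int \<Rightarrow> real \<Rightarrow> real \<Rightarrow> (real \<Rightarrow> real) \<Rightarrow> (nat \<Rightarrow> real) \<Rightarrow> bool" where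
  "regular_spectrum s \<alpha> c\<^sub>0 g C \<longleftrightarrow>
     (\<forall>l\<ge>first_multipole s.
        C l = real l powr (- \<alpha>) * g (real l) \<and> 0 < C l \<and>
        inverse c\<^sub>0 \<le> g (real l) \<and> g (real l) \<le> c\<^sub>0) \<and>
     (\<forall>n. \<forall>u>of_int \<bar>s\<bar>. (deriv ^^ n) g field_differentiable (at u)) \<and>
     (\<forall>n. \<exists>c>0. \<forall>u>of_int \<bar>s\<bar>. \<bar>(deriv ^^ n) g u\<bar> \<le> c / u ^ n)"

definition auto_power_estimator ::
    "'w measure \<Rightarrow> real \<Rightarrow> (real \<Rightarrow> real) \<Rightarrow> (nat \<Rightarrow> nat) \<Rightarrow> (nat \<Rightarrow> nat \<Rightarrow> real ^ 3) \<Rightarrow>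
     (nat \<Rightarrow> nat \<Rightarrow> real) \<Rightarrow> int \<Rightarrow> nat \<Rightarrow> (real ^ 3 \<Rightarrow> 'w \<Rightarrow> complex) \<Rightarrow>
     (nat \<Rightarrow> real ^ 3 \<Rightarrow> 'w \<Rightarrow> complex) \<Rightarrow> nat \<Rightarrow> 'w \<Rightarrow> real" where
  "auto_power_estimator M B b K \<xi> w s D P N j \<omega> =
     1 / real D * (\<Sum>k<K j. \<Sum>r = 1..D.
       (cmod (needlet_coeff B b \<xi> w s (\<lambda>x \<omega>. P x \<omega> + N r x \<omega>) j k \<omega>))\<^sup>2 -
       (LINT \<omega>'|M. (cmod (needlet_coeff B b \<xi> w s (N r) j k \<omega>'))\<^sup>2))"

definition needlet_power ::
    "'w measure \<Rightarrow> real \<Rightarrow> (real \<Rightarrow> real) \<Rightarrow> (nat \<Rightarrow> nat) \<Rightarrow> (nat \<Rightarrow> nat \<Rightarrow> real ^ 3) \<Rightarrow>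
     (nat \<Rightarrow> nat \<Rightarrow> real) \<Rightarrow> int \<Rightarrow> (real ^ 3 \<Rightarrow> 'w \<Rightarrow> complex) \<Rightarrow> nat \<Rightarrow> real" where
  "needlet_power M B b K \<xi> w s P j =
     (\<Sum>k<K j. LINT \<omega>|M. (cmod (needlet_coeff B b \<xi> w s P j k \<omega>))\<^sup>2)"

end

theory Submission
  imports Defs
begin

text \<open>
  Cubature is exact on products of two active harmonics, so summing squared needlet coefficients
  over \<open>k\<close> gives the diagonal form \<open>\<Sum>l. b\<^sup>2 (\<Sum>m. \<bar>a l m\<bar>\<^sup>2)\<close> in the harmonic coefficients.
  Hence the centred estimator is a.e. a sum over \<open>(l, m)\<close> of independent centred quadratic forms in the
  Gaussian variables \<open>a l m\<close> of the signal and of the noises. For multipoles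
  \<open>l\<close> of order \<open>B ^ j\<close>, and with \<open>\<mu> = min \<alpha> \<gamma>\<close>, each of them has variance of order
  \<open>B powr (- 2 * \<mu> * j)\<close> and fourth moment at most of order \<open>B powr (- 4 * \<mu> * j)\<close>. There are
  at most of order \<open>B ^ (2 * j)\<close> summands, and already the single multipole \<open>l = \<lfloor>B ^ j\<rfloor>\<close>, where the
  weight is close to \<open>b 1 = 1\<close>, contributes at least of order \<open>B ^ j\<close> of them to the variance; so
  Lyapunov's condition holds.

  The coefficients are identified as \<open>\<integral>T Y dx\<close>, which needs the orthonormality of the spin
  harmonics with respect to surface measure. Their independence follows from that of the fields
  because they are a.e. equal to functions of the field.
\<close>

section \<open>Orthogonality of the Wigner functions\<close>

text \<open>The hypotheses describe the coefficients \<open>a\<close> only through mean-square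
  convergence at each point, and independence only for whole fields as random elements of a product
  space. To reach the coefficients, \<alpha>, \<gamma> > 2 make \<open>(2 * l + 1) * C l\<close>
  summable, so that the error of the expansion is small in L2 of \<open>M\<close> times the sphere
  and Fubini applies. Joint normality is known inside one field and independence between fields;
  characteristic functions merge them, since the Gaussian formula factorizes over multipoles,
  fields, real and imaginary parts. That the latter two are uncorrelated, with variance
  \<open>C l / 2\<close> each, comes from the vanishing of \<open>E (a p * a q)\<close>. The
  channels share the signal, so the form in one \<open>(l, m)\<close> contains products of signal
  and noise. Its exact variance is avoided: projection on one centred square bounds it from below, a
  crude eighth-moment estimate bounds its fourth moment. In Lyapunov's quotient each fourth moment
  is at most \<open>decay j ^ 2\<close> times the variance of the same term, up to a constant, and
  the total variance is at least of order \<open>B ^ j * decay j ^ 2\<close>; the quotient is O(B ^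
  (- j)).\<close>

lemma alternating_choose_sum:
  "(\<Sum>k\<le>N. (-1) ^ k * real (N choose k) * real ((x + k) choose q)) =
     (if q < N then 0 else (-1) ^ N * real (x choose (q - N)))"
proof (induction N arbitrary: q)
  case 0
  then show ?case by simp
next
  case (Suc N)
  define f where "f k = real ((x + k) choose q)" for k
  have "(\<Sum>k\<le>Suc N. (-1) ^ k * real (Suc N choose k) * f k)
      = (\<Sum>k\<le>N. (-1) ^ k * real (N choose k) * f k) + (\<Sum>k\<le>N. (-1) ^ Suc k * real (N choose k) * f (Suc k))"
  proof -
    have "(\<Sum>k\<le>Suc N. (-1) ^ k * real (Suc N choose k) * f k)
        = f 0 + (\<Sum>k\<le>N. (-1) ^ Suc k * real (Suc N choose Suc k) * f (Suc k))"
      by (subst sum.atMost_Suc_shift) simp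
    also have "\<dots> = f 0 + (\<Sum>k\<le>N. (-1) ^ Suc k * real (N choose Suc k) * f (Suc k)) +
        (\<Sum>k\<le>N. (-1) ^ Suc k * real (N choose k) * f (Suc k))"
      by (simp add: sum.distrib[symmetric] algebra_simps)
    also have "f 0 + (\<Sum>k\<le>N. (-1) ^ Suc k * real (N choose Suc k) * f (Suc k)) =
        (\<Sum>k\<le>Suc N. (-1) ^ k * real (N choose k) * f k)"
      by (subst sum.atMost_Suc_shift) simp
    finally show ?thesis by simp
  qed
  also have "\<dots> = (\<Sum>k\<le>N. (-1) ^ k * real (N choose k) * (f k - f (Suc k)))"
    by (simp add: sum.distrib[symmetric] algebra_simps)
  also have "\<dots> = (if q < Suc N then 0 else (-1) ^ Suc N * real (x choose (q - Suc N)))"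
  proof (cases q)
    case 0
    then show ?thesis by (simp add: f_def)
  next
    case (Suc q')
    \<comment> \<open>By Pascal's rule one difference in \<open>k\<close> lowers the lower index by
      one and keeps the shape of the sum. The original sum is, up to sign, an \<open>N\<close>-th
      difference, which annihilates a polynomial in \<open>k\<close> of degree
      \<open>q < N\<close>.\<close>
    have "f k - f (Suc k) = - real ((x + k) choose q')" for k
      by (simp add: f_def Suc)
    then have "(\<Sum>k\<le>N. (-1) ^ k * real (N choose k) * (f k - f (Suc k))) =
       - (\<Sum>k\<le>N. (-1) ^ k * real (N choose k) * real ((x + k) choose q'))"
      by (simp add: sum_negf)
    then show ?thesis using Suc.IH[of q'] Suc by simp
  qed
  finally show ?case by (simp add: f_def)
qed

text \<open>Twice Euler's Beta integral B(a + 1, b + 1), by x = sin^2(\<beta> / 2). The induction on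
  \<open>a\<close> integrates by parts: the antiderivative vanishes at both ends, and one factor
  cos^2 is traded for sin^2, which is why \<open>b\<close> stays arbitrary.\<close>

lemma half_angle_beta_integral:
  "((\<lambda>\<beta>. cos (\<beta> / 2) ^ (2 * a) * sin (\<beta> / 2) ^ (2 * b) * sin \<beta>) has_integral
     (2 * fact a * fact b / fact (a + b + 1))) {0..pi}"
proof (induction a arbitrary: b)
  case 0
  have "((\<lambda>\<beta>::real. sin (\<beta> / 2) ^ (2 * b) * sin \<beta>) has_integral
     (2 / real (b + 1) * sin (pi / 2) ^ (2 * b + 2) - 2 / real (b + 1) * sin (0 / 2) ^ (2 * b + 2))) {0..pi}"
  proof (rule fundamental_theorem_of_calculus)
    fix x :: real
    have "sin x = 2 * sin (x / 2) * cos (x / 2)"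
      using sin_double[of "x / 2"] by simp
    then show "((\<lambda>\<beta>. 2 / real (b + 1) * sin (\<beta> / 2) ^ (2 * b + 2)) has_vector_derivative
           sin (x / 2) ^ (2 * b) * sin x) (at x within {0..pi})"
      unfolding has_real_derivative_iff_has_vector_derivative[symmetric]
      by (auto intro!: derivative_eq_intros simp del: power_Suc) (simp add: divide_simps)
  qed simp
  moreover have "2 * fact 0 * fact b / fact (0 + b + 1) = 2 / real (b + 1)"
    by simp
  ultimately show ?case by simp
next
  case (Suc a)
  have "((\<lambda>\<beta>::real. real (b + 1) * (cos (\<beta> / 2) ^ (2 * Suc a) * sin (\<beta> / 2) ^ (2 * b) * sin \<beta>)
        - real (Suc a) * (cos (\<beta> / 2) ^ (2 * a) * sin (\<beta> / 2) ^ (2 * Suc b) * sin \<beta>)) has_integral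
     (2 * (cos (pi / 2) ^ (2 * Suc a) * sin (pi / 2) ^ (2 * Suc b)) -
      2 * (cos (0 / 2) ^ (2 * Suc a) * sin (0 / 2) ^ (2 * Suc b)))) {0..pi}"
  proof (rule fundamental_theorem_of_calculus)
    fix x :: real
    have *: "sin x = 2 * sin (x / 2) * cos (x / 2)"
      using sin_double[of "x / 2"] by simp
    have "((\<lambda>\<beta>. 2 * ((cos (\<beta> / 2) ^ 2) ^ Suc a * (sin (\<beta> / 2) ^ 2) ^ Suc b)) has_real_derivative
           real (b + 1) * ((cos (x / 2) ^ 2) ^ Suc a * (sin (x / 2) ^ 2) ^ b * sin x)
        - real (Suc a) * ((cos (x / 2) ^ 2) ^ a * (sin (x / 2) ^ 2) ^ Suc b * sin x)) (at x within {0..pi})"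
      unfolding *
      by (auto intro!: derivative_eq_intros simp del: power_Suc)
    then show "((\<lambda>\<beta>. 2 * (cos (\<beta> / 2) ^ (2 * Suc a) * sin (\<beta> / 2) ^ (2 * Suc b))) has_vector_derivative
          real (b + 1) * (cos (x / 2) ^ (2 * Suc a) * sin (x / 2) ^ (2 * b) * sin x)
        - real (Suc a) * (cos (x / 2) ^ (2 * a) * sin (x / 2) ^ (2 * Suc b) * sin x)) (at x within {0..pi})"
      unfolding has_real_derivative_iff_has_vector_derivative[symmetric] power_mult .
  qed simp
  from has_integral_add[OF this has_integral_mult_right[OF Suc.IH[of "Suc b"], of "real (Suc a)"]]
  have "((\<lambda>\<beta>. real (b + 1) * (cos (\<beta> / 2) ^ (2 * Suc a) * sin (\<beta> / 2) ^ (2 * b) * sin \<beta>)) has_integral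
    real (Suc a) * (2 * fact a * fact (Suc b) / fact (a + Suc b + 1))) {0..pi}" by simp
  from has_integral_mult_right[OF this, of "1 / real (b + 1)"]
  have "((\<lambda>\<beta>. cos (\<beta> / 2) ^ (2 * Suc a) * sin (\<beta> / 2) ^ (2 * b) * sin \<beta>) has_integral
    1 / real (b + 1) * (real (Suc a) * (2 * fact a * fact (Suc b) / fact (a + Suc b + 1)))) {0..pi}"
    by simp
  moreover have "1 / real (b + 1) * (real (Suc a) * (2 * fact a * fact (Suc b) / F)) = 2 * fact (Suc a) * fact b / F" for F :: real
    by (simp add: divide_simps)
  from this[of "fact (Suc a + b + 1)"] have "1 / real (b + 1) * (real (Suc a) * (2 * fact a * fact (Suc b) / fact (a + Suc b + 1))) =
     2 * fact (Suc a) * fact b / fact (Suc a + b + 1)"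
    by (simp del: fact_Suc)
  ultimately show ?case by (simp only:)
qed

text \<open>With P the Jacobi polynomial of degree \<open>N\<close> and parameters
  \<open>(a, b)\<close>, this is sin^a(\<beta> / 2) cos^b(\<beta> / 2) P(cos \<beta>) divided by (N
  + a)! (N + b)!. Half-angle powers keep it a finite sum of Beta integrands.\<close>

definition jacobi_sum :: "nat \<Rightarrow> nat \<Rightarrow> nat \<Rightarrow> real \<Rightarrow> real" where
  "jacobi_sum N a b \<beta> = (\<Sum>k\<le>N. (-1) ^ k / (fact (N + b - k) * fact k * fact (a + k) * fact (N - k)) *
      cos (\<beta> / 2) ^ (2 * (N - k) + b) * sin (\<beta> / 2) ^ (a + 2 * k))"

text \<open>Orthogonality of the Jacobi polynomial to all lower powers of sin^2(\<beta> / 2) in its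
  own weight, together with the first nonzero moment \<open>q = N\<close>, which gives the
  norm.\<close>

lemma jacobi_sum_moment:
  "((\<lambda>\<beta>. jacobi_sum N a b \<beta> * (cos (\<beta> / 2) ^ b * sin (\<beta> / 2) ^ (a + 2 * q)) * sin \<beta>) has_integral
    (if q < N then 0 else 2 * fact q * (-1) ^ N * real ((a + q) choose (q - N)) / (fact (N + a + b + q + 1) * fact N))) {0..pi}"
proof -
  have h1: "((\<lambda>\<beta>. \<Sum>k\<le>N. (-1) ^ k / (fact (N + b - k) * fact k * fact (a + k) * fact (N - k)) *
     (cos (\<beta> / 2) ^ (2 * (N - k + b)) * sin (\<beta> / 2) ^ (2 * (a + k + q)) * sin \<beta>)) has_integral
     (\<Sum>k\<le>N. (-1) ^ k / (fact (N + b - k) * fact k * fact (a + k) * fact (N - k)) *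
     (2 * fact (N - k + b) * fact (a + k + q) / fact (N - k + b + (a + k + q) + 1)))) {0..pi}"
    by (intro has_integral_sum has_integral_mult_right half_angle_beta_integral) auto
  have h2: "(\<Sum>k\<le>N. (-1) ^ k / (fact (N + b - k) * fact k * fact (a + k) * fact (N - k)) *
     (cos (\<beta> / 2) ^ (2 * (N - k + b)) * sin (\<beta> / 2) ^ (2 * (a + k + q)) * sin \<beta>)) =
      jacobi_sum N a b \<beta> * (cos (\<beta> / 2) ^ b * sin (\<beta> / 2) ^ (a + 2 * q)) * sin \<beta>" for \<beta>
    unfolding jacobi_sum_def sum_distrib_right
  proof (intro sum.cong refl)
    fix k
    have "cos (\<beta> / 2) ^ (2 * (N - k + b)) = cos (\<beta> / 2) ^ (2 * (N - k) + b) * cos (\<beta> / 2) ^ b"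
      "sin (\<beta> / 2) ^ (2 * (a + k + q)) = sin (\<beta> / 2) ^ (a + 2 * k) * sin (\<beta> / 2) ^ (a + 2 * q)"
      by (simp_all add: mult_2 flip: power_add) (simp_all add: algebra_simps)
    then show "(-1) ^ k / (fact (N + b - k) * fact k * fact (a + k) * fact (N - k)) *
        (cos (\<beta> / 2) ^ (2 * (N - k + b)) * sin (\<beta> / 2) ^ (2 * (a + k + q)) * sin \<beta>) =
        (-1) ^ k / (fact (N + b - k) * fact k * fact (a + k) * fact (N - k)) *
        cos (\<beta> / 2) ^ (2 * (N - k) + b) * sin (\<beta> / 2) ^ (a + 2 * k) *
        (cos (\<beta> / 2) ^ b * sin (\<beta> / 2) ^ (a + 2 * q)) * sin \<beta>"
      by (simp only: mult_ac)
  qed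
  \<comment> \<open>The denominator of the Beta value does not depend on \<open>k\<close>. One
    numerator factorial cancels, the other completes a binomial coefficient, and an alternating
    binomial sum is left.\<close>
  have h3: "(\<Sum>k\<le>N. (-1) ^ k / (fact (N + b - k) * fact k * fact (a + k) * fact (N - k)) *
     (2 * fact (N - k + b) * fact (a + k + q) / fact (N - k + b + (a + k + q) + 1))) =
     (2 * fact q / (fact (N + a + b + q + 1) * fact N)) *
     (\<Sum>k\<le>N. (-1) ^ k * real (N choose k) * real ((a + q + k) choose q))"
    unfolding sum_distrib_left
  proof (intro sum.cong refl)
    fix k assume "k \<in> {..N}"
    then have k: "k \<le> N" by simp
    have e: "N - k + b + (a + k + q) + 1 = N + a + b + q + 1" "N - k + b = N + b - k" "a + k + q = a + q + k"
      "N + b - k + (a + q + k) + 1 = N + a + b + q + 1"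
      using k by auto
    have c1: "real (N choose k) = fact N / (fact k * fact (N - k))"
      using k by (rule binomial_fact)
    have c2: "real ((a + q + k) choose q) = fact (a + q + k) / (fact q * fact (a + k))"
      using binomial_fact[of q "a + q + k", where 'a=real] by (simp add: add.commute add.left_commute)
    show "(-1) ^ k / (fact (N + b - k) * fact k * fact (a + k) * fact (N - k)) *
     (2 * fact (N - k + b) * fact (a + k + q) / fact (N - k + b + (a + k + q) + 1)) =
     (2 * fact q / (fact (N + a + b + q + 1) * fact N)) *
      ((-1) ^ k * real (N choose k) * real ((a + q + k) choose q))"
      unfolding e c1 c2 by (simp add: field_simps del: fact_Suc)
  qed
  have h4: "(2 * fact q / (fact (N + a + b + q + 1) * fact N)) *
     (\<Sum>k\<le>N. (-1) ^ k * real (N choose k) * real ((a + q + k) choose q)) =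
     (if q < N then 0 else 2 * fact q * (-1) ^ N * real ((a + q) choose (q - N)) / (fact (N + a + b + q + 1) * fact N))"
    unfolding alternating_choose_sum by simp
  show ?thesis
    using h1 unfolding h2 h3 h4 .
qed

text \<open>Substituting cos^2 = 1 - sin^2 gives a polynomial in sin^2(\<beta> / 2). Only its top
  coefficient is made explicit, because against a Jacobi sum of degree \<open>N\<close> all lower
  powers integrate to zero.\<close>

lemma jacobi_sum_poly:
  obtains c where "\<And>\<beta>. jacobi_sum N a b \<beta> =
      (\<Sum>q\<le>N. c q * (cos (\<beta> / 2) ^ b * sin (\<beta> / 2) ^ (a + 2 * q)))"
    and "c N = (-1) ^ N * real ((2 * N + a + b) choose N) / (fact (N + a) * fact (N + b))"
proof -
  define wt :: "nat \<Rightarrow> real" where "wt k = 1 / (fact (N + b - k) * fact k * fact (a + k) * fact (N - k))" for k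
  define p where "p = (\<Sum>k\<le>N. smult ((-1) ^ k * wt k) ([:1, -1:] ^ (N - k) * monom 1 k))"
  have dg: "degree ([:1, -1::real:] ^ (N - k) * monom 1 k) \<le> N" if "k \<le> N" for k
  proof -
    have "degree ([:1, -1::real:] ^ (N - k) * monom 1 k) \<le> degree ([:1, -1::real:] ^ (N - k)) + degree (monom (1::real) k)"
      by (rule degree_mult_le)
    also have "\<dots> \<le> N - k + k"
      by (intro add_mono) (auto simp: degree_monom_eq degree_linear_power intro: order_trans[OF degree_power_le])
    finally show ?thesis using that by simp
  qed
  have deg: "degree p \<le> N"
    unfolding p_def by (intro degree_sum_le) (auto intro: order_trans[OF degree_smult_le] dg)
  have lc: "coeff ([:1, -1::real:] ^ (N - k) * monom 1 k) N = (-1) ^ (N - k)" if "k \<le> N" for k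
  proof -
    have "degree [:1, -1::real:] = 1" by simp
    then have "degree ([:1, -1::real:] ^ (N - k)) = N - k"
      by (subst degree_power_eq) auto
    then have "coeff ([:1, -1::real:] ^ (N - k)) (N - k) = (-1) ^ (N - k)"
      using lead_coeff_power[of "[:1, -1::real:]" "N - k"] by simp
    then show ?thesis
      using that coeff_monom_mult[of "1::real" k "[:1, -1:] ^ (N - k)" N] by (simp add: mult.commute)
  qed
  have "coeff p N = (\<Sum>k\<le>N. (-1) ^ N * wt k)"
    unfolding p_def coeff_sum coeff_smult
  proof (intro sum.cong refl)
    fix k assume "k \<in> {..N}"
    then show "(-1) ^ k * wt k * coeff ([:1, -1:] ^ (N - k) * monom 1 k) N = (-1) ^ N * wt k"
      using lc[of k] power_add[of "-1::real" k "N - k"] by (simp add: mult.commute mult.left_commute)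
  qed
  also have "\<dots> = (-1) ^ N * (real (\<Sum>k\<le>N. ((N + b) choose k) * ((N + a) choose (N - k))) / (fact (N + a) * fact (N + b)))"
    unfolding sum_distrib_left of_nat_sum sum_divide_distrib
  proof (intro sum.cong refl)
    fix k assume "k \<in> {..N}"
    then have k: "k \<le> N" by simp
    have c1: "real ((N + b) choose k) = fact (N + b) / (fact k * fact (N + b - k))"
      using k by (intro binomial_fact) auto
    have c2: "real ((N + a) choose (N - k)) = fact (N + a) / (fact (N - k) * fact (a + k))"
      using binomial_fact[of "N - k" "N + a", where 'a=real] k by (simp add: add.commute)
    show "(-1) ^ N * wt k = (-1) ^ N * (real (((N + b) choose k) * ((N + a) choose (N - k))) / (fact (N + a) * fact (N + b)))"
      unfolding of_nat_mult c1 c2 wt_def by (simp add: field_simps)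
  qed
  \<comment> \<open>The signs \<open>(-1) ^ k\<close> and \<open>(-1) ^ (N - k)\<close> combine to a
    common one, so the top coefficients add up without cancellation, by Vandermonde's
    convolution.\<close>
  also have "(\<Sum>k\<le>N. ((N + b) choose k) * ((N + a) choose (N - k))) = (2 * N + a + b) choose N"
    by (subst vandermonde) (simp add: mult_2 add_ac)
  finally have cN: "coeff p N = (-1) ^ N * real ((2 * N + a + b) choose N) / (fact (N + a) * fact (N + b))"
    by simp
  have "jacobi_sum N a b \<beta> = (\<Sum>q\<le>N. coeff p q * (cos (\<beta> / 2) ^ b * sin (\<beta> / 2) ^ (a + 2 * q)))" for \<beta>
  proof -
    have c2: "1 - (sin (\<beta> / 2))\<^sup>2 = (cos (\<beta> / 2))\<^sup>2" by (simp add: cos_squared_eq)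
    have "(\<Sum>q\<le>N. coeff p q * (cos (\<beta> / 2) ^ b * sin (\<beta> / 2) ^ (a + 2 * q))) =
      cos (\<beta> / 2) ^ b * sin (\<beta> / 2) ^ a * (\<Sum>q\<le>N. coeff p q * ((sin (\<beta> / 2))\<^sup>2) ^ q)"
      unfolding sum_distrib_left by (intro sum.cong refl) (simp add: power_add power_mult)
    also have "(\<Sum>q\<le>N. coeff p q * ((sin (\<beta> / 2))\<^sup>2) ^ q) = poly p ((sin (\<beta> / 2))\<^sup>2)"
      unfolding poly_altdef using deg
      by (intro sum.mono_neutral_right) (auto simp: coeff_eq_0)
    also have "\<dots> = (\<Sum>k\<le>N. (-1) ^ k * wt k * (((cos (\<beta> / 2))\<^sup>2) ^ (N - k) * ((sin (\<beta> / 2))\<^sup>2) ^ k))"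
      unfolding p_def poly_sum by (simp add: poly_monom c2)
    also have "cos (\<beta> / 2) ^ b * sin (\<beta> / 2) ^ a * \<dots> = jacobi_sum N a b \<beta>"
      unfolding jacobi_sum_def sum_distrib_left
      by (intro sum.cong refl) (simp add: wt_def power_add power_mult)
    finally show ?thesis by simp
  qed
  then show ?thesis using cN that by blast
qed

text \<open>The factor of smaller degree is expanded in powers; the moments against the other factor
  vanish below \<open>N\<close>, so at most the term \<open>q = N = N'\<close> survives.\<close>

lemma jacobi_sum_orthogonal_le:
  assumes "N' \<le> N"
  shows "((\<lambda>\<beta>. jacobi_sum N a b \<beta> * jacobi_sum N' a b \<beta> * sin \<beta>) has_integral
    (if N = N' then 2 / (real (2 * N + a + b + 1) * (fact (N + a + b) * fact N * fact (N + b) * fact (N + a))) else 0)) {0..pi}"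
proof -
  obtain c where c: "\<And>\<beta>. jacobi_sum N' a b \<beta> =
      (\<Sum>q\<le>N'. c q * (cos (\<beta> / 2) ^ b * sin (\<beta> / 2) ^ (a + 2 * q)))"
    and cN: "c N' = (-1) ^ N' * real ((2 * N' + a + b) choose N') / (fact (N' + a) * fact (N' + b))"
    using jacobi_sum_poly by blast
  define I where "I q = (if q < N then 0 else 2 * fact q * (-1) ^ N * real ((a + q) choose (q - N)) / (fact (N + a + b + q + 1) * fact N))" for q
  have "((\<lambda>\<beta>. \<Sum>q\<le>N'. c q * (jacobi_sum N a b \<beta> * (cos (\<beta> / 2) ^ b * sin (\<beta> / 2) ^ (a + 2 * q)) * sin \<beta>)) has_integral
     (\<Sum>q\<le>N'. c q * I q)) {0..pi}"
    unfolding I_def by (intro has_integral_sum has_integral_mult_right jacobi_sum_moment) auto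
  moreover have "(\<Sum>q\<le>N'. c q * (jacobi_sum N a b \<beta> * (cos (\<beta> / 2) ^ b * sin (\<beta> / 2) ^ (a + 2 * q)) * sin \<beta>))
      = jacobi_sum N a b \<beta> * jacobi_sum N' a b \<beta> * sin \<beta>" for \<beta>
    unfolding c sum_distrib_left sum_distrib_right by (intro sum.cong refl) (simp add: mult_ac)
  moreover have "(\<Sum>q\<le>N'. c q * I q) =
     (if N = N' then 2 / (real (2 * N + a + b + 1) * (fact (N + a + b) * fact N * fact (N + b) * fact (N + a))) else 0)"
  proof (cases "N = N'")
    case False
    then show ?thesis using assms by (auto intro!: sum.neutral simp: I_def)
  next
    case True
    have "(\<Sum>q\<le>N'. c q * I q) = (\<Sum>q\<in>{N'}. c q * I q)"
      by (intro sum.mono_neutral_right) (auto simp: I_def True)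
    also have "\<dots> = c N * (2 * (-1) ^ N / fact (2 * N + a + b + 1))"
    proof -
      have e: "N + a + b + N + 1 = 2 * N + a + b + 1" by simp
      have "I N = 2 * (-1) ^ N / fact (2 * N + a + b + 1)" unfolding I_def e by simp
      then show ?thesis by (simp add: True)
    qed
    also have "\<dots> = 2 * real ((2 * N + a + b) choose N) / (fact (N + a) * fact (N + b) * fact (2 * N + a + b + 1))"
      using cN True by (simp add: power_add[symmetric] mult_2[symmetric] del: fact_Suc)
    also have "real ((2 * N + a + b) choose N) = fact (2 * N + a + b) / (fact N * fact (N + a + b))"
      using binomial_fact[of N "2 * N + a + b", where 'a=real] by (simp add: mult_2 add_ac)
    finally have "(\<Sum>q\<le>N'. c q * I q) = 2 * (fact (2 * N + a + b) / (fact N * fact (N + a + b))) /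
      (fact (N + a) * fact (N + b) * (real (2 * N + a + b + 1) * fact (2 * N + a + b)))"
      by simp
    moreover have "2 * (F / (x * y)) / (u * v * (k * F)) = 2 / (k * (y * x * v * u))" if "F \<noteq> 0" for F x y u v k :: real
      using that by simp
    ultimately show ?thesis using True by simp
  qed
  ultimately show ?thesis by simp
qed

text \<open>In the sector \<open>\<bar>n\<bar> \<le> m\<close> the summation range of Wigner's
  formula is \<open>0..l - m\<close> and both exponents \<open>m - n\<close>, \<open>m + n\<close>
  are nonnegative. The remaining sectors are reached by the two symmetries below.\<close>

lemma wigner_d_eq_jacobi_sum:
  assumes "\<bar>n\<bar> \<le> m" "m \<le> int l"
  shows "wigner_d l m n \<beta> = (-1) ^ nat (m - n) *
    sqrt (fact (nat (int l + m)) * fact (nat (int l - m)) * fact (nat (int l + n)) * fact (nat (int l - n))) *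
    jacobi_sum (nat (int l - m)) (nat (m - n)) (nat (m + n)) \<beta>"
proof -
  define N a b where "N = nat (int l - m)" and "a = nat (m - n)" and "b = nat (m + n)"
  define S where "S = sqrt (fact (nat (int l + m)) * fact (nat (int l - m)) * fact (nat (int l + n)) * fact (nat (int l - n)))"
  have r: "max 0 (n - m) = 0" "min (int l + n) (int l - m) = int N"
    using assms by (auto simp: N_def)
  have "wigner_d l m n \<beta> = (\<Sum>k = 0..int N.
        (-1) powi (m - n + k) * S /
        (fact (nat (int l + n - k)) * fact (nat k) *
         fact (nat (m - n + k)) * fact (nat (int l - m - k))) *
        cos (\<beta> / 2) ^ nat (2 * int l + n - m - 2 * k) *
        sin (\<beta> / 2) ^ nat (m - n + 2 * k))"
    unfolding wigner_d_def r S_def ..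
  also have "\<dots> = (\<Sum>k\<le>N. (-1) ^ a * S * ((-1) ^ k / (fact (N + b - k) * fact k * fact (a + k) * fact (N - k)) *
      cos (\<beta> / 2) ^ (2 * (N - k) + b) * sin (\<beta> / 2) ^ (a + 2 * k)))"
  proof (rule sum.reindex_bij_witness[of _ int nat])
    fix k assume "k \<in> {0..int N}"
    then obtain k' where k': "k = int k'" "k' \<le> N" by (metis atLeastAtMost_iff nonneg_int_cases of_nat_le_iff)
    have *: "nat (int l + n - k) = N + b - k'" "nat k = k'" "nat (m - n + k) = a + k'"
      "nat (int l - m - k) = N - k'" "nat (2 * int l + n - m - 2 * k) = 2 * (N - k') + b"
      "nat (m - n + 2 * k) = a + 2 * k'" "m - n + k = int (a + k')"
      using assms k' by (auto simp: N_def a_def b_def)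
    show "(-1) ^ a * S * ((-1) ^ nat k / (fact (N + b - nat k) * fact (nat k) * fact (a + nat k) * fact (N - nat k)) *
      cos (\<beta> / 2) ^ (2 * (N - nat k) + b) * sin (\<beta> / 2) ^ (a + 2 * nat k)) =
      (-1) powi (m - n + k) * S /
        (fact (nat (int l + n - k)) * fact (nat k) *
         fact (nat (m - n + k)) * fact (nat (int l - m - k))) *
        cos (\<beta> / 2) ^ nat (2 * int l + n - m - 2 * k) *
        sin (\<beta> / 2) ^ nat (m - n + 2 * k)"
      unfolding *(1-6) unfolding *(7) power_int_of_nat by (simp add: power_add)
  qed auto
  also have "\<dots> = (-1) ^ a * S * jacobi_sum N a b \<beta>"
    unfolding jacobi_sum_def sum_distrib_left ..
  finally show ?thesis unfolding N_def a_def b_def S_def .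
qed

lemma wigner_d_neg: "wigner_d l (- n) (- m) \<beta> = wigner_d l m n \<beta>"
  unfolding wigner_d_def
  by (intro sum.cong) (auto simp: algebra_simps min.commute)

text \<open>Shifting \<open>k\<close> by \<open>m - n\<close> exchanges the factorials of
  \<open>k\<close> and \<open>m - n + k\<close> and leaves the half-angle powers alone, so only a
  constant sign remains.\<close>

lemma wigner_d_swap: "wigner_d l n m \<beta> = (-1) powi (m - n) * wigner_d l m n \<beta>"
  unfolding wigner_d_def sum_distrib_left
proof (rule sum.reindex_bij_witness[of _ "\<lambda>k. k + (m - n)" "\<lambda>k. k - (m - n)"], goal_cases)
  case (5 k)
  have e: "int l + n - (k - (m - n)) = int l + m - k" "m - n + (k - (m - n)) = k"
    "int l - m - (k - (m - n)) = int l - n - k"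
    "2 * int l + n - m - 2 * (k - (m - n)) = 2 * int l + m - n - 2 * k"
    "m - n + 2 * (k - (m - n)) = n - m + 2 * k" "k - (m - n) = n - m + k"
    by auto
  have p: "(-1) powi (n - m + k) = (-1::real) powi (m - n) * (-1) powi k"
    using power_int_minus_one_diff_commute[of n m, where 'a=real] by (simp add: power_int_add)
  show ?case
    unfolding e(1-5) unfolding e(6) p by (simp only: mult_ac times_divide_eq_right times_divide_eq_left)
qed auto

theorem wigner_d_orthogonal:
  assumes "\<bar>m\<bar> \<le> int l" "\<bar>n\<bar> \<le> int l" "\<bar>m\<bar> \<le> int l'" "\<bar>n\<bar> \<le> int l'"
  shows "((\<lambda>\<beta>. wigner_d l m n \<beta> * wigner_d l' m n \<beta> * sin \<beta>) has_integral
    (if l = l' then 2 / (2 * real l + 1) else 0)) {0..pi}"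
proof -
  have main: "((\<lambda>\<beta>. wigner_d l m n \<beta> * wigner_d l' m n \<beta> * sin \<beta>) has_integral
    (if l = l' then 2 / (2 * real l + 1) else 0)) {0..pi}"
    if "\<bar>n\<bar> \<le> m" "m \<le> int l'" "l' \<le> l" for m n l l'
  proof -
    define N N' a b where "N = nat (int l - m)" and "N' = nat (int l' - m)" and "a = nat (m - n)" and "b = nat (m + n)"
    have e: "nat (int l + m) = N + a + b" "nat (int l + n) = N + b" "nat (int l - n) = N + a"
      "2 * l = 2 * N + a + b"
      "N' \<le> N" "(N = N') = (l = l')"
      using that by (auto simp: N_def N'_def a_def b_def)
    define S where "S l = sqrt (fact (nat (int l + m)) * fact (nat (int l - m)) * fact (nat (int l + n)) * fact (nat (int l - n)))" for l
    have eq: "wigner_d l m n \<beta> * wigner_d l' m n \<beta> * sin \<beta> =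
       S l * S l' * (jacobi_sum N a b \<beta> * jacobi_sum N' a b \<beta> * sin \<beta>)" for \<beta>
      using that unfolding S_def N_def N'_def a_def b_def
      by (simp add: wigner_d_eq_jacobi_sum flip: power_mult_distrib)
    \<comment> \<open>For \<open>l = l'\<close> the squared prefactor cancels all factorials in the
      Jacobi norm and leaves 2 / (2 N + a + b + 1), where 2 N + a + b = 2 l.\<close>
    have "S l * S l = fact (N + a + b) * fact N * fact (N + b) * fact (N + a)"
      unfolding S_def e N_def[symmetric] by (simp flip: power2_eq_square)
    moreover have "2 * real l = 2 * real N + real a + real b"
      using e(4) by linarith
    ultimately have v: "S l * S l' * (if N = N' then 2 / (real (2 * N + a + b + 1) * (fact (N + a + b) * fact N * fact (N + b) * fact (N + a))) else 0)
      = (if l = l' then 2 / (2 * real l + 1) else 0)"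
      using e(6) by (auto simp: add_ac)
    show ?thesis
      using has_integral_mult_right[OF jacobi_sum_orthogonal_le[OF e(5), of a b], of "S l * S l'"]
      unfolding v eq .
  qed
  have main2: "((\<lambda>\<beta>. wigner_d l m n \<beta> * wigner_d l' m n \<beta> * sin \<beta>) has_integral
    (if l = l' then 2 / (2 * real l + 1) else 0)) {0..pi}"
    if "\<bar>n\<bar> \<le> m" "m \<le> int l" "m \<le> int l'" for m n
  proof (cases "l' \<le> l")
    case True
    then show ?thesis using main that by blast
  next
    case False
    then show ?thesis using main[of n m l l'] that by (simp add: mult.commute eq_commute)
  qed
  \<comment> \<open>The sign produced by exchanging the orders occurs in both factors and squares to
    one.\<close>
  have sw: "wigner_d l n m \<beta> * wigner_d l' n m \<beta> = wigner_d l m n \<beta> * wigner_d l' m n \<beta>" for m n \<beta>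
    unfolding wigner_d_swap[of _ n m] by (simp add: power_int_minus_one_mult_self' mult_ac flip: power_int_add)
  \<comment> \<open>The four sectors cover the plane of orders; \<open>wigner_d_neg\<close> and
    \<open>sw\<close> map each of them to the sector \<open>\<bar>n\<bar> \<le> m\<close>.\<close>
  consider "\<bar>n\<bar> \<le> m" | "\<bar>m\<bar> \<le> n" | "\<bar>n\<bar> \<le> - m" | "\<bar>m\<bar> \<le> - n" by linarith
  then show ?thesis
  proof cases
    case 1
    then show ?thesis using main2 assms by simp
  next
    case 2
    then show ?thesis using main2[of m n] assms unfolding sw by simp
  next
    case 3
    then show ?thesis using main2[of "- n" "- m"] assms by (simp add: wigner_d_neg sw[where m=m and n=n])
  next
    case 4
    then show ?thesis using main2[of "- m" "- n"] assms unfolding wigner_d_neg by simp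
  qed
qed

section \<open>Spin harmonics on the sphere\<close>

lemma borel_measurable_cnj [measurable]: "cnj \<in> borel_measurable borel"
  by (intro borel_measurable_continuous_onI continuous_intros)

lemma sphere_point_eq:
  "sphere_point \<theta> \<phi> = (\<chi> i. if i = 1 then sin \<theta> * cos \<phi> else if i = 2 then sin \<theta> * sin \<phi> else cos \<theta>)"
  by (simp add: sphere_point_def vec_eq_iff forall_3)

lemma continuous_sphere_point: "continuous_on UNIV (\<lambda>(\<theta>, \<phi>). sphere_point \<theta> \<phi>)"
proof -
  have "continuous_on UNIV (\<lambda>p :: real \<times> real. if i = (1 :: 3) then sin (fst p) * cos (snd p)
      else if i = 2 then sin (fst p) * sin (snd p) else cos (fst p))" for i
    by (cases "i = 1"; cases "i = 2") (auto intro!: continuous_intros)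
  then show ?thesis
    unfolding sphere_point_eq case_prod_beta by (rule continuous_on_vec_lambda)
qed

lemma norm_sphere_point: "norm (sphere_point \<theta> \<phi>) = 1"
proof -
  have "(norm (sphere_point \<theta> \<phi>))\<^sup>2 = (sin \<theta> * cos \<phi>)\<^sup>2 + (sin \<theta> * sin \<phi>)\<^sup>2 + (cos \<theta>)\<^sup>2"
    unfolding power2_norm_eq_inner inner_vec_def sum_3 sphere_point_def
    by (simp add: power2_eq_square)
  also have "\<dots> = (sin \<theta>)\<^sup>2 * ((cos \<phi>)\<^sup>2 + (sin \<phi>)\<^sup>2) + (cos \<theta>)\<^sup>2"
    by (simp only: power_mult_distrib distrib_left)
  also have "\<dots> = 1" by simp
  finally have "(norm (sphere_point \<theta> \<phi>))\<^sup>2 = 1" .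
  then show ?thesis
    using norm_ge_zero[of "sphere_point \<theta> \<phi>"] by (auto simp: power2_eq_1_iff simp del: norm_ge_zero)
qed

abbreviation angle_box :: "(real \<times> real) set" where "angle_box \<equiv> {0..pi} \<times> {0..2 * pi}"

lemma angle_box_sets: "angle_box \<in> sets borel"
  by (simp add: borel_prod[symmetric])

lemma measurable_sphere_point [measurable]:
  "(\<lambda>(\<theta>, \<phi>). sphere_point \<theta> \<phi>) \<in>
     measurable (density (restrict_space lborel angle_box) d) (restrict_space borel (sphere 0 1))"
proof -
  have "(\<lambda>(\<theta>, \<phi>). sphere_point \<theta> \<phi>) \<in> borel_measurable (borel :: (real \<times> real) measure)"
    by (intro borel_measurable_continuous_onI continuous_sphere_point)
  then have "(\<lambda>(\<theta>, \<phi>). sphere_point \<theta> \<phi>) \<in> measurable (restrict_space lborel angle_box) borel"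
    by (intro measurable_restrict_space1) simp
  then have "(\<lambda>(\<theta>, \<phi>). sphere_point \<theta> \<phi>) \<in> measurable (restrict_space lborel angle_box) (restrict_space borel (sphere 0 1))"
    by (intro measurable_restrict_space2) (auto simp: norm_sphere_point)
  then show ?thesis by simp
qed

lemma space_sphere_measure [simp]: "space sphere_measure = sphere 0 1"
  by (simp add: sphere_measure_def space_restrict_space)

lemma sets_sphere_measure [measurable_cong]: "sets sphere_measure = sets (restrict_space borel (sphere 0 1))"
  by (simp add: sphere_measure_def)

lemma measurable_sin_fst [measurable]: "(\<lambda>(\<theta>, \<phi>). sin \<theta>) \<in> borel_measurable (restrict_space (lborel :: (real \<times> real) measure) A)"
  by (intro measurable_restrict_space1) (simp add: borel_prod[symmetric])

lemma integral_sphere_measure: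
  fixes f :: "real ^ 3 \<Rightarrow> complex"
  assumes "f \<in> borel_measurable (restrict_space borel (sphere 0 1))"
  shows "(LINT x|sphere_measure. f x) =
    (LINT p|lborel. indicator angle_box p *\<^sub>R (case p of (\<theta>, \<phi>) \<Rightarrow> sin \<theta> *\<^sub>R f (sphere_point \<theta> \<phi>)))"
proof -
  let ?d = "\<lambda>p :: real \<times> real. case p of (\<theta>, \<phi>) \<Rightarrow> sin \<theta>"
  have [measurable]: "f \<in> borel_measurable (restrict_space borel (sphere 0 1))" by fact
  have d: "(\<lambda>(\<theta>::real, \<phi>::real). ennreal (sin \<theta>)) = (\<lambda>p. ennreal (?d p))"
    by (auto simp: fun_eq_iff)
  have m: "(\<lambda>p. f (case p of (\<theta>, \<phi>) \<Rightarrow> sphere_point \<theta> \<phi>)) \<in> borel_measurable (restrict_space lborel angle_box)"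
    using measurable_compose[OF measurable_sphere_point[of "\<lambda>_. 1"] assms] by simp
  have "(LINT x|sphere_measure. f x) = (LINT p|density (restrict_space lborel angle_box) (\<lambda>p. ennreal (?d p)). f (case p of (\<theta>, \<phi>) \<Rightarrow> sphere_point \<theta> \<phi>))"
    unfolding sphere_measure_def d by (intro integral_distr measurable_sphere_point assms)
  also have "\<dots> = (LINT p|restrict_space lborel angle_box. ?d p *\<^sub>R f (case p of (\<theta>, \<phi>) \<Rightarrow> sphere_point \<theta> \<phi>))"
  proof (rule integral_density[OF m measurable_sin_fst])
    show "AE p in restrict_space lborel angle_box. 0 \<le> ?d p"
      by (rule AE_I2) (auto simp: space_restrict_space sin_ge_zero)
  qed
  also have "\<dots> = (LINT p|lborel. indicator angle_box p *\<^sub>R (?d p *\<^sub>R f (case p of (\<theta>, \<phi>) \<Rightarrow> sphere_point \<theta> \<phi>)))"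
    by (rule integral_restrict_space) (use angle_box_sets in simp)
  also have "\<dots> = (LINT p|lborel. indicator angle_box p *\<^sub>R (case p of (\<theta>, \<phi>) \<Rightarrow> sin \<theta> *\<^sub>R f (sphere_point \<theta> \<phi>)))"
    by (intro Bochner_Integration.integral_cong) auto
  finally show ?thesis .
qed

lemma finite_measure_sphere: "finite_measure sphere_measure"
proof (rule finite_measureI)
  have "emeasure sphere_measure (space sphere_measure) =
     (\<integral>\<^sup>+p. ennreal (case p of (\<theta>, \<phi>) \<Rightarrow> sin \<theta>) * indicator (space (restrict_space lborel angle_box)) p \<partial>restrict_space lborel angle_box)"
  proof -
    have v: "(\<lambda>(\<theta>, \<phi>). sphere_point \<theta> \<phi>) -` sphere 0 1 \<inter> angle_box = angle_box"
      by (auto simp: norm_sphere_point)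
    have d: "(\<lambda>(\<theta>::real, \<phi>::real). ennreal (sin \<theta>)) = (\<lambda>p. ennreal (case p of (\<theta>, \<phi>) \<Rightarrow> sin \<theta>))"
      by (auto simp: fun_eq_iff)
    have "emeasure sphere_measure (space sphere_measure) =
      emeasure (density (restrict_space lborel angle_box) (\<lambda>p. ennreal (case p of (\<theta>, \<phi>) \<Rightarrow> sin \<theta>))) angle_box"
      unfolding sphere_measure_def d
      by (subst emeasure_distr[OF measurable_sphere_point]) (auto simp: v space_restrict_space sets_restrict_space_iff)
    also have "\<dots> = (\<integral>\<^sup>+p. ennreal (case p of (\<theta>, \<phi>) \<Rightarrow> sin \<theta>) * indicator angle_box p \<partial>restrict_space lborel angle_box)"
      by (rule emeasure_density) (use angle_box_sets in \<open>auto simp: sets_restrict_space_iff intro!: measurable_compose[OF measurable_sin_fst]\<close>)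
    finally show ?thesis by (simp add: space_restrict_space)
  qed
  also have "\<dots> \<le> (\<integral>\<^sup>+p. 1 \<partial>restrict_space lborel angle_box)"
    by (intro nn_integral_mono) (auto simp: indicator_def ennreal_le_1)
  also have "\<dots> = emeasure lborel angle_box"
    using angle_box_sets by (simp add: emeasure_restrict_space space_restrict_space)
  also have "\<dots> < \<infinity>"
    by (intro emeasure_bounded_finite bounded_Times) auto
  finally show "emeasure sphere_measure (space sphere_measure) \<noteq> \<infinity>" by simp
qed

interpretation sphere: finite_measure sphere_measure
  by (rule finite_measure_sphere)

lemma integral_lborel_times:
  fixes u v :: "real \<Rightarrow> complex"
  assumes "integrable lborel u" "integrable lborel v"
  shows "(LINT p|lborel. u (fst p) * v (snd p)) = (LINT x|lborel. u x) * (LINT y|lborel. v y)"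
proof -
  have [measurable]: "u \<in> borel_measurable lborel" "v \<in> borel_measurable lborel" using assms by auto
  have "integrable (lborel \<Otimes>\<^sub>M lborel) (\<lambda>p. u (fst p) * v (snd p))"
  proof (rule lborel_pair.Fubini_integrable)
    show "integrable lborel (\<lambda>x. LINT y|lborel. norm (u (fst (x, y)) * v (snd (x, y))))"
      using assms by (simp add: norm_mult)
    show "AE x in lborel. integrable lborel (\<lambda>y. u (fst (x, y)) * v (snd (x, y)))"
      using assms by simp
  qed measurable
  from lborel_pair.integral_fst'[OF this] show ?thesis
    by (simp add: lborel_prod assms)
qed

text \<open>The factorization is required only off the poles. There the longitude is arbitrary, but
  the density \<open>sin \<theta>\<close> vanishes.\<close>

lemma integral_sphere_measure_separable:
  fixes f :: "real ^ 3 \<Rightarrow> complex" and u v :: "real \<Rightarrow> complex"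
  assumes f: "f \<in> borel_measurable (restrict_space borel (sphere 0 1))"
    and u: "continuous_on {0..pi} u" and v: "continuous_on {0..2 * pi} v"
    and eq: "\<And>\<theta> \<phi>. 0 < \<theta> \<Longrightarrow> \<theta> < pi \<Longrightarrow> f (sphere_point \<theta> \<phi>) = u \<theta> * v \<phi>"
  shows "(LINT x|sphere_measure. f x) = integral {0..pi} (\<lambda>\<theta>. sin \<theta> * u \<theta>) * integral {0..2 * pi} v"
proof -
  define u' where "u' \<theta> = indicator {0..pi} \<theta> *\<^sub>R (complex_of_real (sin \<theta>) * u \<theta>)" for \<theta>
  define v' where "v' \<phi> = indicator {0..2 * pi} \<phi> *\<^sub>R v \<phi>" for \<phi>
  have su: "set_integrable lborel {0..pi} (\<lambda>\<theta>. complex_of_real (sin \<theta>) * u \<theta>)"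
    by (intro borel_integrable_atLeastAtMost' continuous_intros u)
  have sv: "set_integrable lborel {0..2 * pi} v"
    by (intro borel_integrable_atLeastAtMost' v)
  have "(LINT x|sphere_measure. f x) = (LINT p|lborel. u' (fst p) * v' (snd p))"
    unfolding integral_sphere_measure[OF f]
  proof (intro Bochner_Integration.integral_cong refl)
    fix p :: "real \<times> real"
    obtain \<theta> \<phi> where p: "p = (\<theta>, \<phi>)" by (cases p)
    show "indicator angle_box p *\<^sub>R (case p of (\<theta>, \<phi>) \<Rightarrow> sin \<theta> *\<^sub>R f (sphere_point \<theta> \<phi>)) = u' (fst p) * v' (snd p)"
    proof (cases "0 < \<theta> \<and> \<theta> < pi")
      case True
      then show ?thesis
        by (auto simp: p u'_def v'_def eq indicator_def scaleR_conv_of_real)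
    next
      case False
      then have "\<theta> \<in> {0..pi} \<Longrightarrow> \<theta> = 0 \<or> \<theta> = pi" by auto
      then have "\<theta> \<in> {0..pi} \<Longrightarrow> sin \<theta> = 0" by auto
      then show ?thesis
        by (auto simp: p u'_def v'_def indicator_def)
    qed
  qed
  also have "\<dots> = (LINT x|lborel. u' x) * (LINT y|lborel. v' y)"
    using su sv by (intro integral_lborel_times) (simp_all add: u'_def[abs_def] v'_def[abs_def] set_integrable_def)
  also have "(LINT x|lborel. u' x) = integral {0..pi} (\<lambda>\<theta>. sin \<theta> * u \<theta>)"
    using set_borel_integral_eq_integral(2)[OF su] by (simp add: u'_def[abs_def] set_lebesgue_integral_def)
  also have "(LINT y|lborel. v' y) = integral {0..2 * pi} v"
    using set_borel_integral_eq_integral(2)[OF sv] by (simp add: v'_def[abs_def] set_lebesgue_integral_def)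
  finally show ?thesis .
qed

text \<open>Integer powers of \<open>z / cmod z\<close> do not see the branch cut of
  \<open>Arg\<close>. This gives Borel measurability of the phase, and lets a longitude in [0, 2 pi]
  be replaced by the principal argument in the chart.\<close>

lemma cis_int_mult_Arg:
  "z \<noteq> 0 \<Longrightarrow> cis (of_int m * Arg z) = (if 0 \<le> m then (z / cmod z) ^ nat m else cnj (z / cmod z) ^ nat (- m))"
proof -
  assume "z \<noteq> 0"
  then have c: "cis (Arg z) = z / cmod z" by (simp add: cis_Arg sgn_eq)
  have "cnj (cis (Arg z)) ^ nat (- m) = cis (of_int m * Arg z)" if "m < 0"
    using that by (simp add: cis_cnj Complex.DeMoivre)
  moreover have "cis (Arg z) ^ nat m = cis (of_int m * Arg z)" if "0 \<le> m"
    using that by (simp add: Complex.DeMoivre)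
  ultimately show ?thesis unfolding c by auto
qed

lemma measurable_cis_longitude [measurable]:
  "(\<lambda>x. cis (of_int m * longitude x)) \<in> borel_measurable borel"
proof -
  define z where "z x = Complex (x $ 1) (x $ 2)" for x :: "real ^ 3"
  have "continuous_on UNIV z"
    unfolding z_def Complex_eq by (intro continuous_intros)
  then have [measurable]: "z \<in> borel_measurable borel"
    by (rule borel_measurable_continuous_onI)
  have eq: "cis (of_int m * longitude x) =
      (if z x = 0 then 1 else if 0 \<le> m then (z x / cmod (z x)) ^ nat m else cnj (z x / cmod (z x)) ^ nat (- m))" for x
    using cis_int_mult_Arg[of "z x" m] by (auto simp: longitude_def z_def Arg_zero)
  show ?thesis unfolding eq by measurable
qed

lemma continuous_wigner_d: "continuous_on A (wigner_d l m n)"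
  unfolding wigner_d_def[abs_def] by (intro continuous_intros) auto

lemma measurable_spin_harmonic [measurable]:
  "spin_harmonic s l m \<in> borel_measurable (restrict_space borel (sphere 0 1))"
proof -
  have c: "continuous_on (sphere 0 1) colatitude"
    unfolding colatitude_def
  proof (intro continuous_on_arccos continuous_intros ballI)
    fix x :: "real ^ 3" assume "x \<in> sphere 0 1"
    then have "\<bar>x $ 3\<bar> \<le> 1" using component_le_norm_cart[of x 3] by simp
    then show "- 1 \<le> x $ 3 \<and> x $ 3 \<le> 1" by linarith
  qed
  have "continuous_on (sphere 0 1) (\<lambda>x. wigner_d l (- m) s (colatitude x))"
    by (rule continuous_on_compose2[OF continuous_wigner_d[of UNIV] c]) auto
  then have [measurable]: "(\<lambda>x. wigner_d l (- m) s (colatitude x)) \<in> borel_measurable (restrict_space borel (sphere 0 1))"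
    by (rule borel_measurable_continuous_on_restrict)
  have [measurable]: "(\<lambda>x. cis (of_int m * longitude x)) \<in> borel_measurable (restrict_space borel (sphere 0 1))"
    by (intro measurable_restrict_space1) measurable
  show ?thesis unfolding spin_harmonic_def[abs_def] by measurable
qed

lemma measurable_spin_harmonic_sphere [measurable]:
  "spin_harmonic s l m \<in> borel_measurable sphere_measure"
  by (simp cong: measurable_cong_sets add: sets_sphere_measure)

lemma spin_harmonic_sphere_point:
  assumes "0 < \<theta>" "\<theta> < pi"
  shows "spin_harmonic s l m (sphere_point \<theta> \<phi>) =
     (-1) powi m * of_real (sqrt ((2 * real l + 1) / (4 * pi))) * of_real (wigner_d l (- m) s \<theta>) * cis (of_int m * \<phi>)"
proof -
  have s: "0 < sin \<theta>" using assms by (simp add: sin_gt_zero)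
  define z where "z = Complex (sin \<theta> * cos \<phi>) (sin \<theta> * sin \<phi>)"
  have z: "z = sin \<theta> * cis \<phi>" by (simp add: z_def complex_eq_iff)
  then have "z \<noteq> 0" "z / cmod z = cis \<phi>" using s by (simp_all add: norm_mult)
  moreover have "cnj (cis \<phi>) ^ nat (- m) = cis (of_int m * \<phi>)" if "m < 0"
    using that by (simp add: cis_cnj Complex.DeMoivre)
  moreover have "cis \<phi> ^ nat m = cis (of_int m * \<phi>)" if "0 \<le> m"
    using that by (simp add: Complex.DeMoivre)
  ultimately have "cis (of_int m * Arg z) = cis (of_int m * \<phi>)"
    using cis_int_mult_Arg[of z m] by (simp split: if_splits)
  then show ?thesis
    using assms by (simp add: spin_harmonic_def longitude_def colatitude_def sphere_point_def z_def arccos_cos)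
qed

lemma bounded_spin_harmonic:
  obtains c where "0 < c" "\<And>x. x \<in> sphere 0 1 \<Longrightarrow> cmod (spin_harmonic s l m x) \<le> c"
proof -
  have "compact (wigner_d l (- m) s ` {0..pi})"
    by (intro compact_continuous_image continuous_wigner_d) auto
  then have "bounded (wigner_d l (- m) s ` {0..pi})" by (rule compact_imp_bounded)
  then obtain c where c: "\<And>\<theta>. \<theta> \<in> {0..pi} \<Longrightarrow> \<bar>wigner_d l (- m) s \<theta>\<bar> \<le> c" "c > 0"
    unfolding bounded_pos by (metis imageI real_norm_def)
  show ?thesis
  proof (rule that)
    show "0 < sqrt ((2 * real l + 1) / (4 * pi)) * c" using c by simp
    fix x :: "real ^ 3" assume "x \<in> sphere 0 1"
    then have "\<bar>x $ 3\<bar> \<le> 1" using component_le_norm_cart[of x 3] by simp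
    then have "colatitude x \<in> {0..pi}" by (auto simp: colatitude_def arccos_lbound arccos_ubound)
    then show "cmod (spin_harmonic s l m x) \<le> sqrt ((2 * real l + 1) / (4 * pi)) * c"
      using c by (simp add: spin_harmonic_def norm_mult norm_power_int mult_left_mono)
  qed
qed

lemma integral_cis_int:
  "integral {0..2 * pi} (\<lambda>\<phi>. cis (of_int m * \<phi>)) = (if m = 0 then 2 * pi else 0)"
proof (cases "m = 0")
  case False
  have "((\<lambda>\<phi>. cis (of_int m * \<phi>)) has_integral
     (cis (of_int m * (2 * pi)) / (\<i> * of_int m) - cis (of_int m * 0) / (\<i> * of_int m))) {0..2 * pi}"
  proof (rule fundamental_theorem_of_calculus)
    fix x :: real
    have "((\<lambda>z. exp (\<i> * (of_int m * z)) / (\<i> * of_int m)) has_field_derivative exp (\<i> * (of_int m * of_real x))) (at (of_real x))"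
      using False by (auto intro!: derivative_eq_intros simp: mult_ac)
    from has_vector_derivative_real_field[OF this]
    show "((\<lambda>\<phi>. cis (of_int m * \<phi>) / (\<i> * of_int m)) has_vector_derivative cis (of_int m * x)) (at x within {0..2 * pi})"
      by (auto simp: cis_conv_exp intro: has_vector_derivative_at_within)
  qed simp
  moreover have "cis (of_int m * (2 * pi)) = 1"
    using cis_multiple_2pi[of "of_int m"] by (simp add: mult_ac)
  ultimately show ?thesis using False by (simp add: integral_unique)
qed (simp add: scaleR_conv_of_real)

text \<open>Integration over the longitude forces \<open>m = m'\<close>, so the Wigner functions are
  compared only at equal orders. The factors 2 pi and 2 / (2 l + 1) cancel the normalization (2 l +
  1) / (4 pi).\<close>

theorem spin_harmonic_orthonormal:
  assumes "\<bar>m\<bar> \<le> int l" "\<bar>m'\<bar> \<le> int l'" "\<bar>s\<bar> \<le> int l" "\<bar>s\<bar> \<le> int l'"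
  shows "(LINT x|sphere_measure. spin_harmonic s l m x * cnj (spin_harmonic s l' m' x)) =
    (if l = l' \<and> m = m' then 1 else 0)"
proof -
  define c :: complex where "c = (-1) powi m * (-1) powi m' * of_real (sqrt ((2 * real l + 1) / (4 * pi)) * sqrt ((2 * real l' + 1) / (4 * pi)))"
  define u where "u \<theta> = c * of_real (wigner_d l (- m) s \<theta> * wigner_d l' (- m') s \<theta>)" for \<theta>
  have "(LINT x|sphere_measure. spin_harmonic s l m x * cnj (spin_harmonic s l' m' x)) =
     integral {0..pi} (\<lambda>\<theta>. sin \<theta> * u \<theta>) * integral {0..2 * pi} (\<lambda>\<phi>. cis (of_int (m - m') * \<phi>))"
  proof (rule integral_sphere_measure_separable)
    show "(\<lambda>x. spin_harmonic s l m x * cnj (spin_harmonic s l' m' x)) \<in> borel_measurable (restrict_space borel (sphere 0 1))"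
      by measurable
    show "continuous_on {0..pi} u"
      unfolding u_def by (intro continuous_intros continuous_wigner_d)
    show "continuous_on {0..2 * pi} (\<lambda>\<phi>. cis (of_int (m - m') * \<phi>))"
      by (intro continuous_intros)
    fix \<theta> \<phi> :: real assume "0 < \<theta>" "\<theta> < pi"
    moreover have "cis (of_int (m - m') * \<phi>) = cis (of_int m * \<phi>) * cis (- (of_int m' * \<phi>))"
      by (simp add: cis_mult algebra_simps)
    ultimately show "spin_harmonic s l m (sphere_point \<theta> \<phi>) * cnj (spin_harmonic s l' m' (sphere_point \<theta> \<phi>)) =
       u \<theta> * cis (of_int (m - m') * \<phi>)"
      by (simp add: spin_harmonic_sphere_point u_def c_def cis_cnj)
  qed
  also have "\<dots> = (if l = l' \<and> m = m' then 1 else 0)"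
  proof (cases "m = m'")
    case True
    have "((\<lambda>\<theta>. c * of_real (wigner_d l (- m) s \<theta> * wigner_d l' (- m) s \<theta> * sin \<theta>)) has_integral
        c * of_real (if l = l' then 2 / (2 * real l + 1) else 0)) {0..pi}"
      using assms True by (intro has_integral_mult_right has_integral_of_real wigner_d_orthogonal) auto
    then have "integral {0..pi} (\<lambda>\<theta>. sin \<theta> * u \<theta>) = c * of_real (if l = l' then 2 / (2 * real l + 1) else 0)"
      by (intro integral_unique) (simp add: u_def True mult_ac)
    moreover have "c = (2 * real l + 1) / (4 * pi)" if "l = l'"
      using True that by (simp add: c_def flip: of_real_mult)
    moreover have "(2 * complex_of_nat l' + 1) \<noteq> 0"
      using of_nat_eq_0_iff[of "2 * l' + 1", where 'a = complex] by (simp add: add.commute)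
    ultimately show ?thesis
      unfolding integral_cis_int using True by (simp add: field_simps)
  next
    case False
    then show ?thesis unfolding integral_cis_int by simp
  qed
  finally show ?thesis .
qed

section \<open>Independence from characteristic functions\<close>

context prob_space
begin

lemma char_distr_eq:
  "X \<in> borel_measurable M \<Longrightarrow> char (distr M borel X) t = (CLINT \<omega>|M. iexp (t * X \<omega>))"
  by (simp add: char_def integral_distr)

lemma expectation_indicator_compose:
  assumes "A \<in> sets N" "X \<in> measurable M N"
  shows "expectation (\<lambda>\<omega>. indicator A (X \<omega>)) = prob (X -` A \<inter> space M)"
proof -
  have "(\<lambda>\<omega>. indicator A (X \<omega>) :: real) = indicator (X -` A)"
    by (auto simp: indicator_def fun_eq_iff)
  then show ?thesis by simp
qed

text \<open>Divided by its mean, \<open>Z\<close> is the density of a new probability measure. By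
  hypothesis \<open>X\<close> has the same characteristic function under it as under
  \<open>M\<close>, hence the same law, and this is the claim for indicators.\<close>

lemma nonneg_weight_factor:
  fixes Z X :: "'a \<Rightarrow> real"
  assumes Z [measurable]: "integrable M Z" and nonneg: "\<And>\<omega>. 0 \<le> Z \<omega>" and X [measurable]: "random_variable borel X"
    and eq: "\<And>s. (CLINT \<omega>|M. Z \<omega> * iexp (s * X \<omega>)) = expectation Z * (CLINT \<omega>|M. iexp (s * X \<omega>))"
    and A [measurable]: "A \<in> sets borel"
  shows "expectation (\<lambda>\<omega>. Z \<omega> * indicator A (X \<omega>)) = expectation Z * prob (X -` A \<inter> space M)"
proof (cases "expectation Z = 0")
  case True
  then have "AE \<omega> in M. Z \<omega> = 0"
    using integral_nonneg_eq_0_iff_AE[OF Z] nonneg by auto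
  then have "AE \<omega> in M. Z \<omega> * indicator A (X \<omega>) = 0" by auto
  then have "expectation (\<lambda>\<omega>. Z \<omega> * indicator A (X \<omega>)) = 0"
    by (rule integral_eq_zero_AE)
  then show ?thesis using True by simp
next
  case False
  define e where "e = expectation Z"
  have e: "e > 0" using False nonneg Bochner_Integration.integral_nonneg[of M Z] by (simp add: e_def order_less_le)
  define N where "N = density M (\<lambda>\<omega>. ennreal (Z \<omega> / e))"
  have [measurable_cong]: "sets N = sets M" by (simp add: N_def)
  have int_N: "(LINT \<omega>|N. f \<omega>) = (LINT \<omega>|M. (Z \<omega> / e) *\<^sub>R f \<omega>)"
    if "f \<in> borel_measurable M" for f :: "'a \<Rightarrow> 'b :: {banach, second_countable_topology}"
    unfolding N_def using that nonneg e by (intro integral_density) auto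
  have "emeasure N (space N) = (\<integral>\<^sup>+\<omega>. ennreal (Z \<omega> / e) \<partial>M)"
    by (simp add: N_def emeasure_density cong: nn_integral_cong)
  also have "\<dots> = ennreal (\<integral>\<omega>. Z \<omega> / e \<partial>M)"
    using nonneg e Z by (intro nn_integral_eq_integral) auto
  also have "\<dots> = 1" using e by (simp add: e_def)
  finally interpret N: prob_space N by (rule prob_spaceI)
  have [measurable]: "X \<in> borel_measurable N" by (simp add: N_def)
  have "distr N borel X = distr M borel X"
  proof (rule Levy_uniqueness)
    show "real_distribution (distr N borel X)" by (rule N.real_distribution_distr) simp
    show "real_distribution (distr M borel X)" by (rule real_distribution_distr) simp
    have "char (distr N borel X) s = char (distr M borel X) s" for s
    proof -
      have "char (distr N borel X) s = (CLINT \<omega>|N. iexp (s * X \<omega>))"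
        by (rule N.char_distr_eq) simp
      also have "\<dots> = (CLINT \<omega>|M. (1 / e) *\<^sub>R (Z \<omega> * iexp (s * X \<omega>)))"
        by (subst int_N) (simp_all add: scaleR_conv_of_real)
      also have "\<dots> = (1 / e) *\<^sub>R (CLINT \<omega>|M. (Z \<omega> * iexp (s * X \<omega>)))"
        by (rule integral_scaleR_right)
      also have "\<dots> = char (distr M borel X) s"
        unfolding eq using e by (simp add: char_distr_eq e_def[symmetric] scaleR_conv_of_real)
      finally show ?thesis .
    qed
    then show "char (distr N borel X) = char (distr M borel X)" by auto
  qed
  then have "measure (distr N borel X) A = measure (distr M borel X) A" by simp
  then have "N.prob (X -` A \<inter> space N) = prob (X -` A \<inter> space M)"
    by (simp add: measure_distr)
  also have "N.prob (X -` A \<inter> space N) = (LINT \<omega>|N. indicator A (X \<omega>))"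
    by (rule N.expectation_indicator_compose[symmetric, OF A]) measurable
  also have "\<dots> = (LINT \<omega>|M. Z \<omega> * indicator A (X \<omega>)) / e"
    by (subst int_N) simp_all
  finally show ?thesis using e by (simp add: field_simps e_def)
qed

text \<open>Reduction to nonnegative weights: the complex weight is split into real and imaginary
  part, and a bounded real weight becomes nonnegative after adding its bound.\<close>

lemma bounded_weight_factor:
  fixes W :: "'a \<Rightarrow> complex" and X :: "'a \<Rightarrow> real"
  assumes W [measurable]: "random_variable borel W" and bnd: "\<And>\<omega>. cmod (W \<omega>) \<le> c" and X [measurable]: "random_variable borel X"
    and eq: "\<And>s. (CLINT \<omega>|M. W \<omega> * iexp (s * X \<omega>)) = expectation W * (CLINT \<omega>|M. iexp (s * X \<omega>))"
    and A [measurable]: "A \<in> sets borel"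
  shows "expectation (\<lambda>\<omega>. W \<omega> * indicator A (X \<omega>)) = expectation W * prob (X -` A \<inter> space M)"
proof -
  have real_case: "expectation (\<lambda>\<omega>. Z \<omega> * indicator A (X \<omega>)) = expectation Z * prob (X -` A \<inter> space M)"
    if Z [measurable]: "random_variable borel Z" and bnd: "\<And>\<omega>. \<bar>Z \<omega>\<bar> \<le> c"
      and eq: "\<And>s. (CLINT \<omega>|M. Z \<omega> * iexp (s * X \<omega>)) = expectation Z * (CLINT \<omega>|M. iexp (s * X \<omega>))"
    for Z :: "'a \<Rightarrow> real"
  proof -
    have intZ: "integrable M Z" by (rule integrable_const_bound[of _ c]) (use bnd in auto)
    have intA: "integrable M (\<lambda>\<omega>. indicator A (X \<omega>) :: real)" by (rule integrable_const_bound[of _ 1]) auto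
    have intZA: "integrable M (\<lambda>\<omega>. Z \<omega> * indicator A (X \<omega>))"
      by (rule Bochner_Integration.integrable_bound[OF intZ]) (auto split: split_indicator)
    have int1: "integrable M (\<lambda>\<omega>. Z \<omega> * iexp (s * X \<omega>))" for s
      by (rule integrable_const_bound[of _ c]) (use bnd in \<open>auto simp: norm_mult\<close>)
    have int2: "integrable M (\<lambda>\<omega>. iexp (s * X \<omega>))" for s
      by (rule integrable_iexp) auto
    \<comment> \<open>Constants satisfy the factorization as well, so it holds for
      \<open>Z + c\<close>, and afterwards the contribution of \<open>c\<close> is
      subtracted.\<close>
    have "expectation (\<lambda>\<omega>. (Z \<omega> + c) * indicator A (X \<omega>)) = expectation (\<lambda>\<omega>. Z \<omega> + c) * prob (X -` A \<inter> space M)"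
    proof (rule nonneg_weight_factor)
      show "0 \<le> Z \<omega> + c" for \<omega> using bnd[of \<omega>] by auto
      fix s
      have "(CLINT \<omega>|M. (Z \<omega> + c) * iexp (s * X \<omega>)) = (CLINT \<omega>|M. Z \<omega> * iexp (s * X \<omega>) + c * iexp (s * X \<omega>))"
        by (intro Bochner_Integration.integral_cong) (auto simp: distrib_right)
      also have "\<dots> = expectation Z * (CLINT \<omega>|M. iexp (s * X \<omega>)) + c * (CLINT \<omega>|M. iexp (s * X \<omega>))"
        using int1[of s] int2[of s] by (simp add: eq del: of_real_mult)
      finally show "(CLINT \<omega>|M. (Z \<omega> + c) * iexp (s * X \<omega>)) = expectation (\<lambda>\<omega>. Z \<omega> + c) * (CLINT \<omega>|M. iexp (s * X \<omega>))"
        using intZ by (simp add: distrib_right prob_space)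
    qed (use intZ in auto)
    moreover have "expectation (\<lambda>\<omega>. indicator A (X \<omega>)) = prob (X -` A \<inter> space M)"
      by (rule expectation_indicator_compose[OF A X])
    ultimately show ?thesis
      using intZ intA intZA by (simp add: distrib_right prob_space)
  qed
  have intW: "integrable M W" by (rule integrable_const_bound[of _ c]) (use bnd in auto)
  have intWi: "integrable M (\<lambda>\<omega>. W \<omega> * iexp (s * X \<omega>))" for s
    by (rule integrable_const_bound[of _ c]) (use bnd in \<open>auto simp: norm_mult\<close>)
  have intcW: "integrable M (\<lambda>\<omega>. cnj (W \<omega>))" using intW by simp
  have intcWi: "integrable M (\<lambda>\<omega>. cnj (W \<omega>) * iexp (s * X \<omega>))" for s
    by (rule integrable_const_bound[of _ c]) (use bnd in \<open>auto simp: norm_mult\<close>)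
  \<comment> \<open>Conjugating the hypothesis at frequency \<open>- s\<close> gives it for
    \<open>cnj W\<close> at \<open>s\<close>; without this the real part of \<open>W\<close> could
    not be separated from the exponential.\<close>
  have eqc: "(CLINT \<omega>|M. cnj (W \<omega>) * iexp (s * X \<omega>)) = cnj (expectation W) * (CLINT \<omega>|M. iexp (s * X \<omega>))" for s
  proof -
    have c: "cnj (iexp (- s * x)) = iexp (s * x)" for x by (simp add: exp_cnj)
    have "(CLINT \<omega>|M. cnj (W \<omega>) * iexp (s * X \<omega>)) = (CLINT \<omega>|M. cnj (W \<omega> * iexp (- s * X \<omega>)))"
      by (intro Bochner_Integration.integral_cong) (simp_all only: complex_cnj_mult c)
    also have "\<dots> = cnj (expectation W * (CLINT \<omega>|M. iexp (- s * X \<omega>)))"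
      using intWi[of "- s"] by (simp only: Bochner_Integration.integral_cnj eq)
    also have "\<dots> = cnj (expectation W) * (CLINT \<omega>|M. cnj (iexp (- s * X \<omega>)))"
      by (simp only: complex_cnj_mult Bochner_Integration.integral_cnj)
    finally show ?thesis by (simp only: c)
  qed
  have Re: "expectation (\<lambda>\<omega>. Re (W \<omega>) * indicator A (X \<omega>)) = expectation (\<lambda>\<omega>. Re (W \<omega>)) * prob (X -` A \<inter> space M)"
  proof (rule real_case)
    show "\<bar>Re (W \<omega>)\<bar> \<le> c" for \<omega> using abs_Re_le_cmod[of "W \<omega>"] bnd[of \<omega>] by linarith
    fix s
    have "(CLINT \<omega>|M. Re (W \<omega>) * iexp (s * X \<omega>)) = (CLINT \<omega>|M. (W \<omega> * iexp (s * X \<omega>) + cnj (W \<omega>) * iexp (s * X \<omega>)) / 2)"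
      by (intro Bochner_Integration.integral_cong) (auto simp: distrib_right[symmetric] complex_add_cnj)
    also have "\<dots> = (expectation W * (CLINT \<omega>|M. iexp (s * X \<omega>)) + cnj (expectation W) * (CLINT \<omega>|M. iexp (s * X \<omega>))) / 2"
      using intWi[of s] intcWi[of s] by (simp add: eq eqc del: of_real_mult)
    also have "\<dots> = Re (expectation W) * (CLINT \<omega>|M. iexp (s * X \<omega>))"
      by (simp add: distrib_right[symmetric] complex_add_cnj)
    finally show "(CLINT \<omega>|M. Re (W \<omega>) * iexp (s * X \<omega>)) = expectation (\<lambda>\<omega>. Re (W \<omega>)) * (CLINT \<omega>|M. iexp (s * X \<omega>))"
      using intW by simp
  qed simp
  have Im: "expectation (\<lambda>\<omega>. Im (W \<omega>) * indicator A (X \<omega>)) = expectation (\<lambda>\<omega>. Im (W \<omega>)) * prob (X -` A \<inter> space M)"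
  proof (rule real_case)
    show "\<bar>Im (W \<omega>)\<bar> \<le> c" for \<omega> using abs_Im_le_cmod[of "W \<omega>"] bnd[of \<omega>] by linarith
    fix s
    have "(CLINT \<omega>|M. Im (W \<omega>) * iexp (s * X \<omega>)) = (CLINT \<omega>|M. (W \<omega> * iexp (s * X \<omega>) - cnj (W \<omega>) * iexp (s * X \<omega>)) / (2 * \<i>))"
      by (intro Bochner_Integration.integral_cong refl)
         (simp only: left_diff_distrib[symmetric] complex_diff_cnj, simp add: field_simps)
    also have "\<dots> = (expectation W * (CLINT \<omega>|M. iexp (s * X \<omega>)) - cnj (expectation W) * (CLINT \<omega>|M. iexp (s * X \<omega>))) / (2 * \<i>)"
      using intWi[of s] intcWi[of s] by (simp add: eq eqc del: of_real_mult)
    also have "\<dots> = Im (expectation W) * (CLINT \<omega>|M. iexp (s * X \<omega>))"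
      by (simp only: left_diff_distrib[symmetric] complex_diff_cnj, simp add: field_simps)
    finally show "(CLINT \<omega>|M. Im (W \<omega>) * iexp (s * X \<omega>)) = expectation (\<lambda>\<omega>. Im (W \<omega>)) * (CLINT \<omega>|M. iexp (s * X \<omega>))"
      using intW by simp
  qed simp
  have intWA: "integrable M (\<lambda>\<omega>. W \<omega> * indicator A (X \<omega>))"
    by (rule Bochner_Integration.integrable_bound[OF intW]) (auto split: split_indicator)
  have *: "Re (W \<omega> * indicator A (X \<omega>)) = Re (W \<omega>) * indicator A (X \<omega>)"
     "Im (W \<omega> * indicator A (X \<omega>)) = Im (W \<omega>) * indicator A (X \<omega>)" for \<omega>
    by (auto split: split_indicator)
  have "Re (expectation (\<lambda>\<omega>. W \<omega> * indicator A (X \<omega>))) = Re (expectation W) * prob (X -` A \<inter> space M)"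
    using Re by (simp only: integral_Re[OF intWA, symmetric] integral_Re[OF intW, symmetric] *)
  moreover have "Im (expectation (\<lambda>\<omega>. W \<omega> * indicator A (X \<omega>))) = Im (expectation W) * prob (X -` A \<inter> space M)"
    using Im by (simp only: integral_Im[OF intWA, symmetric] integral_Im[OF intW, symmetric] *)
  ultimately show ?thesis by (simp add: complex_eq_iff)
qed

text \<open>
  Kac's criterion, by replacing the exponential factors by indicators one index at a time, so
  that only the uniqueness theorem for characteristic functions on the line is needed.
\<close>

lemma indep_vars_if_char_factorizes:
  fixes X :: "'i \<Rightarrow> 'a \<Rightarrow> real"
  assumes fin: "finite I" and X [measurable]: "\<And>i. i \<in> I \<Longrightarrow> random_variable borel (X i)"
    and char: "\<And>t. (CLINT \<omega>|M. (\<Prod>i\<in>I. iexp (t i * X i \<omega>))) = (\<Prod>i\<in>I. CLINT \<omega>|M. iexp (t i * X i \<omega>))"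
  shows "indep_vars (\<lambda>_. borel) X I"
proof (cases "I = {}")
  case True
  then show ?thesis by (simp add: indep_vars_def indep_sets_def)
next
  case False
  have ind: "(CLINT \<omega>|M. (\<Prod>i\<in>J. indicator (A i) (X i \<omega>)) * (\<Prod>i\<in>I - J. iexp (t i * X i \<omega>))) =
      (\<Prod>i\<in>J. prob (X i -` A i \<inter> space M)) * (\<Prod>i\<in>I - J. CLINT \<omega>|M. iexp (t i * X i \<omega>))"
    if "finite J" "J \<subseteq> I" "\<And>i. i \<in> J \<Longrightarrow> A i \<in> sets borel" for J A t
    using that
  proof (induction J arbitrary: t rule: finite_induct)
    case empty
    then show ?case using char by simp
  next
    case (insert j J)
    define W where "W \<omega> = (\<Prod>i\<in>J. indicator (A i) (X i \<omega>)) * (\<Prod>i\<in>I - insert j J. iexp (t i * X i \<omega>))" for \<omega>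
    have j: "j \<in> I" "I - J = insert j (I - insert j J)" "j \<notin> I - insert j J" using insert by auto
    have [measurable]: "A i \<in> sets borel" if "i \<in> insert j J" for i using insert.prems that by auto
    have mA: "(\<lambda>\<omega>. indicator (A i) (X i \<omega>) :: complex) \<in> borel_measurable M" if "i \<in> J" for i
    proof -
      have [measurable]: "A i \<in> sets borel" "random_variable borel (X i)"
        using X[of i] insert.prems that by auto
      show ?thesis by measurable
    qed
    have mE: "(\<lambda>\<omega>. iexp (t i * X i \<omega>)) \<in> borel_measurable M" if "i \<in> I" for i
      using X[OF that] by measurable
    have W [measurable]: "W \<in> borel_measurable M"
      unfolding W_def by (intro borel_measurable_times borel_measurable_prod mA mE) auto
    have W1: "cmod (W \<omega>) \<le> 1" for \<omega>
      unfolding W_def norm_mult prod_norm[symmetric]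
      by (intro mult_le_one prod_le_1 prod_nonneg) (auto split: split_indicator)
    have WX: "(CLINT \<omega>|M. W \<omega> * iexp (s * X j \<omega>)) =
       (\<Prod>i\<in>J. prob (X i -` A i \<inter> space M)) * (\<Prod>i\<in>I - insert j J. CLINT \<omega>|M. iexp (t i * X i \<omega>)) * (CLINT \<omega>|M. iexp (s * X j \<omega>))" for s
    proof -
      define t' where "t' = t(j := s)"
      have "W \<omega> * iexp (s * X j \<omega>) = (\<Prod>i\<in>J. indicator (A i) (X i \<omega>)) * (\<Prod>i\<in>I - J. iexp (t' i * X i \<omega>))" for \<omega>
      proof -
        have "(\<Prod>i\<in>I - insert j J. iexp (t' i * X i \<omega>)) = (\<Prod>i\<in>I - insert j J. iexp (t i * X i \<omega>))"
          by (intro prod.cong) (auto simp: t'_def)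
        then show ?thesis
          unfolding j(2) W_def using fin j(3) by (subst prod.insert) (auto simp: t'_def)
      qed
      then have "(CLINT \<omega>|M. W \<omega> * iexp (s * X j \<omega>)) =
          (\<Prod>i\<in>J. prob (X i -` A i \<inter> space M)) * (\<Prod>i\<in>I - J. CLINT \<omega>|M. iexp (t' i * X i \<omega>))"
        using insert.IH[of t'] insert.prems by simp
      also have "(\<Prod>i\<in>I - J. CLINT \<omega>|M. iexp (t' i * X i \<omega>)) =
          (\<Prod>i\<in>I - insert j J. CLINT \<omega>|M. iexp (t i * X i \<omega>)) * (CLINT \<omega>|M. iexp (s * X j \<omega>))"
      proof -
        have "(\<Prod>i\<in>I - insert j J. CLINT \<omega>|M. iexp (t' i * X i \<omega>)) = (\<Prod>i\<in>I - insert j J. CLINT \<omega>|M. iexp (t i * X i \<omega>))"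
          by (intro prod.cong) (auto simp: t'_def)
        then show ?thesis
          unfolding j(2) using fin j(3) by (subst prod.insert) (auto simp: t'_def)
      qed
      finally show ?thesis by (simp add: mult.assoc)
    qed
    \<comment> \<open>At frequency \<open>s = 0\<close> the factor belonging to \<open>j\<close>
      disappears, so the mean of \<open>W\<close> is read off from \<open>WX\<close>.\<close>
    have EW: "expectation W = (\<Prod>i\<in>J. prob (X i -` A i \<inter> space M)) * (\<Prod>i\<in>I - insert j J. CLINT \<omega>|M. iexp (t i * X i \<omega>))"
      using WX[of 0] by (simp add: prob_space)
    have "expectation (\<lambda>\<omega>. W \<omega> * indicator (A j) (X j \<omega>)) = expectation W * prob (X j -` A j \<inter> space M)"
      by (rule bounded_weight_factor[OF W W1 X[OF j(1)]]) (use insert.prems in \<open>auto simp: WX EW simp del: of_real_mult\<close>)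
    moreover have "W \<omega> * indicator (A j) (X j \<omega>) =
        (\<Prod>i\<in>insert j J. indicator (A i) (X i \<omega>)) * (\<Prod>i\<in>I - insert j J. iexp (t i * X i \<omega>))" for \<omega>
      using insert.hyps by (simp add: W_def mult_ac)
    ultimately show ?case
      using insert.hyps by (simp add: EW mult_ac)
  qed
  show ?thesis
  proof (rule indep_vars_finite[where E = "\<lambda>_. sets borel", THEN iffD2, OF False fin])
    show "\<forall>A\<in>I \<rightarrow> sets borel. prob (\<Inter>j\<in>I. X j -` A j \<inter> space M) = (\<Prod>j\<in>I. prob (X j -` A j \<inter> space M))"
    proof
      fix A :: "'i \<Rightarrow> real set" assume A: "A \<in> I \<rightarrow> sets borel"
      then have [measurable]: "A i \<in> sets borel" if "i \<in> I" for i using that by auto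
      have "complex_of_real (prob (\<Inter>j\<in>I. X j -` A j \<inter> space M)) = (CLINT \<omega>|M. of_real (indicator (\<Inter>j\<in>I. X j -` A j \<inter> space M) \<omega>))"
      proof -
        have "(\<Inter>j\<in>I. X j -` A j \<inter> space M) \<inter> space M = (\<Inter>j\<in>I. X j -` A j \<inter> space M)" using False by auto
        then show ?thesis by simp
      qed
      also have "\<dots> = (CLINT \<omega>|M. (\<Prod>i\<in>I. indicator (A i) (X i \<omega>)))"
        using fin False by (intro Bochner_Integration.integral_cong refl) (auto simp: indicator_def prod_zero_iff split: if_splits)
      also have "\<dots> = (\<Prod>i\<in>I. prob (X i -` A i \<inter> space M))"
        using ind[of I A] fin A by auto
      finally show "prob (\<Inter>j\<in>I. X j -` A j \<inter> space M) = (\<Prod>j\<in>I. prob (X j -` A j \<inter> space M))"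
        unfolding of_real_eq_iff .
    qed
    show "Int_stable (sets borel)" for i by (rule sets.Int_stable)
    show "sets borel = sigma_sets (space borel) (sets borel)" for i by (rule sets.sigma_sets_eq[symmetric])
  qed (auto simp: sets.space_closed)
qed

end

section \<open>A central limit theorem for triangular arrays\<close>

text \<open>The weighted inequality of arithmetic and geometric mean. It trades the third absolute
  moment of the Taylor remainder for the second and fourth ones; the weight \<delta> is later tuned
  to the size of the Lyapunov sum.\<close>

lemma abs_cube_le: "\<bar>x\<bar> ^ 3 \<le> (\<delta> * x ^ 2 + x ^ 4 / \<delta>) / 2" if "\<delta> > 0" for x \<delta> :: real
proof -
  have "0 \<le> (x\<^sup>2 * (\<bar>x\<bar> - \<delta>)\<^sup>2) / (2 * \<delta>)" using that by simp
  also have "x\<^sup>2 * (\<bar>x\<bar> - \<delta>)\<^sup>2 = x ^ 4 + \<delta>\<^sup>2 * x\<^sup>2 - 2 * \<delta> * \<bar>x\<bar> ^ 3"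
  proof -
    have "x\<^sup>2 = \<bar>x\<bar>\<^sup>2" "x ^ 4 = \<bar>x\<bar> ^ 4" by simp_all
    then show ?thesis by (simp only:) (simp add: power2_eq_square algebra_simps eval_nat_numeral)
  qed
  finally show ?thesis using that by (simp add: field_simps power2_eq_square)
qed

lemma exp_minus_diff_le: "0 \<le> x \<Longrightarrow> \<bar>(1 - x) - exp (- x)\<bar> \<le> x\<^sup>2 / 2" for x :: real
proof -
  assume x: "0 \<le> x"
  have "(1 - x) - exp (- x) \<le> 0" using exp_ge_add_one_self[of "- x"] by simp
  moreover have "exp (- x) \<le> 1 - x + x\<^sup>2 / 2"
  proof -
    define f where "f x = 1 - x + x\<^sup>2 / 2 - exp (- x)" for x :: real
    have "f 0 \<le> f x"
    proof (rule DERIV_nonneg_imp_nondecreasing[OF x])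
      fix y :: real assume "0 \<le> y"
      have "(f has_real_derivative (- 1 + y + exp (- y))) (at y)"
        unfolding f_def by (auto intro!: derivative_eq_intros)
      moreover have "0 \<le> - 1 + y + exp (- y)" using exp_ge_add_one_self[of "- y"] by simp
      ultimately show "\<exists>z. (f has_real_derivative z) (at y) \<and> 0 \<le> z" by blast
    qed
    then show ?thesis by (simp add: f_def)
  qed
  ultimately show ?thesis by simp
qed

context prob_space
begin

lemma square_second_moment_le:
  fixes X :: "'a \<Rightarrow> real"
  assumes [measurable]: "random_variable borel X" and int4: "integrable M (\<lambda>\<omega>. X \<omega> ^ 4)"
  shows "(expectation (\<lambda>\<omega>. X \<omega> ^ 2))\<^sup>2 \<le> expectation (\<lambda>\<omega>. X \<omega> ^ 4)"
proof -
  define v where "v = expectation (\<lambda>\<omega>. X \<omega> ^ 2)"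
  have int2: "integrable M (\<lambda>\<omega>. X \<omega> ^ 2)"
    by (rule square_integrable_imp_integrable) (use int4 in \<open>auto simp flip: power_mult\<close>)
  have "0 \<le> expectation (\<lambda>\<omega>. (X \<omega> ^ 2 - v) ^ 2)" by simp
  also have "\<dots> = expectation (\<lambda>\<omega>. X \<omega> ^ 4 - 2 * v * X \<omega> ^ 2 + v\<^sup>2)"
    by (intro Bochner_Integration.integral_cong) (auto simp: power2_eq_square algebra_simps eval_nat_numeral)
  also have "\<dots> = expectation (\<lambda>\<omega>. X \<omega> ^ 4) - 2 * v * v + v\<^sup>2"
    using int2 int4 by (simp add: v_def prob_space)
  finally show ?thesis by (simp add: v_def power2_eq_square)
qed

text \<open>Two errors are added: the third-order Taylor remainder of the characteristic function,
  and the difference between 1 - t^2 v / 2 and its exponential. The latter is quadratic in the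
  variance \<open>v\<close>, hence bounded by the fourth moment.\<close>

lemma char_second_order_bound:
  assumes [measurable]: "random_variable borel X" and int4: "integrable M (\<lambda>\<omega>. X \<omega> ^ 4)"
    and mean: "expectation X = 0" and \<delta>: "\<delta> > 0"
  shows "cmod (char (distr M borel X) t - exp (- (t\<^sup>2 * expectation (\<lambda>\<omega>. X \<omega> ^ 2) / 2))) \<le>
     \<bar>t\<bar> ^ 3 / 12 * (\<delta> * expectation (\<lambda>\<omega>. X \<omega> ^ 2) + expectation (\<lambda>\<omega>. X \<omega> ^ 4) / \<delta>) +
     t ^ 4 / 8 * expectation (\<lambda>\<omega>. X \<omega> ^ 4)"
proof -
  have int2: "integrable M (\<lambda>\<omega>. X \<omega> ^ 2)"
    by (rule square_integrable_imp_integrable) (use int4 in \<open>auto simp flip: power_mult\<close>)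
  have int1: "integrable M X"
    by (rule square_integrable_imp_integrable) (use int2 in auto)
  have int3: "integrable M (\<lambda>\<omega>. \<bar>X \<omega>\<bar> ^ 3)"
  proof (rule Bochner_Integration.integrable_bound)
    show "integrable M (\<lambda>\<omega>. (1 * X \<omega> ^ 2 + X \<omega> ^ 4 / 1) / 2)" using int2 int4 by simp
    show "AE \<omega> in M. norm (\<bar>X \<omega>\<bar> ^ 3) \<le> norm ((1 * X \<omega> ^ 2 + X \<omega> ^ 4 / 1) / 2)"
      using abs_cube_le[of 1] by (auto intro!: AE_I2 intro: order_trans)
  qed simp
  define v q where "v = expectation (\<lambda>\<omega>. X \<omega> ^ 2)" and "q = expectation (\<lambda>\<omega>. X \<omega> ^ 4)"
  have v0: "0 \<le> v" unfolding v_def by simp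
  have vq: "v\<^sup>2 \<le> q"
    unfolding v_def q_def by (rule square_second_moment_le) (use int4 in auto)
  have "cmod (char (distr M borel X) t - (1 - t\<^sup>2 * v / 2)) \<le>
     t\<^sup>2 / 6 * expectation (\<lambda>\<omega>. min (6 * (X \<omega>)\<^sup>2) (\<bar>t\<bar> * \<bar>X \<omega>\<bar> ^ 3))"
    using char_approx3'[of X v "distr M borel X" t] int1 int2 mean by (simp add: v_def)
  also have "expectation (\<lambda>\<omega>. min (6 * (X \<omega>)\<^sup>2) (\<bar>t\<bar> * \<bar>X \<omega>\<bar> ^ 3)) \<le>
      expectation (\<lambda>\<omega>. \<bar>t\<bar> * ((\<delta> * X \<omega> ^ 2 + X \<omega> ^ 4 / \<delta>) / 2))"
  proof (rule integral_mono)
    show "integrable M (\<lambda>\<omega>. min (6 * (X \<omega>)\<^sup>2) (\<bar>t\<bar> * \<bar>X \<omega>\<bar> ^ 3))"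
      using int2 int3 by (intro integrable_min) auto
    show "min (6 * (X \<omega>)\<^sup>2) (\<bar>t\<bar> * \<bar>X \<omega>\<bar> ^ 3) \<le> \<bar>t\<bar> * ((\<delta> * X \<omega> ^ 2 + X \<omega> ^ 4 / \<delta>) / 2)" for \<omega>
      by (rule min.coboundedI2) (intro mult_left_mono abs_cube_le \<delta>, simp)
  qed (use int2 int4 in auto)
  also have "expectation (\<lambda>\<omega>. \<bar>t\<bar> * ((\<delta> * X \<omega> ^ 2 + X \<omega> ^ 4 / \<delta>) / 2)) = \<bar>t\<bar> * ((\<delta> * v + q / \<delta>) / 2)"
    using int2 int4 by (simp add: v_def q_def)
  also have "t\<^sup>2 / 6 * (\<bar>t\<bar> * ((\<delta> * v + q / \<delta>) / 2)) = \<bar>t\<bar> ^ 3 / 12 * (\<delta> * v + q / \<delta>)"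
    by (simp add: eval_nat_numeral)
  finally have 1: "cmod (char (distr M borel X) t - (1 - t\<^sup>2 * v / 2)) \<le> \<bar>t\<bar> ^ 3 / 12 * (\<delta> * v + q / \<delta>)"
    by (simp add: mult_left_mono)
  have "cmod (complex_of_real (1 - t\<^sup>2 * v / 2) - exp (- (t\<^sup>2 * v / 2))) = \<bar>(1 - t\<^sup>2 * v / 2) - exp (- (t\<^sup>2 * v / 2))\<bar>"
    by (simp only: norm_of_real flip: of_real_diff)
  also have "\<dots> \<le> (t\<^sup>2 * v / 2)\<^sup>2 / 2"
    by (rule exp_minus_diff_le) (simp add: v0)
  also have "\<dots> = t ^ 4 / 8 * v\<^sup>2" by (simp add: power2_eq_square eval_nat_numeral)
  also have "\<dots> \<le> t ^ 4 / 8 * q" using vq by (intro mult_left_mono) auto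
  finally have 2: "cmod (complex_of_real (1 - t\<^sup>2 * v / 2) - exp (- (t\<^sup>2 * v / 2))) \<le> t ^ 4 / 8 * q" .
  have "cmod (char (distr M borel X) t - exp (- (t\<^sup>2 * v / 2))) \<le>
     cmod (char (distr M borel X) t - (1 - t\<^sup>2 * v / 2)) + cmod (complex_of_real (1 - t\<^sup>2 * v / 2) - exp (- (t\<^sup>2 * v / 2)))"
    using norm_triangle_ineq[of "char (distr M borel X) t - complex_of_real (1 - t\<^sup>2 * v / 2)" "complex_of_real (1 - t\<^sup>2 * v / 2) - exp (- (t\<^sup>2 * v / 2))"]
    by simp
  then show ?thesis using 1 2 unfolding v_def q_def by linarith
qed

text \<open>The characteristic function of the sum and the Gaussian one are both products of factors
  of modulus at most one, so their distance is at most the sum of the distances of the factors. Unit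
  variance is asked only eventually, because the normalizing variance need not be positive for small
  indices.\<close>

theorem lyapunov_central_limit:
  fixes X :: "nat \<Rightarrow> 'i \<Rightarrow> 'a \<Rightarrow> real"
  assumes fin: "\<And>n. finite (I n)" and indep: "\<And>n. indep_vars (\<lambda>_. borel) (X n) (I n)"
    and int4: "\<And>n i. i \<in> I n \<Longrightarrow> integrable M (\<lambda>\<omega>. X n i \<omega> ^ 4)"
    and mean: "\<And>n i. i \<in> I n \<Longrightarrow> expectation (X n i) = 0"
    and var: "\<forall>\<^sub>F n in sequentially. (\<Sum>i\<in>I n. expectation (\<lambda>\<omega>. X n i \<omega> ^ 2)) = 1"
    and lyapunov: "(\<lambda>n. \<Sum>i\<in>I n. expectation (\<lambda>\<omega>. X n i \<omega> ^ 4)) \<longlonglongrightarrow> 0"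
  shows "weak_conv_m (\<lambda>n. distr M borel (\<lambda>\<omega>. \<Sum>i\<in>I n. X n i \<omega>)) std_normal_distribution"
proof (rule levy_continuity)
  have rv [measurable]: "random_variable borel (X n i)" if "i \<in> I n" for n i
    using indep[of n] that by (auto simp: indep_vars_def)
  show "real_distribution (distr M borel (\<lambda>\<omega>. \<Sum>i\<in>I n. X n i \<omega>))" for n
    by (rule real_distribution_distr) (auto intro!: borel_measurable_sum rv)
  show "real_distribution std_normal_distribution" by (rule real_dist_normal_dist)
  fix t :: real
  define v q where "v n i = expectation (\<lambda>\<omega>. X n i \<omega> ^ 2)" and "q n i = expectation (\<lambda>\<omega>. X n i \<omega> ^ 4)" for n i
  define L where "L n = (\<Sum>i\<in>I n. q n i)" for n
  \<comment> \<open>The weight in \<open>abs_cube_le\<close>: with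
    \<open>L n \<le> \<delta> n ^ 2\<close> both terms \<open>\<delta> n\<close> and
    \<open>L n / \<delta> n\<close> are at most \<open>\<delta> n\<close>, which tends to 0. The
    summand \<open>1 / Suc n\<close> keeps it positive when \<open>L n = 0\<close>.\<close>
  define \<delta> where "\<delta> n = sqrt (L n + 1 / real (Suc n))" for n
  have L0: "0 \<le> L n" for n unfolding L_def q_def by (intro sum_nonneg) simp
  have \<delta>: "\<delta> n > 0" for n using L0[of n] by (simp add: \<delta>_def add_nonneg_pos)
  have L\<delta>: "L n \<le> (\<delta> n)\<^sup>2" for n using L0[of n] by (simp add: \<delta>_def)
  have "(\<lambda>n. L n + 1 / real (Suc n)) \<longlonglongrightarrow> 0 + 0"
    using lyapunov unfolding L_def q_def by (intro tendsto_add LIMSEQ_inverse_real_of_nat[unfolded inverse_eq_divide]) auto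
  then have \<delta>_lim: "\<delta> \<longlonglongrightarrow> 0"
    unfolding \<delta>_def[abs_def] using tendsto_real_sqrt by fastforce
  have bound: "cmod (char (distr M borel (\<lambda>\<omega>. \<Sum>i\<in>I n. X n i \<omega>)) t - exp (- (t\<^sup>2) / 2)) \<le>
      \<bar>t\<bar> ^ 3 / 6 * \<delta> n + t ^ 4 / 8 * (\<delta> n)\<^sup>2" if "(\<Sum>i\<in>I n. v n i) = 1" for n
  proof -
    have "exp (- (t\<^sup>2) / 2) = exp (\<Sum>i\<in>I n. - (t\<^sup>2 * v n i / 2))"
      using that by (simp add: sum_negf sum_divide_distrib[symmetric] sum_distrib_left[symmetric])
    also have "\<dots> = (\<Prod>i\<in>I n. exp (- (t\<^sup>2 * v n i / 2)))" by (rule exp_sum[OF fin])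
    finally have e: "exp (- (t\<^sup>2) / 2) = (\<Prod>i\<in>I n. exp (- (t\<^sup>2 * v n i / 2)))" .
    have "cmod (char (distr M borel (\<lambda>\<omega>. \<Sum>i\<in>I n. X n i \<omega>)) t - exp (- (t\<^sup>2) / 2)) =
       cmod ((\<Prod>i\<in>I n. char (distr M borel (X n i)) t) - (\<Prod>i\<in>I n. complex_of_real (exp (- (t\<^sup>2 * v n i / 2)))))"
      unfolding e by (simp add: char_distr_sum[OF indep])
    also have "\<dots> \<le> (\<Sum>i\<in>I n. cmod (char (distr M borel (X n i)) t - complex_of_real (exp (- (t\<^sup>2 * v n i / 2)))))"
    proof (rule norm_prod_diff)
      fix i assume i: "i \<in> I n"
      show "cmod (char (distr M borel (X n i)) t) \<le> 1"
        by (intro real_distribution.cmod_char_le_1 real_distribution_distr rv i)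
      show "cmod (complex_of_real (exp (- (t\<^sup>2 * v n i / 2)))) \<le> 1"
        unfolding norm_of_real by (simp add: v_def)
    qed
    also have "\<dots> \<le> (\<Sum>i\<in>I n. \<bar>t\<bar> ^ 3 / 12 * (\<delta> n * v n i + q n i / \<delta> n) + t ^ 4 / 8 * q n i)"
      unfolding v_def q_def by (intro sum_mono char_second_order_bound rv int4 mean \<delta>)
    also have "\<dots> = \<bar>t\<bar> ^ 3 / 12 * (\<delta> n * (\<Sum>i\<in>I n. v n i) + L n / \<delta> n) + t ^ 4 / 8 * L n"
      unfolding L_def sum_distrib_left[of "\<delta> n"] sum_divide_distrib sum.distrib[symmetric] sum_distrib_left ..
    also have "\<dots> = \<bar>t\<bar> ^ 3 / 12 * (\<delta> n + L n / \<delta> n) + t ^ 4 / 8 * L n" using that by simp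
    also have "\<dots> \<le> \<bar>t\<bar> ^ 3 / 12 * (\<delta> n + \<delta> n) + t ^ 4 / 8 * (\<delta> n)\<^sup>2"
    proof -
      have "L n / \<delta> n \<le> \<delta> n" using L\<delta>[of n] \<delta>[of n] by (simp add: divide_simps power2_eq_square)
      then show ?thesis using L\<delta>[of n] by (intro add_mono mult_left_mono) auto
    qed
    finally show ?thesis by (simp only: mult_2[symmetric])
  qed
  have "(\<lambda>n. \<bar>t\<bar> ^ 3 / 6 * \<delta> n + t ^ 4 / 8 * (\<delta> n)\<^sup>2) \<longlonglongrightarrow> \<bar>t\<bar> ^ 3 / 6 * 0 + t ^ 4 / 8 * 0\<^sup>2"
    by (intro tendsto_intros \<delta>_lim)
  then have lim: "(\<lambda>n. \<bar>t\<bar> ^ 3 / 6 * \<delta> n + t ^ 4 / 8 * (\<delta> n)\<^sup>2) \<longlonglongrightarrow> 0" by simp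
  have "(\<lambda>n. char (distr M borel (\<lambda>\<omega>. \<Sum>i\<in>I n. X n i \<omega>)) t - exp (- (t\<^sup>2) / 2)) \<longlonglongrightarrow> 0"
    by (rule Lim_null_comparison[OF _ lim]) (use var bound in \<open>auto simp: v_def elim!: eventually_mono\<close>)
  then show "(\<lambda>n. char (distr M borel (\<lambda>\<omega>. \<Sum>i\<in>I n. X n i \<omega>)) t) \<longlonglongrightarrow> char std_normal_distribution t"
    unfolding char_std_normal_distribution by (rule LIM_zero_cancel)
qed

end

section \<open>Gaussian harmonic coefficients\<close>

lemma integrable_mult_square_integrable:
  fixes f g :: "'a \<Rightarrow> 'b :: {real_normed_field, second_countable_topology, banach}"
  assumes [measurable]: "f \<in> borel_measurable M" "g \<in> borel_measurable M"
    and "integrable M (\<lambda>x. (norm (f x))\<^sup>2)" "integrable M (\<lambda>x. (norm (g x))\<^sup>2)"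
  shows "integrable M (\<lambda>x. f x * g x)"
proof (rule Bochner_Integration.integrable_bound)
  show "integrable M (\<lambda>x. (norm (f x))\<^sup>2 + (norm (g x))\<^sup>2)" using assms by simp
  have "norm (f x * g x) \<le> (norm (f x))\<^sup>2 + (norm (g x))\<^sup>2" for x
  proof -
    have "2 * (norm (f x) * norm (g x)) \<le> (norm (f x))\<^sup>2 + (norm (g x))\<^sup>2"
      using zero_le_power2[of "norm (f x) - norm (g x)"] by (simp add: power2_diff)
    moreover have "0 \<le> norm (f x) * norm (g x)" by simp
    ultimately show ?thesis unfolding norm_mult by linarith
  qed
  then show "AE x in M. norm (f x * g x) \<le> norm ((norm (f x))\<^sup>2 + (norm (g x))\<^sup>2)"
    by (auto intro!: AE_I2 intro: order_trans)
qed measurable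

lemma integral_double_sum:
  fixes f :: "'i \<Rightarrow> 'j \<Rightarrow> 'a \<Rightarrow> 'b :: {real_normed_field, second_countable_topology, banach}"
  assumes "\<And>i j. i \<in> I \<Longrightarrow> j \<in> J \<Longrightarrow> integrable M (f i j)"
  shows "(LINT x|M. (\<Sum>i\<in>I. \<Sum>j\<in>J. c i j * f i j x)) = (\<Sum>i\<in>I. \<Sum>j\<in>J. c i j * (LINT x|M. f i j x))"
proof -
  have "(LINT x|M. (\<Sum>i\<in>I. \<Sum>j\<in>J. c i j * f i j x)) = (\<Sum>i\<in>I. LINT x|M. (\<Sum>j\<in>J. c i j * f i j x))"
    using assms by (intro Bochner_Integration.integral_sum Bochner_Integration.integrable_sum integrable_mult_right)
  also have "\<dots> = (\<Sum>i\<in>I. \<Sum>j\<in>J. LINT x|M. c i j * f i j x)"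
    using assms by (intro sum.cong refl Bochner_Integration.integral_sum integrable_mult_right)
  finally show ?thesis by simp
qed

context prob_space
begin

lemma normal_rv_cases:
  assumes "normal_rv M X"
  obtains (const) \<mu> where "AE \<omega> in M. X \<omega> = \<mu>"
  | (normal) \<mu> \<sigma> where "0 < \<sigma>" "distr M borel (\<lambda>\<omega>. (X \<omega> - \<mu>) / \<sigma>) = std_normal_distribution"
proof -
  consider \<mu> where "AE \<omega> in M. X \<omega> = \<mu>" | \<mu> \<sigma> where "0 < \<sigma>" "distributed M lborel X (normal_density \<mu> \<sigma>)"
    using assms unfolding normal_rv_def by auto
  then show ?thesis
  proof cases
    case 2
    then have "distributed M lborel (\<lambda>\<omega>. (X \<omega> - \<mu>) / \<sigma>) std_normal_density"
      using normal_standard_normal_convert[OF 2(1)] by blast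
    then have "distr M lborel (\<lambda>\<omega>. (X \<omega> - \<mu>) / \<sigma>) = std_normal_distribution"
      by (rule distributed_distr_eq_density)
    then have "distr M borel (\<lambda>\<omega>. (X \<omega> - \<mu>) / \<sigma>) = std_normal_distribution"
      by (simp cong: distr_cong)
    then show ?thesis using normal 2 by blast
  qed (use const in auto)
qed

lemma normal_rv_integrable_power:
  assumes X: "normal_rv M X"
  shows "integrable M (\<lambda>\<omega>. X \<omega> ^ k)"
proof -
  have [measurable]: "X \<in> borel_measurable M" using X by (simp add: normal_rv_def)
  from X show ?thesis
  proof (cases rule: normal_rv_cases)
    case (const \<mu>)
    then show ?thesis by (intro integrable_const_bound[of _ "\<bar>\<mu> ^ k\<bar>"]) auto
  next
    case (normal \<mu> \<sigma>)
    have "integrable std_normal_distribution (\<lambda>z. \<Sum>i\<le>k. real (k choose i) * (\<sigma> * z) ^ i * \<mu> ^ (k - i))"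
      using integrable_std_normal_distribution_moment
      by (intro Bochner_Integration.integrable_sum integrable_mult_left integrable_mult_right) (simp add: power_mult_distrib)
    then have "integrable std_normal_distribution (\<lambda>z. (\<sigma> * z + \<mu>) ^ k)"
      unfolding binomial_ring .
    then have "integrable (distr M borel (\<lambda>\<omega>. (X \<omega> - \<mu>) / \<sigma>)) (\<lambda>z. (\<sigma> * z + \<mu>) ^ k)"
      unfolding normal .
    then show ?thesis
      using normal(1) by (simp add: integrable_distr_eq)
  qed
qed

text \<open>A centred constant is a.e. zero and obeys all three formulas with \<open>v = 0\<close>,
  so the degenerate case needs no exception later. The eighth moment serves the fourth moment of
  quadratic forms.\<close>

lemma normal_rv_centered:
  assumes X: "normal_rv M X" and mean: "expectation X = 0"
  defines "v \<equiv> expectation (\<lambda>\<omega>. X \<omega> ^ 2)"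
  shows "(CLINT \<omega>|M. iexp (X \<omega>)) = exp (- v / 2)"
    and "expectation (\<lambda>\<omega>. X \<omega> ^ 4) = 3 * v ^ 2"
    and "expectation (\<lambda>\<omega>. X \<omega> ^ 8) = 105 * v ^ 4"
proof -
  have [measurable]: "X \<in> borel_measurable M" using X by (simp add: normal_rv_def)
  have "(CLINT \<omega>|M. iexp (X \<omega>)) = exp (- v / 2) \<and> expectation (\<lambda>\<omega>. X \<omega> ^ 4) = 3 * v ^ 2 \<and> expectation (\<lambda>\<omega>. X \<omega> ^ 8) = 105 * v ^ 4"
    using X
  proof (cases rule: normal_rv_cases)
    case (const \<mu>)
    have "expectation X = (LINT \<omega>|M. \<mu>)" using const by (intro integral_cong_AE) auto
    then have 0: "AE \<omega> in M. X \<omega> = 0" using mean const by (simp add: prob_space)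
    have "expectation (\<lambda>\<omega>. X \<omega> ^ k) = 0" if "k > 0" for k
      by (rule integral_eq_zero_AE) (use 0 that in \<open>auto elim!: eventually_mono\<close>)
    moreover have "(CLINT \<omega>|M. iexp (X \<omega>)) = (CLINT \<omega>|M. 1)"
      using 0 by (intro integral_cong_AE) (auto elim!: eventually_mono)
    ultimately show ?thesis by (simp add: v_def prob_space)
  next
    case (normal \<mu> \<sigma>)
    define Z where "Z \<omega> = (X \<omega> - \<mu>) / \<sigma>" for \<omega>
    have [measurable]: "Z \<in> borel_measurable M" unfolding Z_def[abs_def] by measurable
    have dZ: "distr M borel Z = std_normal_distribution" using normal by (simp add: Z_def[abs_def])
    have XZ: "X \<omega> = \<sigma> * Z \<omega> + \<mu>" for \<omega> using normal(1) by (simp add: Z_def)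
    have Zint: "integrable M (\<lambda>\<omega>. Z \<omega> ^ k)" for k
      using integrable_std_normal_distribution_moment[of k] unfolding dZ[symmetric] by (simp add: integrable_distr_eq)
    have Zmom: "expectation (\<lambda>\<omega>. Z \<omega> ^ k) = (LINT z|std_normal_distribution. z ^ k)" for k
      unfolding dZ[symmetric] by (simp add: integral_distr)
    have "expectation X = \<sigma> * expectation Z + \<mu>"
      unfolding XZ using Zint[of 1] by (simp add: prob_space)
    then have "\<mu> = 0"
      using mean Zmom[of 1] integral_std_normal_distribution_moment_odd[of 1] by simp
    then have XZ: "X \<omega> = \<sigma> * Z \<omega>" for \<omega> using XZ by simp
    have mom: "expectation (\<lambda>\<omega>. X \<omega> ^ (2 * k)) = \<sigma> ^ (2 * k) * (fact (2 * k) / (2 ^ k * fact k))" for k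
      using Zmom[of "2 * k"] std_normal_distribution_even_moments(1)[of k] by (simp add: XZ power_mult_distrib)
    have v: "v = \<sigma>\<^sup>2" using mom[of 1] by (simp add: v_def)
    have "expectation (\<lambda>\<omega>. X \<omega> ^ 4) = 3 * v ^ 2" "expectation (\<lambda>\<omega>. X \<omega> ^ 8) = 105 * v ^ 4"
      using mom[of 2] mom[of 4] by (simp_all add: v fact_numeral flip: power_mult)
    moreover have "(CLINT \<omega>|M. iexp (X \<omega>)) = char std_normal_distribution \<sigma>"
      unfolding dZ[symmetric] by (simp add: char_distr_eq XZ)
    ultimately show ?thesis by (simp add: char_std_normal_distribution v)
  qed
  then show "(CLINT \<omega>|M. iexp (X \<omega>)) = exp (- v / 2)" "expectation (\<lambda>\<omega>. X \<omega> ^ 4) = 3 * v ^ 2"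
    "expectation (\<lambda>\<omega>. X \<omega> ^ 8) = 105 * v ^ 4" by auto
qed

end

locale spin_coeffs = prob_space M for M :: "'w measure" +
  fixes s :: int and C :: "nat \<Rightarrow> real" and a :: "nat \<times> int \<Rightarrow> 'w \<Rightarrow> complex"
  assumes coeffs: "gaussian_spin_coeffs M s C a"
begin

lemma coeff_measurable [measurable]: "p \<in> spin_indices s \<Longrightarrow> a p \<in> borel_measurable M"
  using coeffs by (simp add: gaussian_spin_coeffs_def jointly_gaussian_def)

lemma linear_combination_normal:
  "finite F \<Longrightarrow> F \<subseteq> spin_indices s \<Longrightarrow> normal_rv M (\<lambda>\<omega>. \<Sum>p\<in>F. Re (c p * a p \<omega>))"
  using coeffs by (simp add: gaussian_spin_coeffs_def jointly_gaussian_def)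

lemma Re_Im_coeff_normal:
  assumes "p \<in> spin_indices s"
  shows "normal_rv M (\<lambda>\<omega>. Re (a p \<omega>))" "normal_rv M (\<lambda>\<omega>. Im (a p \<omega>))"
  using linear_combination_normal[of "{p}" "\<lambda>_. 1"] linear_combination_normal[of "{p}" "\<lambda>_. - \<i>"] assms by auto

lemma integrable_coeff_square: "p \<in> spin_indices s \<Longrightarrow> integrable M (\<lambda>\<omega>. (cmod (a p \<omega>))\<^sup>2)"
  using Re_Im_coeff_normal[of p] by (simp add: cmod_power2 normal_rv_integrable_power)

lemma integrable_coeff: "p \<in> spin_indices s \<Longrightarrow> integrable M (a p)"
proof (rule Bochner_Integration.integrable_bound[of M "\<lambda>\<omega>. 1 + (cmod (a p \<omega>))\<^sup>2"])
  have "cmod z \<le> 1 + (cmod z)\<^sup>2" for z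
    using zero_le_power2[of "cmod z - 1"] norm_ge_zero[of z] by (simp add: power2_diff del: norm_ge_zero)
  then show "AE \<omega> in M. norm (a p \<omega>) \<le> norm (1 + (cmod (a p \<omega>))\<^sup>2)"
    by (auto intro!: AE_I2 intro: order_trans)
qed (auto simp: integrable_coeff_square)

lemma integrable_coeff_mult:
  assumes "p \<in> spin_indices s" "q \<in> spin_indices s"
  shows "integrable M (\<lambda>\<omega>. a p \<omega> * a q \<omega>)" "integrable M (\<lambda>\<omega>. a p \<omega> * cnj (a q \<omega>))"
proof -
  have [measurable]: "cnj \<in> borel_measurable borel" "a p \<in> borel_measurable M" "a q \<in> borel_measurable M"
    using assms by (auto intro!: borel_measurable_continuous_onI continuous_intros)
  show "integrable M (\<lambda>\<omega>. a p \<omega> * a q \<omega>)" "integrable M (\<lambda>\<omega>. a p \<omega> * cnj (a q \<omega>))"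
    using assms by (auto intro!: integrable_mult_square_integrable integrable_coeff_square)
qed

lemma expectation_coeff: "p \<in> spin_indices s \<Longrightarrow> expectation (a p) = 0"
  using coeffs by (simp add: gaussian_spin_coeffs_def)

lemma covariance_coeff:
  "p \<in> spin_indices s \<Longrightarrow> q \<in> spin_indices s \<Longrightarrow>
     expectation (\<lambda>\<omega>. a p \<omega> * cnj (a q \<omega>)) = (if p = q then of_real (C (fst p)) else 0)"
  "p \<in> spin_indices s \<Longrightarrow> q \<in> spin_indices s \<Longrightarrow> expectation (\<lambda>\<omega>. a p \<omega> * a q \<omega>) = 0"
  using coeffs by (simp_all add: gaussian_spin_coeffs_def)

text \<open>Besides the variance, the vanishing of the unconjugated second moment is recorded:
  complex linear combinations inherit it from the coefficients, and it decides how the variance is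
  shared by real and imaginary part.\<close>

lemma square_moment_linear_combination:
  assumes F: "finite F" "F \<subseteq> spin_indices s"
  shows "expectation (\<lambda>\<omega>. (cmod (\<Sum>p\<in>F. c p * a p \<omega>))\<^sup>2) = (\<Sum>p\<in>F. (cmod (c p))\<^sup>2 * C (fst p))"
    and "expectation (\<lambda>\<omega>. (\<Sum>p\<in>F. c p * a p \<omega>)\<^sup>2) = 0"
    and "integrable M (\<lambda>\<omega>. (cmod (\<Sum>p\<in>F. c p * a p \<omega>))\<^sup>2)"
    and "integrable M (\<lambda>\<omega>. (\<Sum>p\<in>F. c p * a p \<omega>)\<^sup>2)"
proof -
  define Z where "Z \<omega> = (\<Sum>p\<in>F. c p * a p \<omega>)" for \<omega>
  have sq: "complex_of_real ((cmod (Z \<omega>))\<^sup>2) = (\<Sum>p\<in>F. \<Sum>q\<in>F. c p * cnj (c q) * (a p \<omega> * cnj (a q \<omega>)))" for \<omega>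
    unfolding complex_norm_square Z_def cnj_sum sum_product by (simp add: mult_ac)
  have sq2: "(Z \<omega>)\<^sup>2 = (\<Sum>p\<in>F. \<Sum>q\<in>F. c p * c q * (a p \<omega> * a q \<omega>))" for \<omega>
    unfolding power2_eq_square Z_def sum_product by (simp add: mult_ac)
  have int: "integrable M (\<lambda>\<omega>. complex_of_real ((cmod (Z \<omega>))\<^sup>2))"
    unfolding sq using F by (intro Bochner_Integration.integrable_sum integrable_mult_right integrable_coeff_mult) auto
  then show "integrable M (\<lambda>\<omega>. (cmod (\<Sum>p\<in>F. c p * a p \<omega>))\<^sup>2)"
    unfolding Z_def[symmetric] by (simp only: complex_of_real_integrable_eq)
  show "integrable M (\<lambda>\<omega>. (\<Sum>p\<in>F. c p * a p \<omega>)\<^sup>2)"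
    unfolding Z_def[symmetric] sq2 using F
    by (intro Bochner_Integration.integrable_sum integrable_mult_right integrable_coeff_mult) auto
  have "complex_of_real (expectation (\<lambda>\<omega>. (cmod (Z \<omega>))\<^sup>2)) = (CLINT \<omega>|M. complex_of_real ((cmod (Z \<omega>))\<^sup>2))"
    by (rule integral_complex_of_real[symmetric])
  also have "\<dots> = (\<Sum>p\<in>F. \<Sum>q\<in>F. c p * cnj (c q) * (if p = q then of_real (C (fst p)) else 0))"
  proof -
    have "(CLINT \<omega>|M. complex_of_real ((cmod (Z \<omega>))\<^sup>2)) = (\<Sum>p\<in>F. \<Sum>q\<in>F. c p * cnj (c q) * expectation (\<lambda>\<omega>. a p \<omega> * cnj (a q \<omega>)))"
      unfolding sq using F by (intro integral_double_sum integrable_coeff_mult) auto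
    also have "\<dots> = (\<Sum>p\<in>F. \<Sum>q\<in>F. c p * cnj (c q) * (if p = q then of_real (C (fst p)) else 0))"
      using F by (intro sum.cong refl) (simp only: covariance_coeff subset_iff)
    finally show ?thesis .
  qed
  also have "\<dots> = (\<Sum>p\<in>F. c p * cnj (c p) * of_real (C (fst p)))"
    using F by (intro sum.cong refl) (simp add: if_distrib sum.delta' cong: if_cong)
  also have "\<dots> = complex_of_real (\<Sum>p\<in>F. (cmod (c p))\<^sup>2 * C (fst p))"
    by (simp add: complex_norm_square[symmetric])
  finally show "expectation (\<lambda>\<omega>. (cmod (\<Sum>p\<in>F. c p * a p \<omega>))\<^sup>2) = (\<Sum>p\<in>F. (cmod (c p))\<^sup>2 * C (fst p))"
    unfolding Z_def of_real_eq_iff .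
  show "expectation (\<lambda>\<omega>. (\<Sum>p\<in>F. c p * a p \<omega>)\<^sup>2) = 0"
  proof -
    have "expectation (\<lambda>\<omega>. (Z \<omega>)\<^sup>2) = (\<Sum>p\<in>F. \<Sum>q\<in>F. c p * c q * expectation (\<lambda>\<omega>. a p \<omega> * a q \<omega>))"
      unfolding sq2 using F by (intro integral_double_sum integrable_coeff_mult) auto
    also have "\<dots> = 0"
      using F by (intro sum.neutral ballI) (simp add: covariance_coeff subsetD[OF F(2)])
    finally show ?thesis by (simp add: Z_def)
  qed
qed

text \<open>Since (Re z)^2 = (|z|^2 + Re (z^2)) / 2 and the mean of z^2 is zero, the real part
  carries exactly half of the complex variance. This half and the 1/2 in the Gaussian characteristic
  function make the 4 in the exponent.\<close>

lemma real_linear_combination: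
  fixes c :: "nat \<times> int \<Rightarrow> complex"
  assumes F: "finite F" "F \<subseteq> spin_indices s"
  defines "X \<equiv> \<lambda>\<omega>. \<Sum>p\<in>F. Re (c p * a p \<omega>)"
  shows "expectation X = 0"
    and "expectation (\<lambda>\<omega>. (X \<omega>)\<^sup>2) = (\<Sum>p\<in>F. (cmod (c p))\<^sup>2 * C (fst p)) / 2"
    and "integrable M (\<lambda>\<omega>. (X \<omega>)\<^sup>2)"
    and "(CLINT \<omega>|M. iexp (X \<omega>)) = exp (- (\<Sum>p\<in>F. (cmod (c p))\<^sup>2 * C (fst p)) / 4)"
proof -
  have n: "normal_rv M X" unfolding X_def using F by (rule linear_combination_normal)
  show mean: "expectation X = 0"
  proof -
    have "expectation X = (\<Sum>p\<in>F. expectation (\<lambda>\<omega>. Re (c p * a p \<omega>)))"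
      unfolding X_def using F by (intro Bochner_Integration.integral_sum integrable_Re integrable_mult_right integrable_coeff) auto
    also have "\<dots> = (\<Sum>p\<in>F. Re (c p * expectation (a p)))"
    proof (intro sum.cong refl)
      fix p assume "p \<in> F"
      then have "integrable M (\<lambda>\<omega>. c p * a p \<omega>)" using F by (intro integrable_mult_right integrable_coeff) auto
      from integral_Re[OF this] show "expectation (\<lambda>\<omega>. Re (c p * a p \<omega>)) = Re (c p * expectation (a p))"
        by (simp only: integral_mult_right_zero)
    qed
    also have "\<dots> = 0" using F by (intro sum.neutral) (auto simp: expectation_coeff)
    finally show ?thesis .
  qed
  have X2: "(X \<omega>)\<^sup>2 = ((cmod (\<Sum>p\<in>F. c p * a p \<omega>))\<^sup>2 + Re ((\<Sum>p\<in>F. c p * a p \<omega>)\<^sup>2)) / 2" for \<omega>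
  proof -
    have "X \<omega> = Re (\<Sum>p\<in>F. c p * a p \<omega>)" by (simp only: X_def Re_sum)
    moreover have "(Re z)\<^sup>2 = ((cmod z)\<^sup>2 + Re (z\<^sup>2)) / 2" for z
      unfolding cmod_power2 by (simp add: power2_eq_square)
    ultimately show ?thesis by (simp only:)
  qed
  show "integrable M (\<lambda>\<omega>. (X \<omega>)\<^sup>2)" using n by (rule normal_rv_integrable_power)
  show var: "expectation (\<lambda>\<omega>. (X \<omega>)\<^sup>2) = (\<Sum>p\<in>F. (cmod (c p))\<^sup>2 * C (fst p)) / 2"
    unfolding X2 using square_moment_linear_combination[OF F, of c] by simp
  show "(CLINT \<omega>|M. iexp (X \<omega>)) = exp (- (\<Sum>p\<in>F. (cmod (c p))\<^sup>2 * C (fst p)) / 4)"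
    using normal_rv_centered(1)[OF n mean] by (simp add: var)
qed

end

section \<open>Coefficients of a spin field as integrals of its paths\<close>

text \<open>The convergence in \<open>expansion\<close> is pointwise on the sphere and comes without
  a rate. \<open>summable_spectrum\<close> supplies the bound on the error integrated over the
  sphere.\<close>

locale spin_field = spin_coeffs M s C a
  for M :: "'w measure" and s C a +
  fixes T :: "real ^ 3 \<Rightarrow> 'w \<Rightarrow> complex"
  assumes T_joint: "(\<lambda>(\<omega>, x). T x \<omega>) \<in> borel_measurable (M \<Otimes>\<^sub>M sphere_measure)"
    and expansion: "\<And>x. x \<in> sphere 0 1 \<Longrightarrow>
           (\<lambda>L. \<integral>\<^sup>+\<omega>. ennreal ((cmod (T x \<omega> -
              (\<Sum>l = first_multipole s..L. \<Sum>m = - int l..int l.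
                 a (l, m) \<omega> * spin_harmonic s l m x)))\<^sup>2) \<partial>M) \<longlonglongrightarrow> 0"
    and summable_spectrum: "summable (\<lambda>l. (2 * real l + 1) * C l)"
begin

abbreviation Y :: "nat \<times> int \<Rightarrow> real ^ 3 \<Rightarrow> complex" where
  "Y p \<equiv> spin_harmonic s (fst p) (snd p)"

definition idx :: "nat \<Rightarrow> (nat \<times> int) set" where
  "idx L = (SIGMA l:{first_multipole s..L}. {- int l..int l})"

definition partial :: "nat \<Rightarrow> real ^ 3 \<Rightarrow> 'w \<Rightarrow> complex" where
  "partial L x \<omega> = (\<Sum>p\<in>idx L. Y p x * a p \<omega>)"

sublocale M_sphere: pair_sigma_finite M sphere_measure
  by unfold_locales

lemma T_joint' [measurable]: "(\<lambda>z. T (snd z) (fst z)) \<in> borel_measurable (M \<Otimes>\<^sub>M sphere_measure)"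
  using T_joint by (simp add: case_prod_beta')

lemma measurable_T [measurable]: "x \<in> sphere 0 1 \<Longrightarrow> T x \<in> borel_measurable M"
  using measurable_compose[OF measurable_Pair2'[of x sphere_measure M] T_joint'] by simp

lemma measurable_path [measurable]: "\<omega> \<in> space M \<Longrightarrow> (\<lambda>x. T x \<omega>) \<in> borel_measurable sphere_measure"
  using measurable_compose[OF measurable_Pair1'[of \<omega> M sphere_measure] T_joint'] by simp

lemma finite_idx [simp]: "finite (idx L)" and idx_subset: "idx L \<subseteq> spin_indices s"
  and idx_mono: "L \<le> L' \<Longrightarrow> idx L \<subseteq> idx L'" and idx_0: "idx 0 = {}"
  by (auto simp: idx_def spin_indices_def first_multipole_def)

lemma spin_indices_idx: "p \<in> spin_indices s \<Longrightarrow> fst p \<le> L \<Longrightarrow> p \<in> idx L"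
  by (auto simp: idx_def spin_indices_def)

lemma spin_indices_bounds: "p \<in> spin_indices s \<Longrightarrow> \<bar>snd p\<bar> \<le> int (fst p) \<and> \<bar>s\<bar> \<le> int (fst p)"
  by (auto simp: spin_indices_def first_multipole_def)

lemma expansion':
  assumes "x \<in> sphere 0 1"
  shows "(\<lambda>L. \<integral>\<^sup>+\<omega>. ennreal ((cmod (T x \<omega> - partial L x \<omega>))\<^sup>2) \<partial>M) \<longlonglongrightarrow> 0"
proof -
  have "partial L x \<omega> = (\<Sum>l = first_multipole s..L. \<Sum>m = - int l..int l. a (l, m) \<omega> * spin_harmonic s l m x)" for L \<omega>
    unfolding partial_def idx_def by (subst sum.Sigma) (auto intro!: sum.cong simp: mult_ac)
  then show ?thesis using expansion[OF assms] by simp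
qed

lemma measurable_Y [measurable]: "Y p \<in> borel_measurable sphere_measure"
  by (rule measurable_spin_harmonic_sphere)

lemma measurable_partial [measurable]:
  "(\<lambda>z. partial L (snd z) (fst z)) \<in> borel_measurable (M \<Otimes>\<^sub>M sphere_measure)"
proof -
  have "(\<lambda>z. Y p (snd z) * a p (fst z)) \<in> borel_measurable (M \<Otimes>\<^sub>M sphere_measure)" if "p \<in> idx L" for p
  proof -
    have [measurable]: "a p \<in> borel_measurable M" using that idx_subset by (auto intro: coeff_measurable)
    show ?thesis by measurable
  qed
  then show ?thesis unfolding partial_def by (rule borel_measurable_sum)
qed

lemma spectrum_nonneg: "p \<in> spin_indices s \<Longrightarrow> 0 \<le> C (fst p)"
proof -
  assume p: "p \<in> spin_indices s"
  have "0 \<le> expectation (\<lambda>\<omega>. (cmod (\<Sum>q\<in>{p}. 1 * a q \<omega>))\<^sup>2)" by simp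
  also have "\<dots> = C (fst p)" using square_moment_linear_combination(1)[of "{p}" "\<lambda>_. 1"] p by simp
  finally show ?thesis .
qed

lemma integrable_Y_mult: "integrable sphere_measure (\<lambda>x. Y p x * cnj (Y q x))"
proof -
  obtain c where c: "0 < c" "\<And>x. x \<in> sphere 0 1 \<Longrightarrow> cmod (Y p x) \<le> c" using bounded_spin_harmonic by blast
  obtain d where d: "0 < d" "\<And>x. x \<in> sphere 0 1 \<Longrightarrow> cmod (Y q x) \<le> d" using bounded_spin_harmonic by blast
  show ?thesis
  proof (rule sphere.integrable_const_bound)
    show "AE x in sphere_measure. norm (Y p x * cnj (Y q x)) \<le> c * d"
      using c d by (intro AE_I2) (auto simp: norm_mult intro!: mult_mono)
  qed measurable
qed

lemma integral_Y_mult: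
  "p \<in> spin_indices s \<Longrightarrow> q \<in> spin_indices s \<Longrightarrow> (LINT x|sphere_measure. Y p x * cnj (Y q x)) = (if p = q then 1 else 0)"
  using spin_indices_bounds[of p] spin_indices_bounds[of q]
  by (subst spin_harmonic_orthonormal) (auto simp: prod_eq_iff)

lemma nn_integral_Y_square:
  assumes "p \<in> spin_indices s"
  shows "(\<integral>\<^sup>+x. ennreal ((cmod (Y p x))\<^sup>2) \<partial>sphere_measure) = 1"
proof -
  have int: "integrable sphere_measure (\<lambda>x. (cmod (Y p x))\<^sup>2)"
    using integrable_Y_mult[of p p] unfolding complex_norm_square[symmetric] complex_of_real_integrable_eq .
  have "complex_of_real (LINT x|sphere_measure. (cmod (Y p x))\<^sup>2) = 1"
    using integral_Y_mult[OF assms assms]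
    unfolding complex_norm_square[symmetric] integral_complex_of_real by simp
  then have "(LINT x|sphere_measure. (cmod (Y p x))\<^sup>2) = 1" by (simp only: of_real_eq_1_iff)
  then show ?thesis
    using nn_integral_eq_integral[OF int] by simp
qed

section \<open>Mean-square error of the expansion, integrated over the sphere\<close>

definition V :: "nat \<times> int \<Rightarrow> real ^ 3 \<Rightarrow> real" where
  "V p x = (cmod (Y p x))\<^sup>2 * C (fst p)"

lemma V_nonneg: "p \<in> spin_indices s \<Longrightarrow> 0 \<le> V p x"
  by (simp add: V_def spectrum_nonneg)

lemma partial_diff_moment:
  assumes "L \<le> L'"
  shows "(\<integral>\<^sup>+\<omega>. ennreal ((cmod (partial L' x \<omega> - partial L x \<omega>))\<^sup>2) \<partial>M) = ennreal (\<Sum>p\<in>idx L' - idx L. V p x)"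
proof -
  have d: "partial L' x \<omega> - partial L x \<omega> = (\<Sum>p\<in>idx L' - idx L. Y p x * a p \<omega>)" for \<omega>
    unfolding partial_def using idx_mono[OF assms] by (simp add: sum_diff)
  have F: "finite (idx L' - idx L)" "idx L' - idx L \<subseteq> spin_indices s" using idx_subset[of L'] by auto
  show ?thesis
    unfolding d V_def square_moment_linear_combination(1)[OF F, of "\<lambda>p. Y p x", symmetric]
    by (intro nn_integral_eq_integral square_moment_linear_combination(3)[OF F]) auto
qed

definition remainder :: "nat \<Rightarrow> real ^ 3 \<Rightarrow> ennreal" where
  "remainder L x = (\<integral>\<^sup>+\<omega>. ennreal ((cmod (T x \<omega> - partial L x \<omega>))\<^sup>2) \<partial>M)"

lemma measurable_partial_section [measurable]: "partial L x \<in> borel_measurable M"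
  unfolding partial_def using idx_subset by (intro borel_measurable_sum borel_measurable_times) (auto intro: coeff_measurable)

text \<open>\<open>T\<close> is compared with a later partial sum, whose own error vanishes in the
  limit; only increments of partial sums remain, and their second moments are explicit. The factor 2
  comes from |u + v|^2 \<le> 2 |u|^2 + 2 |v|^2. The bound is an extended real and becomes finite
  only after integration over \<open>x\<close>.\<close>

lemma remainder_le:
  assumes x: "x \<in> sphere 0 1"
  shows "remainder L x \<le> 2 * (SUP L'. ennreal (\<Sum>p\<in>idx L' - idx L. V p x))"
proof -
  have [measurable]: "T x \<in> borel_measurable M" using x by simp
  define U where "U = (SUP L'. ennreal (\<Sum>p\<in>idx L' - idx L. V p x))"
  have "remainder L x \<le> 2 * U + 2 * remainder L' x" if "L \<le> L'" for L'
  proof -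
    have "remainder L x \<le> (\<integral>\<^sup>+\<omega>. 2 * ennreal ((cmod (partial L' x \<omega> - partial L x \<omega>))\<^sup>2) + 2 * ennreal ((cmod (T x \<omega> - partial L' x \<omega>))\<^sup>2) \<partial>M)"
      unfolding remainder_def
    proof (rule nn_integral_mono)
      fix \<omega>
      define u v where "u = partial L' x \<omega> - partial L x \<omega>" and "v = T x \<omega> - partial L' x \<omega>"
      have "(cmod (u + v))\<^sup>2 \<le> (cmod u + cmod v)\<^sup>2" by (intro power_mono norm_triangle_ineq) simp
      also have "\<dots> \<le> 2 * (cmod u)\<^sup>2 + 2 * (cmod v)\<^sup>2"
        using zero_le_power2[of "cmod u - cmod v"] by (simp add: power2_diff power2_sum)
      finally have "(cmod (T x \<omega> - partial L x \<omega>))\<^sup>2 \<le> 2 * (cmod u)\<^sup>2 + 2 * (cmod v)\<^sup>2"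
        by (simp add: u_def v_def)
      then have "ennreal ((cmod (T x \<omega> - partial L x \<omega>))\<^sup>2) \<le> ennreal (2 * (cmod u)\<^sup>2 + 2 * (cmod v)\<^sup>2)"
        by (rule ennreal_leI)
      also have "\<dots> = 2 * ennreal ((cmod u)\<^sup>2) + 2 * ennreal ((cmod v)\<^sup>2)"
        by (simp add: ennreal_plus ennreal_mult)
      finally show "ennreal ((cmod (T x \<omega> - partial L x \<omega>))\<^sup>2) \<le> 2 * ennreal ((cmod (partial L' x \<omega> - partial L x \<omega>))\<^sup>2) + 2 * ennreal ((cmod (T x \<omega> - partial L' x \<omega>))\<^sup>2)"
        by (simp add: u_def v_def)
    qed
    also have "\<dots> = 2 * (\<integral>\<^sup>+\<omega>. ennreal ((cmod (partial L' x \<omega> - partial L x \<omega>))\<^sup>2) \<partial>M) + 2 * remainder L' x"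
      by (simp add: nn_integral_add nn_integral_cmult remainder_def)
    also have "\<dots> \<le> 2 * U + 2 * remainder L' x"
      unfolding partial_diff_moment[OF that] U_def by (intro add_right_mono mult_left_mono SUP_upper) auto
    finally show ?thesis .
  qed
  moreover have "(\<lambda>L'. 2 * U + 2 * remainder L' x) \<longlonglongrightarrow> 2 * U + 2 * 0"
    using expansion'[OF x] unfolding remainder_def by (intro tendsto_add tendsto_const ennreal_tendsto_cmult) auto
  ultimately have "remainder L x \<le> 2 * U + 2 * 0"
    by (intro LIMSEQ_le_const) auto
  then show ?thesis by (simp add: U_def)
qed

text \<open>The part of the series of (2 l + 1) C_l beyond \<open>L\<close>. Terms below the first
  multipole are cut off because nothing is known about \<open>C\<close> there.\<close>

definition tail :: "nat \<Rightarrow> real" where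
  "tail L = (\<Sum>l. if first_multipole s \<le> l then (2 * real l + 1) * C l else 0) -
     (\<Sum>l\<le>L. if first_multipole s \<le> l then (2 * real l + 1) * C l else 0)"

lemma tail:
  shows tail_tendsto: "tail \<longlonglongrightarrow> 0"
    and tail_ge: "(\<Sum>p\<in>idx L' - idx L. C (fst p)) \<le> tail L"
    and tail_nonneg: "0 \<le> tail L"
proof -
  define f where "f l = (if first_multipole s \<le> l then (2 * real l + 1) * C l else 0)" for l
  have "summable f"
    by (rule summable_cong[THEN iffD2, OF _ summable_spectrum])
       (auto simp: f_def intro!: eventually_mono[OF eventually_ge_at_top[of "first_multipole s"]])
  then have lim: "(\<lambda>L. \<Sum>l\<le>L. f l) \<longlonglongrightarrow> suminf f" by (rule summable_LIMSEQ')
  have f0: "0 \<le> f l" for l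
    using spectrum_nonneg[of "(l, 0)"] by (auto simp: f_def spin_indices_def)
  have tail_eq: "tail L = suminf f - (\<Sum>l\<le>L. f l)" for L by (simp add: tail_def f_def[abs_def])
  show "tail \<longlonglongrightarrow> 0"
    using tendsto_diff[OF tendsto_const[of "suminf f"] lim] by (simp add: tail_eq[abs_def])
  have le: "(\<Sum>l\<le>L. f l) \<le> suminf f" for L
    using \<open>summable f\<close> f0 by (intro sum_le_suminf) auto
  then show "0 \<le> tail L" by (simp add: tail_eq)
  have I: "(\<Sum>p\<in>idx L. C (fst p)) = (\<Sum>l\<le>L. f l)" for L
  proof -
    have "(\<Sum>p\<in>idx L. C (fst p)) = (\<Sum>l = first_multipole s..L. \<Sum>m = - int l..int l. C l)"
      unfolding idx_def by (subst sum.Sigma) (auto simp: case_prod_beta)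
    also have "\<dots> = (\<Sum>l = first_multipole s..L. f l)"
      by (intro sum.cong refl) (simp add: f_def)
    also have "\<dots> = (\<Sum>l\<le>L. f l)"
      by (intro sum.mono_neutral_left) (auto simp: f_def)
    finally show ?thesis .
  qed
  show "(\<Sum>p\<in>idx L' - idx L. C (fst p)) \<le> tail L"
  proof (cases "L \<le> L'")
    case True
    then have "(\<Sum>p\<in>idx L' - idx L. C (fst p)) = (\<Sum>l\<le>L'. f l) - (\<Sum>l\<le>L. f l)"
      using idx_mono by (simp add: sum_diff I)
    then show ?thesis using le[of L'] by (simp add: tail_eq)
  next
    case False
    then have e: "idx L' - idx L = {}" using idx_mono[of L' L] by auto
    show ?thesis unfolding e using le[of L] by (simp add: tail_eq)
  qed
qed

text \<open>Each |Y|^2 has integral one, so the increments integrate to sums of \<open>C\<close>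
  over the indices between \<open>L\<close> and \<open>L'\<close>. The increments grow with
  \<open>L'\<close>, and monotone convergence moves the supremum outside.\<close>

lemma nn_integral_remainder: "(\<integral>\<^sup>+x. remainder L x \<partial>sphere_measure) \<le> 2 * ennreal (tail L)"
proof -
  have [measurable]: "V p \<in> borel_measurable sphere_measure" for p
    unfolding V_def[abs_def] by measurable
  have sub: "idx L' - idx L \<subseteq> spin_indices s" for L' using idx_subset by auto
  have "(\<integral>\<^sup>+x. remainder L x \<partial>sphere_measure) \<le> (\<integral>\<^sup>+x. 2 * (SUP L'. ennreal (\<Sum>p\<in>idx L' - idx L. V p x)) \<partial>sphere_measure)"
    by (intro nn_integral_mono remainder_le) simp
  also have "\<dots> = 2 * (\<integral>\<^sup>+x. (SUP L'. ennreal (\<Sum>p\<in>idx L' - idx L. V p x)) \<partial>sphere_measure)"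
    by (rule nn_integral_cmult) measurable
  also have "(\<integral>\<^sup>+x. (SUP L'. ennreal (\<Sum>p\<in>idx L' - idx L. V p x)) \<partial>sphere_measure) =
      (SUP L'. \<integral>\<^sup>+x. ennreal (\<Sum>p\<in>idx L' - idx L. V p x) \<partial>sphere_measure)"
  proof (rule nn_integral_monotone_convergence_SUP)
    show "incseq (\<lambda>L' x. ennreal (\<Sum>p\<in>idx L' - idx L. V p x))"
    proof (intro incseq_SucI le_funI ennreal_leI sum_mono2)
      show "idx n - idx L \<subseteq> idx (Suc n) - idx L" for n using idx_mono[of n "Suc n"] by auto
      show "0 \<le> V p x" if "p \<in> (idx (Suc n) - idx L) - (idx n - idx L)" for p x n
        using that sub[of "Suc n"] by (intro V_nonneg) blast
    qed simp
  qed measurable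
  also have "\<dots> \<le> ennreal (tail L)"
  proof (rule SUP_least)
    fix L'
    have p: "p \<in> spin_indices s" if "p \<in> idx L' - idx L" for p using that sub[of L'] by blast
    have "ennreal (\<Sum>p\<in>idx L' - idx L. V p x) = (\<Sum>p\<in>idx L' - idx L. ennreal (C (fst p)) * ennreal ((cmod (Y p x))\<^sup>2))" for x
    proof -
      have "ennreal (\<Sum>p\<in>idx L' - idx L. V p x) = (\<Sum>p\<in>idx L' - idx L. ennreal (V p x))"
        by (intro sum_ennreal[symmetric] V_nonneg p)
      also have "\<dots> = (\<Sum>p\<in>idx L' - idx L. ennreal (C (fst p)) * ennreal ((cmod (Y p x))\<^sup>2))"
        by (intro sum.cong refl) (simp add: V_def ennreal_mult' mult.commute spectrum_nonneg[OF p])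
      finally show ?thesis .
    qed
    then have "(\<integral>\<^sup>+x. ennreal (\<Sum>p\<in>idx L' - idx L. V p x) \<partial>sphere_measure) =
       (\<integral>\<^sup>+x. (\<Sum>p\<in>idx L' - idx L. ennreal (C (fst p)) * ennreal ((cmod (Y p x))\<^sup>2)) \<partial>sphere_measure)"
      by simp
    also have "\<dots> = (\<Sum>p\<in>idx L' - idx L. ennreal (C (fst p)) * (\<integral>\<^sup>+x. ennreal ((cmod (Y p x))\<^sup>2) \<partial>sphere_measure))"
      by (simp add: nn_integral_sum nn_integral_cmult)
    also have "\<dots> = (\<Sum>p\<in>idx L' - idx L. ennreal (C (fst p)))"
      by (intro sum.cong refl) (simp add: nn_integral_Y_square[OF p])
    also have "\<dots> = ennreal (\<Sum>p\<in>idx L' - idx L. C (fst p))"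
      by (intro sum_ennreal spectrum_nonneg p)
    also have "\<dots> \<le> ennreal (tail L)" by (rule ennreal_leI) (rule tail_ge)
    finally show "(\<integral>\<^sup>+x. ennreal (\<Sum>p\<in>idx L' - idx L. V p x) \<partial>sphere_measure) \<le> ennreal (tail L)" .
  qed
  finally show ?thesis by (simp add: mult_left_mono)
qed

lemma nn_integral_remainder_pair:
  "(\<integral>\<^sup>+\<omega>. (\<integral>\<^sup>+x. ennreal ((cmod (T x \<omega> - partial L x \<omega>))\<^sup>2) \<partial>sphere_measure) \<partial>M) \<le> 2 * ennreal (tail L)"
proof -
  have "(\<integral>\<^sup>+\<omega>. (\<integral>\<^sup>+x. ennreal ((cmod (T x \<omega> - partial L x \<omega>))\<^sup>2) \<partial>sphere_measure) \<partial>M) = (\<integral>\<^sup>+x. remainder L x \<partial>sphere_measure)"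
    unfolding remainder_def by (rule M_sphere.Fubini'[symmetric]) (simp add: case_prod_beta')
  also have "\<dots> \<le> 2 * ennreal (tail L)" by (rule nn_integral_remainder)
  finally show ?thesis .
qed

lemma integrable_field_square: "integrable (M \<Otimes>\<^sub>M sphere_measure) (\<lambda>z. (cmod (T (snd z) (fst z)))\<^sup>2)"
proof (rule integrableI_bounded)
  have "(\<integral>\<^sup>+z. ennreal (norm ((cmod (T (snd z) (fst z)))\<^sup>2)) \<partial>(M \<Otimes>\<^sub>M sphere_measure)) =
     (\<integral>\<^sup>+\<omega>. (\<integral>\<^sup>+x. ennreal ((cmod (T x \<omega> - partial 0 x \<omega>))\<^sup>2) \<partial>sphere_measure) \<partial>M)"
    by (subst sphere.nn_integral_fst[symmetric]) (simp_all add: partial_def idx_0)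
  \<comment> \<open>The first multipole is at least 1, so \<open>idx 0\<close> is empty and the
    error at \<open>L = 0\<close> is the field itself.\<close>
  also have "\<dots> \<le> 2 * ennreal (tail 0)" by (rule nn_integral_remainder_pair)
  also have "\<dots> < \<infinity>" by (simp add: ennreal_mult_less_top)
  finally show "(\<integral>\<^sup>+z. ennreal (norm ((cmod (T (snd z) (fst z)))\<^sup>2)) \<partial>(M \<Otimes>\<^sub>M sphere_measure)) < \<infinity>" .
qed measurable

lemma AE_integrable_path_square: "AE \<omega> in M. integrable sphere_measure (\<lambda>x. (cmod (T x \<omega>))\<^sup>2)"
  using M_sphere.AE_integrable_fst'[OF integrable_field_square] by simp

lemma integrable_path_mult:
  assumes \<omega>: "\<omega> \<in> space M" and int: "integrable sphere_measure (\<lambda>x. (cmod (T x \<omega>))\<^sup>2)"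
  shows "integrable sphere_measure (\<lambda>x. T x \<omega> * cnj (Y p x))"
proof (rule integrable_mult_square_integrable)
  show "integrable sphere_measure (\<lambda>x. (cmod (cnj (Y p x)))\<^sup>2)"
    using integrable_Y_mult[of p p] unfolding complex_norm_square[symmetric] complex_of_real_integrable_eq by simp
qed (use assms in \<open>measurable\<close>)

lemma integral_partial:
  assumes p: "p \<in> spin_indices s" "fst p \<le> L"
  shows "integrable sphere_measure (\<lambda>x. partial L x \<omega> * cnj (Y p x))"
    and "(LINT x|sphere_measure. partial L x \<omega> * cnj (Y p x)) = a p \<omega>"
proof -
  have eq: "partial L x \<omega> * cnj (Y p x) = (\<Sum>q\<in>idx L. a q \<omega> * (Y q x * cnj (Y p x)))" for x
    unfolding partial_def sum_distrib_right by (intro sum.cong refl) (simp add: mult_ac)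
  show "integrable sphere_measure (\<lambda>x. partial L x \<omega> * cnj (Y p x))"
    unfolding eq by (intro Bochner_Integration.integrable_sum integrable_mult_right integrable_Y_mult)
  have "(LINT x|sphere_measure. partial L x \<omega> * cnj (Y p x)) = (\<Sum>q\<in>idx L. a q \<omega> * (LINT x|sphere_measure. Y q x * cnj (Y p x)))"
    unfolding eq by (subst Bochner_Integration.integral_sum) (auto intro!: integrable_mult_right integrable_Y_mult)
  also have "\<dots> = (\<Sum>q\<in>idx L. a q \<omega> * (if q = p then 1 else 0))"
    using integral_Y_mult[OF subsetD[OF idx_subset[of L]] p(1)] by (intro sum.cong refl) (simp only:)
  also have "\<dots> = a p \<omega>" using spin_indices_idx[OF p] by (simp add: if_distrib sum.delta cong: if_cong)
  finally show "(LINT x|sphere_measure. partial L x \<omega> * cnj (Y p x)) = a p \<omega>" .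
qed

text \<open>For \<open>L\<close> at least the multipole of \<open>p\<close>, the coefficient of the
  partial sum is exactly \<open>a p\<close>, by orthonormality. So the difference of the two sides
  is the coefficient of the error \<open>T - partial L\<close>, whose mean modulus is bounded for
  every such \<open>L\<close> by a quantity tending to 0.\<close>

theorem AE_field_coefficient:
  assumes p: "p \<in> spin_indices s"
  shows "AE \<omega> in M. (LINT x|sphere_measure. T x \<omega> * cnj (Y p x)) = a p \<omega>"
proof -
  obtain c where c: "0 < c" "\<And>x. x \<in> sphere 0 1 \<Longrightarrow> cmod (Y p x) \<le> c" using bounded_spin_harmonic by blast
  define I where "I \<omega> = (LINT x|sphere_measure. T x \<omega> * cnj (Y p x)) - a p \<omega>" for \<omega>
  have [measurable]: "a p \<in> borel_measurable M" using p by simp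
  have "(\<lambda>\<omega>. LINT x|sphere_measure. T x \<omega> * cnj (Y p x)) \<in> borel_measurable M"
    by (rule sphere.borel_measurable_lebesgue_integral) (simp add: case_prod_beta')
  then have [measurable]: "I \<in> borel_measurable M" unfolding I_def[abs_def] by measurable
  define \<mu> where "\<mu> = measure sphere_measure (sphere 0 1)"
  define \<delta> where "\<delta> L = sqrt (tail L + 1 / real (Suc L))" for L
  have \<delta>: "0 < \<delta> L" "tail L \<le> (\<delta> L)\<^sup>2" for L
    using tail_nonneg[of L] by (auto simp: \<delta>_def add_nonneg_pos)
  have bound: "(\<integral>\<^sup>+\<omega>. ennreal (cmod (I \<omega>)) \<partial>M) \<le> ennreal (c * (\<delta> L * \<mu> + 2 * \<delta> L))" if L: "fst p \<le> L" for L
  proof -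
    have "(\<integral>\<^sup>+\<omega>. ennreal (cmod (I \<omega>)) \<partial>M) \<le>
      (\<integral>\<^sup>+\<omega>. (\<integral>\<^sup>+x. ennreal c * (ennreal (\<delta> L) + ennreal (1 / \<delta> L) * ennreal ((cmod (T x \<omega> - partial L x \<omega>))\<^sup>2)) \<partial>sphere_measure) \<partial>M)"
    proof (rule nn_integral_mono_AE)
      show "AE \<omega> in M. ennreal (cmod (I \<omega>)) \<le>
        (\<integral>\<^sup>+x. ennreal c * (ennreal (\<delta> L) + ennreal (1 / \<delta> L) * ennreal ((cmod (T x \<omega> - partial L x \<omega>))\<^sup>2)) \<partial>sphere_measure)"
        using AE_integrable_path_square AE_space
      proof eventually_elim
        case (elim \<omega>)
        note int = integrable_path_mult[OF elim(2,1), of p]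
        have "I \<omega> = (LINT x|sphere_measure. (T x \<omega> - partial L x \<omega>) * cnj (Y p x))"
          unfolding I_def integral_partial(2)[OF p L, symmetric]
          using int integral_partial(1)[OF p L] by (simp add: left_diff_distrib)
        moreover have "integrable sphere_measure (\<lambda>x. (T x \<omega> - partial L x \<omega>) * cnj (Y p x))"
          using int integral_partial(1)[OF p L] by (simp add: left_diff_distrib)
        ultimately have "ennreal (cmod (I \<omega>)) \<le> (\<integral>\<^sup>+x. ennreal (norm ((T x \<omega> - partial L x \<omega>) * cnj (Y p x))) \<partial>sphere_measure)"
          by (simp add: integral_norm_bound_ennreal)
        also have "\<dots> \<le> (\<integral>\<^sup>+x. ennreal c * (ennreal (\<delta> L) + ennreal (1 / \<delta> L) * ennreal ((cmod (T x \<omega> - partial L x \<omega>))\<^sup>2)) \<partial>sphere_measure)"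
        proof (rule nn_integral_mono)
          fix x assume "x \<in> space sphere_measure"
          then have x: "x \<in> sphere 0 1" by simp
          define u where "u = cmod (T x \<omega> - partial L x \<omega>)"
          \<comment> \<open>A substitute for the Cauchy-Schwarz inequality: either \<open>u\<close>
            is at most \<delta>, or \<open>u\<close> is at most its square over \<delta>. As the
            integrated square is at most 2 \<delta>^2, both parts are of order \<delta>.\<close>
          have u: "u \<le> \<delta> L + 1 / \<delta> L * u\<^sup>2"
          proof (cases "u \<le> \<delta> L")
            case False
            then have "u \<le> 1 / \<delta> L * u\<^sup>2" using \<delta>(1)[of L] by (simp add: field_simps power2_eq_square mult_right_mono)
            then show ?thesis using \<delta>(1)[of L] by linarith
          next
            case True
            have "0 \<le> 1 / \<delta> L * u\<^sup>2" using \<delta>(1)[of L] by simp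
            then show ?thesis using True by linarith
          qed
          have "norm ((T x \<omega> - partial L x \<omega>) * cnj (Y p x)) = cmod (Y p x) * u" by (simp add: norm_mult u_def)
          also have "\<dots> \<le> c * (\<delta> L + 1 / \<delta> L * u\<^sup>2)"
            using c x u by (intro mult_mono) (auto simp: u_def)
          finally have "ennreal (norm ((T x \<omega> - partial L x \<omega>) * cnj (Y p x))) \<le> ennreal (c * (\<delta> L + 1 / \<delta> L * u\<^sup>2))"
            by (rule ennreal_leI)
          also have "\<dots> = ennreal c * (ennreal (\<delta> L) + ennreal (1 / \<delta> L) * ennreal (u\<^sup>2))"
            using c(1) \<delta>(1)[of L] ennreal_mult'[of c "\<delta> L + 1 / \<delta> L * u\<^sup>2"]
              ennreal_plus[of "\<delta> L" "1 / \<delta> L * u\<^sup>2"] ennreal_mult'[of "1 / \<delta> L" "u\<^sup>2"]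
            by (simp only: less_imp_le zero_le_mult_iff zero_le_power2 zero_le_divide_1_iff simp_thms)
          finally show "ennreal (norm ((T x \<omega> - partial L x \<omega>) * cnj (Y p x))) \<le>
             ennreal c * (ennreal (\<delta> L) + ennreal (1 / \<delta> L) * ennreal ((cmod (T x \<omega> - partial L x \<omega>))\<^sup>2))"
            unfolding u_def .
        qed
        finally show ?case .
      qed
    qed
    also have "\<dots> = (\<integral>\<^sup>+\<omega>. ennreal c * (ennreal (\<delta> L) * ennreal \<mu> + ennreal (1 / \<delta> L) *
        (\<integral>\<^sup>+x. ennreal ((cmod (T x \<omega> - partial L x \<omega>))\<^sup>2) \<partial>sphere_measure)) \<partial>M)"
    proof (rule nn_integral_cong)
      fix \<omega> assume \<omega>: "\<omega> \<in> space M"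
      have [measurable]: "(\<lambda>x. partial L x \<omega>) \<in> borel_measurable sphere_measure"
        using measurable_compose[OF measurable_Pair1'[OF \<omega>, of sphere_measure] measurable_partial[of L]] by simp
      have [measurable]: "(\<lambda>x. T x \<omega>) \<in> borel_measurable sphere_measure" using \<omega> by (rule measurable_path)
      show "(\<integral>\<^sup>+x. ennreal c * (ennreal (\<delta> L) + ennreal (1 / \<delta> L) * ennreal ((cmod (T x \<omega> - partial L x \<omega>))\<^sup>2)) \<partial>sphere_measure) =
        ennreal c * (ennreal (\<delta> L) * ennreal \<mu> + ennreal (1 / \<delta> L) *
        (\<integral>\<^sup>+x. ennreal ((cmod (T x \<omega> - partial L x \<omega>))\<^sup>2) \<partial>sphere_measure))"
        by (simp add: nn_integral_add nn_integral_cmult \<mu>_def sphere.emeasure_eq_measure)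
    qed
    also have "\<dots> = ennreal c * (ennreal (\<delta> L) * ennreal \<mu> + ennreal (1 / \<delta> L) *
        (\<integral>\<^sup>+\<omega>. (\<integral>\<^sup>+x. ennreal ((cmod (T x \<omega> - partial L x \<omega>))\<^sup>2) \<partial>sphere_measure) \<partial>M))"
    proof -
      have [measurable]: "(\<lambda>\<omega>. \<integral>\<^sup>+x. ennreal ((cmod (T x \<omega> - partial L x \<omega>))\<^sup>2) \<partial>sphere_measure) \<in> borel_measurable M"
        by (rule sphere.borel_measurable_nn_integral) (simp add: case_prod_beta')
      show ?thesis by (simp add: nn_integral_add nn_integral_cmult emeasure_space_1)
    qed
    also have "\<dots> \<le> ennreal c * (ennreal (\<delta> L) * ennreal \<mu> + ennreal (1 / \<delta> L) * (2 * ennreal (tail L)))"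
      by (intro mult_left_mono add_left_mono nn_integral_remainder_pair) auto
    also have "\<dots> = ennreal (c * (\<delta> L * \<mu> + 1 / \<delta> L * (2 * tail L)))"
    proof -
      have "ennreal (1 / \<delta> L * (2 * tail L)) = ennreal (1 / \<delta> L) * (2 * ennreal (tail L))"
        using \<delta>(1)[of L] ennreal_mult'[of "1 / \<delta> L" "2 * tail L"] by (simp add: ennreal_mult')
      moreover have "0 \<le> 1 / \<delta> L * (2 * tail L)" "0 \<le> \<delta> L * \<mu>"
        using \<delta>(1)[of L] tail_nonneg[of L] by (simp_all add: \<mu>_def)
      ultimately show ?thesis
        using c(1) \<delta>(1)[of L] by (simp add: ennreal_mult' ennreal_plus del: times_divide_eq_left)
    qed
    also have "\<dots> \<le> ennreal (c * (\<delta> L * \<mu> + 2 * \<delta> L))"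
    proof -
      have "1 / \<delta> L * (2 * tail L) \<le> 1 / \<delta> L * (2 * (\<delta> L)\<^sup>2)" using \<delta>[of L] by (intro mult_left_mono) auto
      also have "\<dots> = 2 * \<delta> L" using \<delta>(1)[of L] by (simp add: power2_eq_square)
      finally show ?thesis using c(1) by (intro ennreal_leI mult_left_mono add_left_mono) auto
    qed
    finally show ?thesis .
  qed
  have "(\<lambda>L. tail L + 1 / real (Suc L)) \<longlonglongrightarrow> 0 + 0"
    using tail_tendsto by (intro tendsto_add LIMSEQ_inverse_real_of_nat[unfolded inverse_eq_divide])
  then have "\<delta> \<longlonglongrightarrow> 0"
    unfolding \<delta>_def[abs_def] using tendsto_real_sqrt by fastforce
  then have "(\<lambda>L. ennreal (c * (\<delta> L * \<mu> + 2 * \<delta> L))) \<longlonglongrightarrow> ennreal (c * (0 * \<mu> + 2 * 0))"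
    by (intro tendsto_intros)
  then have "(\<integral>\<^sup>+\<omega>. ennreal (cmod (I \<omega>)) \<partial>M) \<le> ennreal (c * (0 * \<mu> + 2 * 0))"
    by (rule LIMSEQ_le_const) (use bound in blast)
  then have "(\<integral>\<^sup>+\<omega>. ennreal (cmod (I \<omega>)) \<partial>M) = 0" by simp
  then have "AE \<omega> in M. ennreal (cmod (I \<omega>)) = 0"
    by (subst (asm) nn_integral_0_iff_AE) auto
  then show ?thesis by (auto simp: I_def elim!: eventually_mono)
qed

section \<open>Measurability of the coefficients with respect to the field\<close>

lemma integrable_field_section_square:
  assumes x: "x \<in> sphere 0 1"
  shows "integrable M (\<lambda>\<omega>. (cmod (T x \<omega>))\<^sup>2)"
proof -
  have [measurable]: "T x \<in> borel_measurable M" using x by simp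
  have "eventually (\<lambda>L. (\<integral>\<^sup>+\<omega>. ennreal ((cmod (T x \<omega> - partial L x \<omega>))\<^sup>2) \<partial>M) < 1) sequentially"
    using order_tendstoD(2)[OF expansion'[OF x]] by simp
  then obtain L where L: "(\<integral>\<^sup>+\<omega>. ennreal ((cmod (T x \<omega> - partial L x \<omega>))\<^sup>2) \<partial>M) < 1"
    by (auto simp: eventually_sequentially)
  have 1: "integrable M (\<lambda>\<omega>. (cmod (T x \<omega> - partial L x \<omega>))\<^sup>2)"
    using order_less_trans[OF L, of \<infinity>] by (intro integrableI_bounded) auto
  have 2: "integrable M (\<lambda>\<omega>. (cmod (partial L x \<omega>))\<^sup>2)"
    unfolding partial_def using idx_subset by (intro square_moment_linear_combination) auto
  show ?thesis
  proof (rule Bochner_Integration.integrable_bound)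
    show "integrable M (\<lambda>\<omega>. 2 * (cmod (T x \<omega> - partial L x \<omega>))\<^sup>2 + 2 * (cmod (partial L x \<omega>))\<^sup>2)"
      using 1 2 by simp
    show "AE \<omega> in M. norm ((cmod (T x \<omega>))\<^sup>2) \<le> norm (2 * (cmod (T x \<omega> - partial L x \<omega>))\<^sup>2 + 2 * (cmod (partial L x \<omega>))\<^sup>2)"
    proof (rule AE_I2)
      fix \<omega>
      define u v where "u = T x \<omega> - partial L x \<omega>" and "v = partial L x \<omega>"
      have "(cmod (u + v))\<^sup>2 \<le> (cmod u + cmod v)\<^sup>2" by (intro power_mono norm_triangle_ineq) simp
      also have "\<dots> \<le> 2 * (cmod u)\<^sup>2 + 2 * (cmod v)\<^sup>2"
        using zero_le_power2[of "cmod u - cmod v"] by (simp add: power2_diff power2_sum)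
      finally show "norm ((cmod (T x \<omega>))\<^sup>2) \<le> norm (2 * (cmod (T x \<omega> - partial L x \<omega>))\<^sup>2 + 2 * (cmod (partial L x \<omega>))\<^sup>2)"
        by (simp add: u_def v_def)
    qed
  qed measurable
qed

text \<open>Replacing \<open>a p\<close> by the path integral and exchanging integrals writes the
  left side as an integral over \<open>x\<close> of E (Z T_x) times a conjugate harmonic. Fubini
  applies since \<open>Z\<close> and the field are square integrable on the product space.\<close>

lemma coeff_orthogonal_if_field_orthogonal:
  fixes Z :: "'w \<Rightarrow> real"
  assumes Z [measurable]: "Z \<in> borel_measurable M" and Z2: "integrable M (\<lambda>\<omega>. (Z \<omega>)\<^sup>2)"
    and orth: "\<And>x. x \<in> sphere 0 1 \<Longrightarrow> expectation (\<lambda>\<omega>. Z \<omega> * T x \<omega>) = 0"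
    and p: "p \<in> spin_indices s"
  shows "expectation (\<lambda>\<omega>. Z \<omega> * a p \<omega>) = 0"
proof -
  have [measurable]: "a p \<in> borel_measurable M" using p by simp
  obtain c where c: "0 < c" "\<And>x. x \<in> sphere 0 1 \<Longrightarrow> cmod (Y p x) \<le> c" using bounded_spin_harmonic by blast
  have int: "integrable (M \<Otimes>\<^sub>M sphere_measure) (\<lambda>z. complex_of_real (Z (fst z)) * (T (snd z) (fst z) * cnj (Y p (snd z))))"
  proof (rule integrable_mult_square_integrable)
    have "integrable (M \<Otimes>\<^sub>M sphere_measure) (\<lambda>z. (Z (fst z))\<^sup>2)"
      by (rule M_sphere.Fubini_integrable) (use Z2 in auto)
    then show "integrable (M \<Otimes>\<^sub>M sphere_measure) (\<lambda>z. (cmod (complex_of_real (Z (fst z))))\<^sup>2)" by simp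
    show "integrable (M \<Otimes>\<^sub>M sphere_measure) (\<lambda>z. (cmod (T (snd z) (fst z) * cnj (Y p (snd z))))\<^sup>2)"
    proof (rule Bochner_Integration.integrable_bound)
      show "integrable (M \<Otimes>\<^sub>M sphere_measure) (\<lambda>z. c\<^sup>2 * (cmod (T (snd z) (fst z)))\<^sup>2)"
        using integrable_field_square by simp
      show "AE z in M \<Otimes>\<^sub>M sphere_measure. norm ((cmod (T (snd z) (fst z) * cnj (Y p (snd z))))\<^sup>2) \<le> norm (c\<^sup>2 * (cmod (T (snd z) (fst z)))\<^sup>2)"
        using c by (intro AE_I2) (auto simp: space_pair_measure norm_mult power_mult_distrib mult.commute[of "c\<^sup>2"] intro!: mult_left_mono power_mono)
    qed measurable
  qed measurable
  have "expectation (\<lambda>\<omega>. Z \<omega> * a p \<omega>) = (CLINT \<omega>|M. (LINT x|sphere_measure. Z \<omega> * (T x \<omega> * cnj (Y p x))))"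
  proof (rule integral_cong_AE)
    show "(\<lambda>\<omega>. LINT x|sphere_measure. Z \<omega> * (T x \<omega> * cnj (Y p x))) \<in> borel_measurable M"
      by (rule sphere.borel_measurable_lebesgue_integral) (simp add: case_prod_beta')
    show "AE \<omega> in M. Z \<omega> * a p \<omega> = (LINT x|sphere_measure. Z \<omega> * (T x \<omega> * cnj (Y p x)))"
      using AE_field_coefficient[OF p] by eventually_elim simp
  qed measurable
  also have "\<dots> = (LINT x|sphere_measure. (CLINT \<omega>|M. Z \<omega> * (T x \<omega> * cnj (Y p x))))"
    by (rule M_sphere.Fubini_integral[symmetric]) (use int in \<open>simp add: case_prod_beta'\<close>)
  also have "\<dots> = (LINT x|sphere_measure. 0)"
  proof (rule Bochner_Integration.integral_cong)
    fix x assume "x \<in> space sphere_measure"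
    then have "expectation (\<lambda>\<omega>. Z \<omega> * T x \<omega>) = 0" by (intro orth) simp
    then have "(CLINT \<omega>|M. (Z \<omega> * T x \<omega>) * cnj (Y p x)) = 0" by (simp only: integral_mult_left_zero mult_zero_left)
    then show "(CLINT \<omega>|M. Z \<omega> * (T x \<omega> * cnj (Y p x))) = 0" by (simp only: mult.assoc)
  qed simp
  finally show ?thesis by simp
qed

text \<open>
  The integral \<open>\<integral>T Y dx\<close> over the path is not a function of countably many field values, so it
  need not be measurable with respect to the product \<open>\<sigma>\<close>-algebra. It agrees a.e. with its
  conditional expectation given the field: the difference is orthogonal to all \<open>T x\<close>, hence to
  the coefficients.
\<close>

lemma linear_combination_field_measurable:
  fixes c :: "nat \<times> int \<Rightarrow> complex"
  assumes fe: "field_element T \<in> measurable M (Pi\<^sub>M (sphere 0 1) (\<lambda>_. borel))"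
    and F: "finite F" "F \<subseteq> spin_indices s"
  defines "X \<equiv> \<lambda>\<omega>. \<Sum>p\<in>F. Re (c p * a p \<omega>)"
  obtains X' where "X' \<in> borel_measurable (vimage_algebra (space M) (field_element T) (Pi\<^sub>M (sphere 0 1) (\<lambda>_. borel)))"
    and "AE \<omega> in M. X \<omega> = X' \<omega>"
proof -
  define G where "G = vimage_algebra (space M) (field_element T) (Pi\<^sub>M (sphere 0 1) (\<lambda>_. borel :: complex measure))"
  have sub: "subalgebra M G"
    unfolding subalgebra_def G_def using fe by (auto simp: sets_vimage_algebra2[OF measurable_space[OF fe, THEN funcsetI]] intro: measurable_sets)
  interpret G: finite_measure_subalgebra M G
    by unfold_locales (rule sub)
  have TG: "T x \<in> borel_measurable G" if "x \<in> sphere 0 1" for x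
  proof -
    have "field_element T \<in> measurable G (Pi\<^sub>M (sphere 0 1) (\<lambda>_. borel))"
      unfolding G_def using fe by (intro measurable_vimage_algebra1) (auto dest: measurable_space)
    from measurable_compose[OF this measurable_component_singleton[OF that]]
    show ?thesis using that by (simp add: field_element_def)
  qed
  have [measurable]: "X \<in> borel_measurable M"
    unfolding X_def using F by (intro borel_measurable_sum) (auto intro!: borel_measurable_Re borel_measurable_times)
  have X2: "integrable M (\<lambda>\<omega>. (X \<omega>)\<^sup>2)" unfolding X_def by (rule real_linear_combination[OF F])
  have X1: "integrable M X" by (rule square_integrable_imp_integrable[OF _ X2]) measurable
  define X' where "X' = real_cond_exp M G X"
  have [measurable]: "X' \<in> borel_measurable G" "X' \<in> borel_measurable M" unfolding X'_def by auto
  \<comment> \<open>Conditional Jensen inequality for the square; all products below need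
    \<open>X'\<close> in L2.\<close>
  have X'2: "integrable M (\<lambda>\<omega>. (X' \<omega>)\<^sup>2)"
    unfolding X'_def
  proof (rule G.integrable_convex_cond_exp[of X UNIV _ _ "\<lambda>x. x\<^sup>2"])
    show "convex_on UNIV (\<lambda>x::real. x\<^sup>2)" by (rule convex_power2)
  qed (use X1 X2 in auto)
  define Z where "Z \<omega> = X \<omega> - X' \<omega>" for \<omega>
  have [measurable]: "Z \<in> borel_measurable M" unfolding Z_def[abs_def] by measurable
  have prod: "integrable M (\<lambda>\<omega>. f \<omega> * g \<omega>)"
    if "f \<in> borel_measurable M" "g \<in> borel_measurable M" "integrable M (\<lambda>\<omega>. (f \<omega>)\<^sup>2)" "integrable M (\<lambda>\<omega>. (g \<omega>)\<^sup>2)" for f g :: "'w \<Rightarrow> real"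
    using that by (intro integrable_mult_square_integrable) auto
  have Z2: "integrable M (\<lambda>\<omega>. (Z \<omega>)\<^sup>2)"
    using X2 X'2 prod[of X X'] by (simp add: Z_def power2_diff mult.assoc)
  have orthG: "expectation (\<lambda>\<omega>. f \<omega> * Z \<omega>) = 0"
    if f [measurable]: "f \<in> borel_measurable G" and f2: "integrable M (\<lambda>\<omega>. (f \<omega>)\<^sup>2)" for f
  proof -
    have fM [measurable]: "f \<in> borel_measurable M" using f by (rule measurable_from_subalg[OF sub])
    have "integrable M (\<lambda>\<omega>. f \<omega> * X \<omega>)" using f2 X2 by (intro prod) auto
    from G.real_cond_exp_intg[OF this] show ?thesis
      using prod[of f X] prod[of f X'] f2 X2 X'2 by (simp add: Z_def right_diff_distrib X'_def)
  qed
  have "expectation (\<lambda>\<omega>. Z \<omega> * T x \<omega>) = 0" if x: "x \<in> sphere 0 1" for x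
  proof -
    have T2: "integrable M (\<lambda>\<omega>. (cmod (T x \<omega>))\<^sup>2)" by (rule integrable_field_section_square[OF x])
    have [measurable]: "T x \<in> borel_measurable M" "T x \<in> borel_measurable G" using x TG by auto
    have "expectation (\<lambda>\<omega>. Re (T x \<omega>) * Z \<omega>) = 0"
      by (rule orthG) (auto intro!: Bochner_Integration.integrable_bound[OF T2] simp: cmod_power2)
    moreover have "expectation (\<lambda>\<omega>. Im (T x \<omega>) * Z \<omega>) = 0"
      by (rule orthG) (auto intro!: Bochner_Integration.integrable_bound[OF T2] simp: cmod_power2)
    moreover have int: "integrable M (\<lambda>\<omega>. complex_of_real (Z \<omega>) * T x \<omega>)"
      using T2 Z2 by (intro integrable_mult_square_integrable) auto
    moreover have "Re (expectation (\<lambda>\<omega>. Z \<omega> * T x \<omega>)) = expectation (\<lambda>\<omega>. Re (T x \<omega>) * Z \<omega>)"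
      "Im (expectation (\<lambda>\<omega>. Z \<omega> * T x \<omega>)) = expectation (\<lambda>\<omega>. Im (T x \<omega>) * Z \<omega>)"
      using integral_Re[OF int] integral_Im[OF int] by (simp_all add: mult.commute)
    ultimately show ?thesis by (simp add: complex_eq_iff)
  qed
  then have orth: "expectation (\<lambda>\<omega>. Z \<omega> * a p \<omega>) = 0" if "p \<in> F" for p
    using that F Z2 by (intro coeff_orthogonal_if_field_orthogonal) auto
  have "expectation (\<lambda>\<omega>. Z \<omega> * X \<omega>) = (\<Sum>p\<in>F. expectation (\<lambda>\<omega>. Re (c p * (Z \<omega> * a p \<omega>))))"
  proof -
    have "integrable M (\<lambda>\<omega>. Re (c p * (Z \<omega> * a p \<omega>)))" if "p \<in> F" for p
      using that F Z2 integrable_coeff_square[of p]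
      by (intro integrable_Re integrable_mult_right integrable_mult_square_integrable) auto
    then have "(\<Sum>p\<in>F. expectation (\<lambda>\<omega>. Re (c p * (Z \<omega> * a p \<omega>)))) = expectation (\<lambda>\<omega>. \<Sum>p\<in>F. Re (c p * (Z \<omega> * a p \<omega>)))"
      by (intro Bochner_Integration.integral_sum[symmetric]) auto
    also have "(\<lambda>\<omega>. \<Sum>p\<in>F. Re (c p * (Z \<omega> * a p \<omega>))) = (\<lambda>\<omega>. Z \<omega> * X \<omega>)"
      by (simp add: X_def sum_distrib_left fun_eq_iff algebra_simps)
    finally show ?thesis by simp
  qed
  also have "\<dots> = 0"
  proof (intro sum.neutral ballI)
    fix p assume p: "p \<in> F"
    have "integrable M (\<lambda>\<omega>. c p * (Z \<omega> * a p \<omega>))"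
      using p F Z2 integrable_coeff_square[of p]
      by (intro integrable_mult_right integrable_mult_square_integrable) auto
    from integral_Re[OF this] show "expectation (\<lambda>\<omega>. Re (c p * (Z \<omega> * a p \<omega>))) = 0"
      by (simp only: integral_mult_right_zero orth[OF p]) simp
  qed
  finally have "expectation (\<lambda>\<omega>. Z \<omega> * X \<omega>) = 0" .
  moreover have "expectation (\<lambda>\<omega>. X' \<omega> * Z \<omega>) = 0" using X'2 by (intro orthG) auto
  \<comment> \<open>The two products have mean zero for different reasons: \<open>Z\<close> is
    orthogonal to the coefficients that make up \<open>X\<close>, and \<open>X'\<close> is
    measurable with respect to the field while \<open>Z\<close> is orthogonal to all such functions
    in L2.\<close>
  moreover have "(Z \<omega>)\<^sup>2 = Z \<omega> * X \<omega> - X' \<omega> * Z \<omega>" for \<omega>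
    by (simp add: Z_def power2_eq_square algebra_simps)
  ultimately have "expectation (\<lambda>\<omega>. (Z \<omega>)\<^sup>2) = 0"
    using prod[of Z X] prod[of X' Z] Z2 X2 X'2 by simp
  then have "AE \<omega> in M. (Z \<omega>)\<^sup>2 = 0"
    using integral_nonneg_eq_0_iff_AE[OF Z2] by simp
  then have "AE \<omega> in M. X \<omega> = X' \<omega>" by (auto simp: Z_def elim!: eventually_mono)
  then show ?thesis using that[of X'] \<open>X' \<in> borel_measurable G\<close> unfolding G_def by blast
qed

end

section \<open>Independence of the coefficients of several fields\<close>

context prob_space
begin

text \<open>Each linear combination is exchanged for an a.e. equal function measurable with respect
  to its own field. Independence of the fields then factorizes the mean, and each factor is
  Gaussian.\<close>

lemma independent_fields_char:
  fixes fld :: "nat \<Rightarrow> real ^ 3 \<Rightarrow> 'a \<Rightarrow> complex" and c :: "nat \<Rightarrow> nat \<times> int \<Rightarrow> complex"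
  assumes fields: "\<And>i. i \<in> I \<Longrightarrow> spin_field M s (Cs i) (A i) (fld i)"
    and indep: "indep_vars (\<lambda>_. Pi\<^sub>M (sphere 0 1) (\<lambda>_. borel)) (\<lambda>i. field_element (fld i)) I"
    and I: "finite I" and F: "finite F" "F \<subseteq> spin_indices s"
  shows "(CLINT \<omega>|M. (\<Prod>i\<in>I. iexp (\<Sum>p\<in>F. Re (c i p * A i p \<omega>)))) =
    (\<Prod>i\<in>I. complex_of_real (exp (- (\<Sum>p\<in>F. (cmod (c i p))\<^sup>2 * Cs i (fst p)) / 4)))"
proof -
  define S where "S i \<omega> = (\<Sum>p\<in>F. Re (c i p * A i p \<omega>))" for i \<omega>
  define G where "G i = vimage_algebra (space M) (field_element (fld i)) (Pi\<^sub>M (sphere 0 1) (\<lambda>_. borel :: complex measure))" for i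
  have fe: "field_element (fld i) \<in> measurable M (Pi\<^sub>M (sphere 0 1) (\<lambda>_. borel))" if "i \<in> I" for i
    using indep that by (auto simp: indep_vars_def)
  have "\<exists>S'. S' \<in> borel_measurable (G i) \<and> (AE \<omega> in M. S i \<omega> = S' \<omega>)" if i: "i \<in> I" for i
  proof -
    interpret spin_field M s "Cs i" "A i" "fld i" using fields[OF i] .
    show ?thesis
      using linear_combination_field_measurable[OF fe[OF i] F, of "c i"] unfolding S_def G_def by blast
  qed
  then obtain S' where S': "\<And>i. i \<in> I \<Longrightarrow> S' i \<in> borel_measurable (G i)" "\<And>i. i \<in> I \<Longrightarrow> AE \<omega> in M. S i \<omega> = S' i \<omega>"
    by metis
  have setsG: "sets (G i) = {field_element (fld i) -` B \<inter> space M | B. B \<in> sets (Pi\<^sub>M (sphere 0 1) (\<lambda>_. borel))}" if "i \<in> I" for i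
    unfolding G_def using fe[OF that] by (intro sets_vimage_algebra2) (auto dest: measurable_space)
  have S'M [measurable]: "S' i \<in> borel_measurable M" if "i \<in> I" for i
  proof -
    have "subalgebra M (G i)"
      unfolding subalgebra_def using setsG[OF that] fe[OF that] by (auto simp: G_def intro: measurable_sets)
    then show ?thesis using S'(1)[OF that] by (rule measurable_from_subalg)
  qed
  have SM [measurable]: "S i \<in> borel_measurable M" if "i \<in> I" for i
  proof -
    interpret spin_field M s "Cs i" "A i" "fld i" using fields[OF that] .
    show ?thesis unfolding S_def[abs_def] using F
      by (intro borel_measurable_sum) (auto intro!: borel_measurable_Re borel_measurable_times)
  qed
  have "indep_vars (\<lambda>_. borel) S' I"
    unfolding indep_vars_def2
  proof
    show "\<forall>i\<in>I. random_variable borel (S' i)" using S'M by blast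
    have "indep_sets (\<lambda>i. {field_element (fld i) -` B \<inter> space M | B. B \<in> sets (Pi\<^sub>M (sphere 0 1) (\<lambda>_. borel))}) I"
      using indep unfolding indep_vars_def2 by blast
    then show "indep_sets (\<lambda>i. {S' i -` B \<inter> space M | B. B \<in> sets borel}) I"
    proof (rule indep_sets_mono_sets)
      fix i assume i: "i \<in> I"
      show "{S' i -` B \<inter> space M | B. B \<in> sets borel} \<subseteq> {field_element (fld i) -` B \<inter> space M | B. B \<in> sets (Pi\<^sub>M (sphere 0 1) (\<lambda>_. borel))}"
        unfolding setsG[OF i, symmetric] using measurable_sets[OF S'(1)[OF i]] by (auto simp: G_def)
    qed
  qed
  then have "indep_vars (\<lambda>_. borel) (\<lambda>i \<omega>. iexp (S' i \<omega>)) I"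
    by (rule indep_vars_compose2) simp
  then have "(CLINT \<omega>|M. (\<Prod>i\<in>I. iexp (S' i \<omega>))) = (\<Prod>i\<in>I. CLINT \<omega>|M. iexp (S' i \<omega>))"
    using I by (intro indep_vars_lebesgue_integral) (auto intro!: integrable_iexp)
  moreover have "(CLINT \<omega>|M. (\<Prod>i\<in>I. iexp (S i \<omega>))) = (CLINT \<omega>|M. (\<Prod>i\<in>I. iexp (S' i \<omega>)))"
  proof (rule integral_cong_AE)
    have "AE \<omega> in M. \<forall>i\<in>I. S i \<omega> = S' i \<omega>" using I S'(2) by (simp add: AE_ball_countable countable_finite)
    then show "AE \<omega> in M. (\<Prod>i\<in>I. iexp (S i \<omega>)) = (\<Prod>i\<in>I. iexp (S' i \<omega>))"
      by eventually_elim (simp cong: prod.cong)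
  qed (auto intro!: borel_measurable_prod measurable_compose[OF SM] measurable_compose[OF S'M])
  moreover have "(CLINT \<omega>|M. iexp (S' i \<omega>)) = exp (- (\<Sum>p\<in>F. (cmod (c i p))\<^sup>2 * Cs i (fst p)) / 4)" if i: "i \<in> I" for i
  proof -
    interpret spin_field M s "Cs i" "A i" "fld i" using fields[OF i] .
    have [measurable]: "S i \<in> borel_measurable M" "S' i \<in> borel_measurable M" using i by auto
    have "(CLINT \<omega>|M. iexp (S' i \<omega>)) = (CLINT \<omega>|M. iexp (S i \<omega>))"
      by (rule integral_cong_AE) (use S'(2)[OF i] in \<open>auto elim!: eventually_mono\<close>)
    then show ?thesis unfolding S_def using real_linear_combination(4)[OF F, of "c i"] by simp
  qed
  ultimately show ?thesis unfolding S_def by (simp cong: prod.cong)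
qed

text \<open>For any frequencies the joint exponential collects into one real linear combination per
  field. Its Gaussian value is the exponential of a sum of squares, one for each real or imaginary
  part, and therefore a product of the individual characteristic functions.\<close>

theorem independent_coefficient_parts:
  fixes fld :: "nat \<Rightarrow> real ^ 3 \<Rightarrow> 'a \<Rightarrow> complex"
  assumes fields: "\<And>i. i \<in> I \<Longrightarrow> spin_field M s (Cs i) (A i) (fld i)"
    and indep: "indep_vars (\<lambda>_. Pi\<^sub>M (sphere 0 1) (\<lambda>_. borel)) (\<lambda>i. field_element (fld i)) I"
    and I: "finite I" and F: "finite F" "F \<subseteq> spin_indices s"
  shows "indep_vars (\<lambda>_. borel) (\<lambda>(p, i, b) \<omega>. if b then Re (A i p \<omega>) else Im (A i p \<omega>)) (F \<times> I \<times> UNIV)"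
proof (rule indep_vars_if_char_factorizes)
  show "finite (F \<times> I \<times> (UNIV :: bool set))" using F I by simp
  define X where "X = (\<lambda>(p, i, b) \<omega>. if b then Re (A i p \<omega>) else Im (A i p \<omega>))"
  define e where "e i p t = complex_of_real (exp (- (t\<^sup>2 * Cs i (fst p)) / 4))" for i and p :: "nat \<times> int" and t :: real
  have single: "(CLINT \<omega>|M. iexp (t * X (p, i, b) \<omega>)) = e i p t" "random_variable borel (X (p, i, b))"
    if "p \<in> F" "i \<in> I" for p i b t
  proof -
    interpret spin_field M s "Cs i" "A i" "fld i" using fields[OF that(2)] .
    have p: "finite {p}" "{p} \<subseteq> spin_indices s" using that F by auto
    have [measurable]: "A i p \<in> borel_measurable M" using p by simp
    show "random_variable borel (X (p, i, b))" by (auto simp: X_def)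
    have "X (p, i, b) \<omega> * t = (\<Sum>q\<in>{p}. Re ((if b then t else - \<i> * t) * A i q \<omega>))" for \<omega>
      by (simp add: X_def)
    then show "(CLINT \<omega>|M. iexp (t * X (p, i, b) \<omega>)) = e i p t"
      using real_linear_combination(4)[OF p, of "\<lambda>_. if b then t else - \<i> * t"]
      by (simp add: e_def norm_mult mult.commute del: of_real_mult)
  qed
  show "random_variable borel ((case j of (p, i, b) \<Rightarrow> \<lambda>\<omega>. if b then Re (A i p \<omega>) else Im (A i p \<omega>)))"
    if "j \<in> F \<times> I \<times> UNIV" for j
    using single(2) that by (auto simp: X_def)
  fix t :: "(nat \<times> int) \<times> nat \<times> bool \<Rightarrow> real"
  \<comment> \<open>With this coefficient Re (c z) = t_1 Re z + t_2 Im z and |c|^2 = t_1^2 + t_2^2,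
    where t_1 and t_2 are the frequencies for \<open>True\<close> and \<open>False\<close>.\<close>
  define c where "c i p = t (p, i, True) - \<i> * t (p, i, False)" for i p
  have "(\<Prod>j\<in>F \<times> I \<times> UNIV. iexp (t j * X j \<omega>)) = (\<Prod>i\<in>I. iexp (\<Sum>p\<in>F. Re (c i p * A i p \<omega>)))" for \<omega>
  proof -
    have "(\<Prod>j\<in>F \<times> I \<times> UNIV. iexp (t j * X j \<omega>)) = (\<Prod>p\<in>F. \<Prod>i\<in>I. \<Prod>b\<in>UNIV. iexp (t (p, i, b) * X (p, i, b) \<omega>))"
      by (simp add: prod.cartesian_product)
    also have "\<dots> = (\<Prod>p\<in>F. \<Prod>i\<in>I. iexp (Re (c i p * A i p \<omega>)))"
      by (intro prod.cong refl) (simp add: UNIV_bool X_def c_def exp_add[symmetric] algebra_simps)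
    also have "\<dots> = (\<Prod>i\<in>I. \<Prod>p\<in>F. iexp (Re (c i p * A i p \<omega>)))" by (rule prod.swap)
    also have "\<dots> = (\<Prod>i\<in>I. iexp (\<Sum>p\<in>F. Re (c i p * A i p \<omega>)))"
      using F by (simp add: exp_sum sum_distrib_left)
    finally show ?thesis .
  qed
  then have "(CLINT \<omega>|M. (\<Prod>j\<in>F \<times> I \<times> UNIV. iexp (t j * X j \<omega>))) =
     (\<Prod>i\<in>I. complex_of_real (exp (- (\<Sum>p\<in>F. (cmod (c i p))\<^sup>2 * Cs i (fst p)) / 4)))"
    using independent_fields_char[OF fields indep I F, of c] by simp
  also have "\<dots> = (\<Prod>i\<in>I. \<Prod>p\<in>F. \<Prod>b\<in>UNIV. e i p (t (p, i, b)))"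
  proof (intro prod.cong refl)
    fix i
    have "(cmod (c i p))\<^sup>2 = (t (p, i, True))\<^sup>2 + (t (p, i, False))\<^sup>2" for p
      by (simp add: c_def cmod_power2)
    then have "- (\<Sum>p\<in>F. (cmod (c i p))\<^sup>2 * Cs i (fst p)) / 4 =
      (\<Sum>p\<in>F. - ((t (p, i, False))\<^sup>2 * Cs i (fst p)) / 4 + - ((t (p, i, True))\<^sup>2 * Cs i (fst p)) / 4)"
      by (simp add: sum_divide_distrib sum_negf[symmetric] field_simps)
    then show "complex_of_real (exp (- (\<Sum>p\<in>F. (cmod (c i p))\<^sup>2 * Cs i (fst p)) / 4)) = (\<Prod>p\<in>F. \<Prod>b\<in>UNIV. e i p (t (p, i, b)))"
      using F unfolding UNIV_bool e_def by (simp only: exp_sum exp_add) simp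
  qed
  also have "\<dots> = (\<Prod>p\<in>F. \<Prod>i\<in>I. \<Prod>b\<in>UNIV. e i p (t (p, i, b)))" by (rule prod.swap)
  also have "\<dots> = (\<Prod>p\<in>F. \<Prod>i\<in>I. \<Prod>b\<in>UNIV. CLINT \<omega>|M. iexp (t (p, i, b) * X (p, i, b) \<omega>))"
    by (intro prod.cong refl) (simp only: single)
  also have "\<dots> = (\<Prod>j\<in>F \<times> I \<times> UNIV. CLINT \<omega>|M. iexp (t j * X j \<omega>))"
    by (simp add: prod.cartesian_product)
  finally show "(CLINT \<omega>|M. (\<Prod>j\<in>F \<times> I \<times> UNIV. iexp (t j * (case j of (p, i, b) \<Rightarrow> \<lambda>\<omega>. if b then Re (A i p \<omega>) else Im (A i p \<omega>)) \<omega>))) =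
     (\<Prod>j\<in>F \<times> I \<times> UNIV. CLINT \<omega>|M. iexp (t j * (case j of (p, i, b) \<Rightarrow> \<lambda>\<omega>. if b then Re (A i p \<omega>) else Im (A i p \<omega>)) \<omega>))"
    unfolding X_def .
qed

end

section \<open>Moments of the quadratic terms\<close>

lemma sum_power4_le:
  fixes x :: "'i \<Rightarrow> real"
  assumes "finite K" "\<And>k. k \<in> K \<Longrightarrow> 0 \<le> x k"
  shows "(\<Sum>k\<in>K. x k) ^ 4 \<le> real (card K) ^ 4 * (\<Sum>k\<in>K. x k ^ 4)"
proof (cases "K = {}")
  case False
  define m where "m = Max (x ` K)"
  have "m \<in> x ` K" unfolding m_def using assms False by (intro Max_in) auto
  then obtain k where k: "k \<in> K" "x k = m" by auto
  have "(\<Sum>k\<in>K. x k) \<le> of_nat (card K) * m"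
    using assms by (intro sum_bounded_above) (auto simp: m_def)
  then have "(\<Sum>k\<in>K. x k) ^ 4 \<le> (real (card K) * m) ^ 4"
    using assms by (intro power_mono sum_nonneg) auto
  also have "\<dots> = real (card K) ^ 4 * x k ^ 4" by (simp add: power_mult_distrib k)
  also have "\<dots> \<le> real (card K) ^ 4 * (\<Sum>k\<in>K. x k ^ 4)"
    using assms k by (intro mult_left_mono member_le_sum) auto
  finally show ?thesis .
qed simp

context prob_space
begin

text \<open>The functions \<open>f\<close> may vary with the index, so that several factors in the
  same variable can be merged into one before independence is used.\<close>

lemma expectation_product_zero:
  fixes X :: "'i \<Rightarrow> 'a \<Rightarrow> real" and f :: "'i \<Rightarrow> real \<Rightarrow> real"
  assumes indep: "indep_vars (\<lambda>_. borel) X I" and J: "finite J" "J \<subseteq> I" and k: "k \<in> J"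
    and f [measurable]: "\<And>j. j \<in> J \<Longrightarrow> f j \<in> borel_measurable borel"
    and int: "\<And>j. j \<in> J \<Longrightarrow> integrable M (\<lambda>\<omega>. f j (X j \<omega>))"
    and zero: "expectation (\<lambda>\<omega>. f k (X k \<omega>)) = 0"
  shows "integrable M (\<lambda>\<omega>. \<Prod>j\<in>J. f j (X j \<omega>))" "expectation (\<lambda>\<omega>. \<Prod>j\<in>J. f j (X j \<omega>)) = 0"
proof -
  have "indep_vars (\<lambda>_. borel) (\<lambda>j \<omega>. f j (X j \<omega>)) J"
    using indep_vars_subset[OF indep J(2)] by (rule indep_vars_compose2) (rule f)
  note ind = this
  show "integrable M (\<lambda>\<omega>. \<Prod>j\<in>J. f j (X j \<omega>))"
    by (rule indep_vars_integrable[OF J(1) ind]) (rule int)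
  have "expectation (\<lambda>\<omega>. \<Prod>j\<in>J. f j (X j \<omega>)) = (\<Prod>j\<in>J. expectation (\<lambda>\<omega>. f j (X j \<omega>)))"
    by (rule indep_vars_lebesgue_integral[OF J(1) ind]) (rule int)
  then show "expectation (\<lambda>\<omega>. \<Prod>j\<in>J. f j (X j \<omega>)) = 0"
    using J(1) k zero prod_zero[of J "\<lambda>j. expectation (\<lambda>\<omega>. f j (X j \<omega>))"] by auto
qed

end

text \<open>
  The bound \<open>\<bar>quad\<bar> \<le> 2 * (2 * m + (\<Sum>j. (X j)\<^sup>2))\<close> has \<open>2 * D + 3\<close> summands, and 105 is the eighth
  moment of the standard normal distribution.
\<close>

definition quad_const :: "nat \<Rightarrow> real" where
  "quad_const D = 16 * (real (2 * D + 3)) ^ 4 * (16 + 210 * real (D + 1))"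

text \<open>One fixed pair \<open>(l, m)\<close>: index 0 is the signal, \<open>1..D\<close> are the
  noises, the boolean selects real or imaginary part, and \<open>v\<close> stands for half of a
  power spectrum.\<close>

locale signal_noise_quadratic = prob_space M for M :: "'w measure" +
  fixes X :: "nat \<times> bool \<Rightarrow> 'w \<Rightarrow> real" and v :: "nat \<Rightarrow> real" and D :: nat
  assumes D: "1 \<le> D"
    and indep: "indep_vars (\<lambda>_. borel) X ({0..D} \<times> UNIV)"
    and normal: "\<And>i b. i \<le> D \<Longrightarrow> normal_rv M (X (i, b))"
    and mean: "\<And>i b. i \<le> D \<Longrightarrow> expectation (X (i, b)) = 0"
    and var: "\<And>i b. i \<le> D \<Longrightarrow> expectation (\<lambda>\<omega>. (X (i, b) \<omega>)\<^sup>2) = v i"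
begin

definition quad :: "'w \<Rightarrow> real" where
  "quad \<omega> = 1 / real D * (\<Sum>r = 1..D. \<Sum>b\<in>UNIV. (X (0, b) \<omega> + X (r, b) \<omega>)\<^sup>2 - v 0 - v r)"

definition U :: "nat \<times> bool \<Rightarrow> 'w \<Rightarrow> real" where
  "U j \<omega> = (X j \<omega>)\<^sup>2 - v (fst j)"

lemma rv_X [measurable]: "i \<le> D \<Longrightarrow> X (i, b) \<in> borel_measurable M"
  using normal by (auto simp: normal_rv_def)

lemma integrable_X_power: "i \<le> D \<Longrightarrow> integrable M (\<lambda>\<omega>. X (i, b) \<omega> ^ k)"
  by (rule normal_rv_integrable_power[OF normal])

lemma integrable_X_mult_U: "i \<le> D \<Longrightarrow> integrable M (\<lambda>\<omega>. X (i, b) \<omega> * U (i, b) \<omega>)"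
  using integrable_X_power[of i b 3] integrable_X_power[of i b 1]
  by (simp add: U_def right_diff_distrib eval_nat_numeral)

lemma integrable_U: "i \<le> D \<Longrightarrow> integrable M (U (i, b))"
  unfolding U_def[abs_def] using integrable_X_power[of i b 2] by simp

lemma integrable_U2: "i \<le> D \<Longrightarrow> integrable M (\<lambda>\<omega>. (U (i, b) \<omega>)\<^sup>2)"
  using integrable_X_power[of i b 4] integrable_X_power[of i b 2]
  by (simp add: U_def power2_diff mult_ac flip: power_mult)

lemma expectation_U: "i \<le> D \<Longrightarrow> expectation (U (i, b)) = 0"
  unfolding U_def[abs_def] using integrable_X_power[of i b 2] by (simp add: var prob_space)

lemma expectation_U2: "i \<le> D \<Longrightarrow> expectation (\<lambda>\<omega>. (U (i, b) \<omega>)\<^sup>2) = 2 * (v i)\<^sup>2"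
proof -
  assume i: "i \<le> D"
  have "expectation (\<lambda>\<omega>. (U (i, b) \<omega>)\<^sup>2) = expectation (\<lambda>\<omega>. X (i, b) \<omega> ^ 4 - 2 * v i * (X (i, b) \<omega>)\<^sup>2 + (v i)\<^sup>2)"
    by (simp add: U_def power2_diff algebra_simps flip: power_mult)
  also have "\<dots> = 3 * (v i)\<^sup>2 - 2 * v i * v i + (v i)\<^sup>2"
    using integrable_X_power[OF i, of b 4] integrable_X_power[OF i, of b 2] normal_rv_centered(2)[OF normal[OF i] mean[OF i], of b]
    by (simp add: var[OF i] prob_space)
  finally show ?thesis by (simp add: power2_eq_square)
qed

lemma v_nonneg: "i \<le> D \<Longrightarrow> 0 \<le> v i"
  using var[of i True] by (metis integral_nonneg_AE AE_I2 zero_le_power2)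

text \<open>Decomposition into centred squares and products of signal and noise. Every channel
  contains the same signal, so the average over \<open>r\<close> leaves the signal square with
  weight 1, while each noise square has weight 1 / D.\<close>

lemma quad_eq:
  "quad \<omega> = (\<Sum>b\<in>UNIV. U (0, b) \<omega> + 1 / real D * (\<Sum>r = 1..D. U (r, b) \<omega>) + 2 / real D * (\<Sum>r = 1..D. X (0, b) \<omega> * X (r, b) \<omega>))"
proof -
  have "quad \<omega> = (\<Sum>b\<in>UNIV. 1 / real D * (\<Sum>r = 1..D. U (0, b) \<omega> + U (r, b) \<omega> + 2 * (X (0, b) \<omega> * X (r, b) \<omega>)))"
    unfolding quad_def sum_distrib_left[symmetric]
    by (subst sum.swap) (intro arg_cong2[where f = "(*)"] sum.cong refl, simp add: U_def power2_sum)
  also have "\<dots> = (\<Sum>b\<in>UNIV. U (0, b) \<omega> + 1 / real D * (\<Sum>r = 1..D. U (r, b) \<omega>) + 2 / real D * (\<Sum>r = 1..D. X (0, b) \<omega> * X (r, b) \<omega>))"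
    using D by (intro sum.cong refl) (simp add: sum.distrib sum_distrib_left[symmetric] field_simps)
  finally show ?thesis .
qed

lemma cross_term:
  assumes "r \<in> {1..D}"
  shows "integrable M (\<lambda>\<omega>. X (0, b) \<omega> * X (r, b) \<omega>)" "expectation (\<lambda>\<omega>. X (0, b) \<omega> * X (r, b) \<omega>) = 0"
proof -
  have [simp]: "(\<Prod>j\<in>{(0, b), (r, b)}. X j \<omega>) = X (0, b) \<omega> * X (r, b) \<omega>" for \<omega> using assms by simp
  have *: "finite {(0, b), (r, b)}" "{(0, b), (r, b)} \<subseteq> {0..D} \<times> UNIV" "(0, b) \<in> {(0, b), (r, b)}" using assms by auto
  show "integrable M (\<lambda>\<omega>. X (0, b) \<omega> * X (r, b) \<omega>)" "expectation (\<lambda>\<omega>. X (0, b) \<omega> * X (r, b) \<omega>) = 0"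
    using expectation_product_zero[OF indep *, of "\<lambda>_ x. x"] assms integrable_X_power[of _ _ 1] by (auto simp: mean)
qed

lemma U_U_term:
  assumes "i \<le> D" "k \<le> D" "(i, b) \<noteq> (k, b')"
  shows "integrable M (\<lambda>\<omega>. U (i, b) \<omega> * U (k, b') \<omega>)" "expectation (\<lambda>\<omega>. U (i, b) \<omega> * U (k, b') \<omega>) = 0"
proof -
  have [simp]: "(\<Prod>j\<in>{(i, b), (k, b')}. (X j \<omega>)\<^sup>2 - v (fst j)) = U (i, b) \<omega> * U (k, b') \<omega>" for \<omega>
    using assms by (subst prod.insert) (auto simp: U_def)
  have *: "finite {(i, b), (k, b')}" "{(i, b), (k, b')} \<subseteq> {0..D} \<times> UNIV" "(i, b) \<in> {(i, b), (k, b')}" using assms by auto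
  have U: "integrable M (\<lambda>\<omega>. (X j \<omega>)\<^sup>2 - v (fst j))" if "j \<in> {(i, b), (k, b')}" for j
    using that integrable_U[OF assms(1), of b] integrable_U[OF assms(2), of b'] unfolding U_def[abs_def] by blast
  have zero: "expectation (\<lambda>\<omega>. (X (i, b) \<omega>)\<^sup>2 - v (fst (i, b))) = 0"
    using expectation_U[OF assms(1), of b] unfolding U_def[abs_def] .
  note ep = expectation_product_zero[OF indep *, where f = "\<lambda>j x. x\<^sup>2 - v (fst j)"]
  show "integrable M (\<lambda>\<omega>. U (i, b) \<omega> * U (k, b') \<omega>)"
    using ep(1) U zero by simp
  show "expectation (\<lambda>\<omega>. U (i, b) \<omega> * U (k, b') \<omega>) = 0"
    using ep(2) U zero by simp
qed

text \<open>The index of \<open>U\<close> may coincide with that of the signal or of the noise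
  factor. Even then one of these two factors stays alone in its variable, and its mean is
  zero.\<close>

lemma cross_U_term:
  assumes r: "r \<in> {1..D}" and i: "i \<le> D"
  shows "integrable M (\<lambda>\<omega>. X (0, b) \<omega> * X (r, b) \<omega> * U (i, b') \<omega>)"
    "expectation (\<lambda>\<omega>. X (0, b) \<omega> * X (r, b) \<omega> * U (i, b') \<omega>) = 0"
proof -
  define J where "J = {(0, b), (r, b), (i, b')}"
  define f where "f j x = (if j = (0, b) \<or> j = (r, b) then x else 1) * (if j = (i, b') then x\<^sup>2 - v i else 1)" for j :: "nat \<times> bool" and x :: real
  \<comment> \<open>The index of the factor that is not merged with \<open>U\<close>; there
    \<open>f k\<close> is the identity.\<close>
  define k :: "nat \<times> bool" where "k = (if (i, b') = (0, b) then (r, b) else (0, b))"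
  have r0: "(0, b) \<noteq> (r, b)" using r by simp
  have kJ: "k \<in> J" "k \<noteq> (i, b')" "k = (0, b) \<or> k = (r, b)" using r by (auto simp: k_def J_def)
  have eq: "(\<Prod>j\<in>J. f j (X j \<omega>)) = X (0, b) \<omega> * X (r, b) \<omega> * U (i, b') \<omega>" for \<omega>
  proof -
    have "(\<Prod>j\<in>J. f j (X j \<omega>)) = (\<Prod>j\<in>J. if j = (0, b) \<or> j = (r, b) then X j \<omega> else 1) * (\<Prod>j\<in>J. if j = (i, b') then (X j \<omega>)\<^sup>2 - v i else 1)"
      unfolding f_def prod.distrib ..
    also have "(\<Prod>j\<in>J. if j = (0, b) \<or> j = (r, b) then X j \<omega> else 1) = (\<Prod>j\<in>{(0, b), (r, b)}. X j \<omega>)"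
      by (rule prod.mono_neutral_cong_right) (auto simp: J_def)
    also have "\<dots> = X (0, b) \<omega> * X (r, b) \<omega>" using r0 by simp
    also have "(\<Prod>j\<in>J. if j = (i, b') then (X j \<omega>)\<^sup>2 - v i else 1) = (\<Prod>j\<in>{(i, b')}. (X j \<omega>)\<^sup>2 - v i)"
      by (rule prod.mono_neutral_cong_right) (auto simp: J_def)
    finally show ?thesis by (simp add: U_def)
  qed
  have J: "finite J" "J \<subseteq> {0..D} \<times> UNIV" using r i by (auto simp: J_def)
  have fm: "f j \<in> borel_measurable borel" for j unfolding f_def[abs_def] by measurable
  have int: "integrable M (\<lambda>\<omega>. f j (X j \<omega>))" if jJ: "j \<in> J" for j
  proof -
    obtain k b'' where j: "j = (k, b'')" "k \<le> D" using subsetD[OF J(2) jJ] by (cases j) auto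
    show ?thesis
      using integrable_X_mult_U[OF j(2), of b''] integrable_U[OF j(2), of b''] integrable_X_power[OF j(2), of b'' 1]
      by (cases "j = (i, b')"; cases "j = (0, b) \<or> j = (r, b)") (auto simp: f_def j U_def[abs_def])
  qed
  have zero: "expectation (\<lambda>\<omega>. f k (X k \<omega>)) = 0"
    using kJ r by (auto simp: f_def mean)
  show "integrable M (\<lambda>\<omega>. X (0, b) \<omega> * X (r, b) \<omega> * U (i, b') \<omega>)"
    "expectation (\<lambda>\<omega>. X (0, b) \<omega> * X (r, b) \<omega> * U (i, b') \<omega>) = 0"
    using expectation_product_zero[OF indep J kJ(1) fm int zero] unfolding eq by auto
qed

lemma measurable_quad [measurable]: "quad \<in> borel_measurable M"
  unfolding quad_def[abs_def]
  by (intro borel_measurable_times borel_measurable_sum borel_measurable_diff borel_measurable_power borel_measurable_add) auto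

lemma expectation_quad_shape:
  fixes f :: "bool \<Rightarrow> 'w \<Rightarrow> real"
  assumes "\<And>b. integrable M (f b)" "\<And>r b. r \<in> R \<Longrightarrow> integrable M (g r b)" "\<And>r b. r \<in> R \<Longrightarrow> integrable M (h r b)"
  shows "expectation (\<lambda>\<omega>. \<Sum>b\<in>UNIV. f b \<omega> + c * (\<Sum>r\<in>R. g r b \<omega>) + d * (\<Sum>r\<in>R. h r b \<omega>)) =
    (\<Sum>b\<in>UNIV. expectation (f b) + c * (\<Sum>r\<in>R. expectation (g r b)) + d * (\<Sum>r\<in>R. expectation (h r b)))"
  using assms by (simp add: UNIV_bool)

lemma expectation_quad: "expectation quad = 0"
proof -
  have "expectation quad = (\<Sum>b\<in>UNIV. expectation (U (0, b)) + 1 / real D * (\<Sum>r = 1..D. expectation (U (r, b))) +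
      2 / real D * (\<Sum>r = 1..D. expectation (\<lambda>\<omega>. X (0, b) \<omega> * X (r, b) \<omega>)))"
    unfolding quad_eq by (rule expectation_quad_shape) (auto intro!: integrable_U cross_term(1))
  also have "\<dots> = 0" using expectation_U cross_term(2) by (simp add: UNIV_bool)
  finally show ?thesis .
qed

text \<open>Among the terms of \<open>quad_eq\<close> only the multiple of
  \<open>U (i, True)\<close> itself correlates with it, with weight 1 for the signal and 1 / D for a
  noise.\<close>

lemma expectation_quad_U:
  assumes i: "i \<le> D"
  shows "expectation (\<lambda>\<omega>. quad \<omega> * U (i, True) \<omega>) = (if i = 0 then 1 else 1 / real D) * (2 * (v i)\<^sup>2)"
proof -
  have UU: "integrable M (\<lambda>\<omega>. U (k, b) \<omega> * U (i, True) \<omega>)" "expectation (\<lambda>\<omega>. U (k, b) \<omega> * U (i, True) \<omega>) = (if (k, b) = (i, True) then 2 * (v i)\<^sup>2 else 0)"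
    if "k \<le> D" for k b
  proof -
    have "integrable M (\<lambda>\<omega>. U (k, b) \<omega> * U (i, True) \<omega>) \<and> expectation (\<lambda>\<omega>. U (k, b) \<omega> * U (i, True) \<omega>) = (if (k, b) = (i, True) then 2 * (v i)\<^sup>2 else 0)"
    proof (cases "(k, b) = (i, True)")
      case True
      then show ?thesis
        using integrable_U2[OF i, of True] expectation_U2[OF i, of True] by (simp add: power2_eq_square)
    next
      case False
      then show ?thesis using U_U_term[OF that i False] by auto
    qed
    then show "integrable M (\<lambda>\<omega>. U (k, b) \<omega> * U (i, True) \<omega>)" "expectation (\<lambda>\<omega>. U (k, b) \<omega> * U (i, True) \<omega>) = (if (k, b) = (i, True) then 2 * (v i)\<^sup>2 else 0)"
      by auto
  qed
  have "expectation (\<lambda>\<omega>. quad \<omega> * U (i, True) \<omega>) = expectation (\<lambda>\<omega>. \<Sum>b\<in>UNIV. U (0, b) \<omega> * U (i, True) \<omega> + 1 / real D * (\<Sum>r = 1..D. U (r, b) \<omega> * U (i, True) \<omega>) +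
      2 / real D * (\<Sum>r = 1..D. X (0, b) \<omega> * X (r, b) \<omega> * U (i, True) \<omega>))"
    unfolding quad_eq by (simp only: distrib_right sum_distrib_right mult.assoc)
  also have "\<dots> = (\<Sum>b\<in>UNIV. expectation (\<lambda>\<omega>. U (0, b) \<omega> * U (i, True) \<omega>) + 1 / real D * (\<Sum>r = 1..D. expectation (\<lambda>\<omega>. U (r, b) \<omega> * U (i, True) \<omega>)) +
      2 / real D * (\<Sum>r = 1..D. expectation (\<lambda>\<omega>. X (0, b) \<omega> * X (r, b) \<omega> * U (i, True) \<omega>)))"
    by (rule expectation_quad_shape) (auto intro!: UU(1) cross_U_term(1) i)
  also have "\<dots> = (\<Sum>b\<in>UNIV. (if (0, b) = (i, True) then 2 * (v i)\<^sup>2 else 0) + 1 / real D * (\<Sum>r = 1..D. if (r, b) = (i, True) then 2 * (v i)\<^sup>2 else 0))"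
    using UU(2) cross_U_term(2)[OF _ i] by simp
  also have "\<dots> = (if i = 0 then 1 else 1 / real D) * (2 * (v i)\<^sup>2)"
    using i D by (auto simp: UNIV_bool sum.delta)
  finally show ?thesis .
qed

lemma fourth_moment_quad:
  assumes m: "\<And>i. i \<le> D \<Longrightarrow> v i \<le> m"
  shows "integrable M (\<lambda>\<omega>. quad \<omega> ^ 4)" "expectation (\<lambda>\<omega>. quad \<omega> ^ 4) \<le> quad_const D * m ^ 4"
proof -
  have m0: "0 \<le> m" using v_nonneg[of 0] m[of 0] by simp
  \<comment> \<open>\<open>None\<close> holds the constant \<open>2 * m\<close> and
    \<open>Some j\<close> the squares, so that a single power inequality over
    \<open>1 + 2 * (D + 1)\<close> nonnegative summands covers the whole bound.\<close>
  define K where "K = insert None (Some ` ({0..D} \<times> (UNIV :: bool set)))"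
  define y where "y k \<omega> = (case k of None \<Rightarrow> 2 * m | Some j \<Rightarrow> (X j \<omega>)\<^sup>2)" for k \<omega>
  have cardK: "card K = 2 * D + 3" unfolding K_def by (subst card_insert_disjoint) (auto simp: card_image card_cartesian_product)
  have finK: "finite K" by (simp add: K_def)
  have sumK: "(\<Sum>k\<in>K. h k) = h None + (\<Sum>j\<in>{0..D} \<times> UNIV. h (Some j))" for h :: "(nat \<times> bool) option \<Rightarrow> real"
    unfolding K_def by (subst sum.insert) (auto simp: sum.reindex)
  have bound: "\<bar>quad \<omega>\<bar> \<le> 2 * (\<Sum>k\<in>K. y k \<omega>)" for \<omega>
  proof -
    define t where "t i = (\<Sum>b\<in>UNIV. (X (i, b) \<omega>)\<^sup>2)" for i
    have t0: "0 \<le> t i" for i unfolding t_def by (intro sum_nonneg) auto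
    have "\<bar>\<Sum>b\<in>UNIV. (X (0, b) \<omega> + X (r, b) \<omega>)\<^sup>2 - v 0 - v r\<bar> \<le> 2 * t 0 + 2 * t r + 4 * m" if "r \<in> {1..D}" for r
    proof -
      have "\<bar>\<Sum>b\<in>UNIV. (X (0, b) \<omega> + X (r, b) \<omega>)\<^sup>2 - v 0 - v r\<bar> \<le> (\<Sum>b\<in>UNIV. \<bar>(X (0, b) \<omega> + X (r, b) \<omega>)\<^sup>2 - v 0 - v r\<bar>)"
        by (rule sum_abs)
      also have "\<dots> \<le> (\<Sum>b\<in>(UNIV :: bool set). 2 * (X (0, b) \<omega>)\<^sup>2 + 2 * (X (r, b) \<omega>)\<^sup>2 + 2 * m)"
      proof (rule sum_mono)
        fix b
        have "(X (0, b) \<omega> + X (r, b) \<omega>)\<^sup>2 \<le> 2 * (X (0, b) \<omega>)\<^sup>2 + 2 * (X (r, b) \<omega>)\<^sup>2"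
          using zero_le_power2[of "X (0, b) \<omega> - X (r, b) \<omega>"] by (simp add: power2_diff power2_sum)
        moreover have "0 \<le> (X (0, b) \<omega> + X (r, b) \<omega>)\<^sup>2" by simp
        moreover have "0 \<le> v 0" "v 0 \<le> m" "0 \<le> v r" "v r \<le> m" using v_nonneg m that by auto
        moreover have "0 \<le> (X (0, b) \<omega>)\<^sup>2" "0 \<le> (X (r, b) \<omega>)\<^sup>2" by auto
        ultimately show "\<bar>(X (0, b) \<omega> + X (r, b) \<omega>)\<^sup>2 - v 0 - v r\<bar> \<le> 2 * (X (0, b) \<omega>)\<^sup>2 + 2 * (X (r, b) \<omega>)\<^sup>2 + 2 * m"
          by linarith
      qed
      also have "\<dots> = 2 * t 0 + 2 * t r + 4 * m" by (simp add: t_def UNIV_bool)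
      finally show ?thesis .
    qed
    then have "\<bar>\<Sum>r = 1..D. \<Sum>b\<in>UNIV. (X (0, b) \<omega> + X (r, b) \<omega>)\<^sup>2 - v 0 - v r\<bar> \<le> (\<Sum>r = 1..D. 2 * t 0 + 2 * t r + 4 * m)"
      by (rule order_trans[OF sum_abs sum_mono])
    also have "\<dots> = real D * (2 * t 0 + 4 * m) + 2 * (\<Sum>r = 1..D. t r)"
      unfolding sum.distrib sum_distrib_left[symmetric] by (simp add: algebra_simps)
    also have "\<dots> \<le> real D * (2 * t 0 + 4 * m) + real D * (2 * (\<Sum>r = 1..D. t r))"
    proof -
      have "1 * (2 * (\<Sum>r = 1..D. t r)) \<le> real D * (2 * (\<Sum>r = 1..D. t r))"
        using D t0 by (intro mult_right_mono mult_nonneg_nonneg sum_nonneg) auto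
      then show ?thesis by simp
    qed
    finally have "real D * \<bar>quad \<omega>\<bar> \<le> real D * (2 * (2 * m + (t 0 + (\<Sum>r = 1..D. t r))))"
      using D by (simp add: quad_def abs_mult algebra_simps)
    then have "\<bar>quad \<omega>\<bar> \<le> 2 * (2 * m + (t 0 + (\<Sum>r = 1..D. t r)))" using D by simp
    also have "t 0 + (\<Sum>r = 1..D. t r) = (\<Sum>i\<in>{0..D}. t i)" by (simp add: sum.atLeast_Suc_atMost)
    also have "\<dots> = (\<Sum>j\<in>{0..D} \<times> UNIV. (X j \<omega>)\<^sup>2)" by (simp add: t_def sum.cartesian_product)
    finally show ?thesis unfolding sumK by (simp add: y_def)
  qed
  have bound4: "quad \<omega> ^ 4 \<le> 16 * real (2 * D + 3) ^ 4 * (16 * m ^ 4 + (\<Sum>j\<in>{0..D} \<times> UNIV. X j \<omega> ^ 8))" for \<omega>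
  proof -
    have "quad \<omega> ^ 4 = \<bar>quad \<omega>\<bar> ^ 4" by simp
    also have "\<dots> \<le> (2 * (\<Sum>k\<in>K. y k \<omega>)) ^ 4" by (intro power_mono bound) simp
    also have "\<dots> = 16 * (\<Sum>k\<in>K. y k \<omega>) ^ 4" by (simp add: power_mult_distrib)
    also have "\<dots> \<le> 16 * (real (card K) ^ 4 * (\<Sum>k\<in>K. y k \<omega> ^ 4))"
      using finK m0 by (intro mult_left_mono sum_power4_le) (auto simp: y_def split: option.split)
    also have "(\<Sum>k\<in>K. y k \<omega> ^ 4) = 16 * m ^ 4 + (\<Sum>j\<in>{0..D} \<times> UNIV. X j \<omega> ^ 8)"
      unfolding sumK by (simp add: y_def power_mult_distrib flip: power_mult)
    finally show ?thesis unfolding cardK by simp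
  qed
  have int8: "integrable M (\<lambda>\<omega>. X j \<omega> ^ 8)" if "j \<in> {0..D} \<times> UNIV" for j
    using that integrable_X_power[of "fst j" "snd j" 8] by (cases j) simp
  have intB: "integrable M (\<lambda>\<omega>. 16 * real (2 * D + 3) ^ 4 * (16 * m ^ 4 + (\<Sum>j\<in>{0..D} \<times> UNIV. X j \<omega> ^ 8)))"
    using int8 by (intro integrable_mult_right Bochner_Integration.integrable_add Bochner_Integration.integrable_sum) auto
  show int4: "integrable M (\<lambda>\<omega>. quad \<omega> ^ 4)"
    by (rule Bochner_Integration.integrable_bound[OF intB]) (auto intro!: AE_I2 intro: order_trans[OF bound4])
  have "expectation (\<lambda>\<omega>. quad \<omega> ^ 4) \<le> expectation (\<lambda>\<omega>. 16 * real (2 * D + 3) ^ 4 * (16 * m ^ 4 + (\<Sum>j\<in>{0..D} \<times> UNIV. X j \<omega> ^ 8)))"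
    by (intro integral_mono int4 intB bound4)
  also have "\<dots> = 16 * real (2 * D + 3) ^ 4 * (16 * m ^ 4 + (\<Sum>j\<in>{0..D} \<times> UNIV. expectation (\<lambda>\<omega>. X j \<omega> ^ 8)))"
    using int8 by (simp add: prob_space del: mem_Sigma_iff)
  also have "\<dots> \<le> 16 * real (2 * D + 3) ^ 4 * (16 * m ^ 4 + (\<Sum>j\<in>{0..D} \<times> (UNIV :: bool set). 105 * m ^ 4))"
  proof (intro mult_left_mono add_left_mono sum_mono)
    fix j :: "nat \<times> bool" assume "j \<in> {0..D} \<times> UNIV"
    then obtain i b where j: "j = (i, b)" "i \<le> D" by (cases j) simp
    show "expectation (\<lambda>\<omega>. X j \<omega> ^ 8) \<le> 105 * m ^ 4"
      using normal_rv_centered(3)[OF normal[OF j(2)] mean[OF j(2)], of b] m[OF j(2)] v_nonneg[OF j(2)] var[OF j(2), of b]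
      by (simp add: j power_mono)
  qed auto
  also have "\<dots> = quad_const D * m ^ 4"
    by (simp add: quad_const_def card_cartesian_product algebra_simps)
  finally show "expectation (\<lambda>\<omega>. quad \<omega> ^ 4) \<le> quad_const D * m ^ 4" .
qed

lemma integrable_quad_square: "integrable M (\<lambda>\<omega>. (quad \<omega>)\<^sup>2)"
proof -
  have "integrable M (\<lambda>\<omega>. quad \<omega> ^ 4)"
    by (rule fourth_moment_quad(1)[of "Max (v ` {0..D})"]) auto
  moreover have "quad \<omega> ^ 4 = ((quad \<omega>)\<^sup>2)\<^sup>2" for \<omega> by (simp flip: power_mult)
  ultimately have "integrable M (\<lambda>\<omega>. ((quad \<omega>)\<^sup>2)\<^sup>2)" by (simp only:)
  then show ?thesis by (rule square_integrable_imp_integrable[rotated]) measurable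
qed

text \<open>Bessel's inequality for the projection on the single direction
  \<open>U (i, True)\<close>. Both weights 1 and 1 / D are at least 1 / D, so the bound is the same
  for signal and noise, and any one non-negligible spectrum bounds the variance from below.\<close>

lemma second_moment_quad:
  assumes i: "i \<le> D"
  shows "2 * (v i)\<^sup>2 / (real D)\<^sup>2 \<le> expectation (\<lambda>\<omega>. (quad \<omega>)\<^sup>2)"
proof -
  define c where "c = (if i = 0 then 1 else 1 / real D)"
  have [measurable]: "U (i, True) \<in> borel_measurable M" using integrable_U[OF i] by auto
  have qU: "integrable M (\<lambda>\<omega>. quad \<omega> * U (i, True) \<omega>)"
    using integrable_quad_square integrable_U2[OF i, of True] by (intro integrable_mult_square_integrable) auto
  have "0 \<le> expectation (\<lambda>\<omega>. (quad \<omega> - c * U (i, True) \<omega>)\<^sup>2)" by simp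
  also have "\<dots> = expectation (\<lambda>\<omega>. (quad \<omega>)\<^sup>2 - 2 * c * (quad \<omega> * U (i, True) \<omega>) + c\<^sup>2 * (U (i, True) \<omega>)\<^sup>2)"
    by (intro Bochner_Integration.integral_cong) (auto simp: power2_eq_square algebra_simps)
  also have "\<dots> = expectation (\<lambda>\<omega>. (quad \<omega>)\<^sup>2) - 2 * c * (c * (2 * (v i)\<^sup>2)) + c\<^sup>2 * (2 * (v i)\<^sup>2)"
    using integrable_quad_square qU integrable_U2[OF i, of True] expectation_quad_U[OF i] expectation_U2[OF i, of True]
    by (simp add: c_def)
  also have "\<dots> = expectation (\<lambda>\<omega>. (quad \<omega>)\<^sup>2) - c\<^sup>2 * (2 * (v i)\<^sup>2)" by (simp add: power2_eq_square)
  finally have "c\<^sup>2 * (2 * (v i)\<^sup>2) \<le> expectation (\<lambda>\<omega>. (quad \<omega>)\<^sup>2)" by simp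
  moreover have "(1 / real D)\<^sup>2 * (2 * (v i)\<^sup>2) \<le> c\<^sup>2 * (2 * (v i)\<^sup>2)"
    using D by (intro mult_right_mono power_mono) (auto simp: c_def)
  ultimately show ?thesis by (simp add: power_divide)
qed

end

section \<open>Needlets\<close>

text \<open>From \<bar>s\<bar> \<le> l and 1 \<le> l the two factors are at most 2 l and 3 l. The
  constant 3 reappears in the lower cut-off \<open>B ^ j / (3 * B)\<close> for multipoles with
  nonzero weight.\<close>

lemma spin_eigenvalue_bounds:
  assumes "first_multipole s \<le> l"
  shows "0 \<le> spin_eigenvalue s l" "spin_eigenvalue s l \<le> (3 * real l)\<^sup>2"
    "(real l)\<^sup>2 \<le> spin_eigenvalue s l + (real_of_int s)\<^sup>2 + \<bar>real_of_int s\<bar>"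
proof -
  have l: "\<bar>s\<bar> \<le> int l" "1 \<le> l" using assms by (auto simp: first_multipole_def)
  then show "0 \<le> spin_eigenvalue s l" unfolding spin_eigenvalue_def by simp
  have "(int l - s) * (int l + s + 1) \<le> (2 * int l) * (3 * int l)" using l by (intro mult_mono) auto
  also have "\<dots> \<le> (3 * int l)\<^sup>2" by (simp add: power2_eq_square)
  finally have "spin_eigenvalue s l \<le> real_of_int ((3 * int l)\<^sup>2)" unfolding spin_eigenvalue_def of_int_le_iff .
  then show "spin_eigenvalue s l \<le> (3 * real l)\<^sup>2" by simp
  have "spin_eigenvalue s l = (real l)\<^sup>2 + real l - (real_of_int s)\<^sup>2 - real_of_int s"
    by (simp add: spin_eigenvalue_def power2_eq_square algebra_simps)
  then show "(real l)\<^sup>2 \<le> spin_eigenvalue s l + (real_of_int s)\<^sup>2 + \<bar>real_of_int s\<bar>"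
    by linarith
qed

locale needlet_system =
  fixes B :: real and b :: "real \<Rightarrow> real" and s :: int
    and K :: "nat \<Rightarrow> nat" and \<xi> :: "nat \<Rightarrow> nat \<Rightarrow> real ^ 3" and w :: "nat \<Rightarrow> nat \<Rightarrow> real"
  assumes B: "1 < B" and window: "needlet_window B b" and cubature: "cubature_system B s K \<xi> w"
begin

lemma window_nonneg: "0 \<le> b u"
  using window by (simp add: needlet_window_def)

lemma window_support: "u \<notin> {1 / B..B} \<Longrightarrow> b u = 0"
  using window by (simp add: needlet_window_def)

lemma window_partition: "0 < u \<Longrightarrow> ((\<lambda>j::int. (b (u / B powi j))\<^sup>2) has_sum 1) UNIV"
  using window by (simp add: needlet_window_def)

lemma window_continuous: "isCont b u"
proof -
  have "(deriv ^^ 0) b field_differentiable (at u)"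
    using window unfolding needlet_window_def by blast
  then show ?thesis by (simp add: field_differentiable_imp_continuous_at)
qed

lemma window_le_1: "b u \<le> 1"
proof (cases "0 < u")
  case True
  have "(\<Sum>j\<in>{0::int}. (b (u / B powi j))\<^sup>2) \<le> 1"
    by (rule has_sum_mono_neutral[OF has_sum_finite window_partition[OF True]]) auto
  then show ?thesis by (simp add: power_le_one_iff abs_square_le_1 window_nonneg)
next
  case False
  then have "u \<notin> {1 / B..B}" using B by (auto simp: not_less dest: order_trans[of "1 / B" u 0])
  then show ?thesis using window_support by simp
qed

text \<open>The support condition allows nonzero values at the end points; continuity excludes
  them.\<close>

lemma window_edges: "b B = 0" "b (1 / B) = 0"
proof -
  have "(b \<longlongrightarrow> b B) (at_right B)"
    using window_continuous[of B] by (auto simp: isCont_def intro: filterlim_at_split[THEN iffD1, THEN conjunct2])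
  moreover have "(b \<longlongrightarrow> 0) (at_right B)"
    by (rule tendsto_eventually) (auto simp: eventually_at_filter intro!: always_eventually window_support)
  ultimately show "b B = 0" by (rule tendsto_unique[rotated]) simp
  have "(b \<longlongrightarrow> b (1 / B)) (at_left (1 / B))"
    using window_continuous[of "1 / B"] by (auto simp: isCont_def intro: filterlim_at_split[THEN iffD1, THEN conjunct1])
  moreover have "(b \<longlongrightarrow> 0) (at_left (1 / B))"
    by (rule tendsto_eventually) (auto simp: eventually_at_filter intro!: always_eventually window_support)
  ultimately show "b (1 / B) = 0" by (rule tendsto_unique[rotated]) simp
qed

text \<open>In the partition of unity at \<open>u = 1\<close> the levels \<plusminus>1 fall on the
  edges of the support and all further ones outside it, so level 0 alone has to give 1.\<close>

lemma window_1: "b 1 = 1"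
proof -
  have 0: "b (1 / B powi j) = 0" if "j \<noteq> 0" for j :: int
  proof -
    consider "j = 1" | "j = -1" | "2 \<le> j" | "j \<le> -2" using \<open>j \<noteq> 0\<close> by linarith
    then show ?thesis
    proof cases
      case 1
      then show ?thesis using window_edges by simp
    next
      case 2
      then show ?thesis using window_edges B by (simp add: power_int_minus divide_inverse)
    next
      case 3
      have "B powi 1 < B powi j" using 3 B by (intro power_int_strict_increasing) auto
      then have "1 / B powi j < 1 / B" using B by (intro divide_strict_left_mono) auto
      then show ?thesis by (intro window_support) auto
    next
      case 4
      have "B powi 1 < B powi (- j)" using 4 B by (intro power_int_strict_increasing) auto
      then have "B < 1 / B powi j" by (simp add: power_int_minus field_simps)
      then show ?thesis by (intro window_support) auto
    qed
  qed
  have "((\<lambda>j::int. (b (1 / B powi j))\<^sup>2) has_sum (\<Sum>j\<in>{0}. (b (1 / B powi j))\<^sup>2)) UNIV"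
    by (rule has_sum_finite_neutralI[of "{0::int}"]) (auto simp: 0)
  then have "(\<Sum>j\<in>{0::int}. (b (1 / B powi j))\<^sup>2) = 1"
    using window_partition[of 1] by (intro has_sum_unique) auto
  then show ?thesis using window_nonneg[of 1] by (simp add: power2_eq_1_iff)
qed

text \<open>The range in which the cubature is exact. It contains every multipole with nonzero
  weight, but the weight may vanish on part of it.\<close>

definition active :: "nat \<Rightarrow> nat set" where
  "active j = {l. first_multipole s \<le> l \<and> sqrt (spin_eigenvalue s l) \<le> B ^ (j + 1)}"

definition active_idx :: "nat \<Rightarrow> (nat \<times> int) set" where
  "active_idx j = (SIGMA l:active j. {- int l..int l})"

definition bw :: "nat \<Rightarrow> nat \<Rightarrow> real" where
  "bw j l = b (sqrt (spin_eigenvalue s l) / B ^ j)"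

text \<open>The root of the factor in l^2 \<le> e_ls + s^2 + \<bar>s\<bar> \<le> (B^2 + s^2 +
  \<bar>s\<bar>) B^(2 j), so that active multipoles are at most this constant times
  \<open>B ^ j\<close>.\<close>

definition upper_const :: real where
  "upper_const = sqrt (B\<^sup>2 + (real_of_int s)\<^sup>2 + \<bar>real_of_int s\<bar>)"

lemma active_le: "l \<in> active j \<Longrightarrow> real l \<le> upper_const * B ^ j"
proof -
  assume l: "l \<in> active j"
  then have f: "first_multipole s \<le> l" and e: "sqrt (spin_eigenvalue s l) \<le> B ^ (j + 1)" by (auto simp: active_def)
  have "spin_eigenvalue s l \<le> (B ^ (j + 1))\<^sup>2"
    using power_mono[OF e, of 2] spin_eigenvalue_bounds(1)[OF f] by simp
  then have "(real l)\<^sup>2 \<le> (B ^ (j + 1))\<^sup>2 + ((real_of_int s)\<^sup>2 + \<bar>real_of_int s\<bar>) * 1"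
    using spin_eigenvalue_bounds(3)[OF f] by simp
  also have "\<dots> \<le> (B ^ (j + 1))\<^sup>2 + ((real_of_int s)\<^sup>2 + \<bar>real_of_int s\<bar>) * (B ^ j)\<^sup>2"
    using B by (intro add_left_mono mult_left_mono) (auto intro: one_le_power)
  also have "\<dots> = (B\<^sup>2 + (real_of_int s)\<^sup>2 + \<bar>real_of_int s\<bar>) * (B ^ j)\<^sup>2"
    by (simp add: power_mult_distrib algebra_simps)
  also have "\<dots> = (upper_const * B ^ j)\<^sup>2" by (simp add: upper_const_def power_mult_distrib)
  finally show ?thesis
    by (rule power2_le_imp_le) (use B in \<open>simp add: upper_const_def\<close>)
qed

lemma finite_active [simp]: "finite (active j)"
proof (rule finite_subset)
  show "active j \<subseteq> {..nat \<lfloor>upper_const * B ^ j\<rfloor>}"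
    using active_le by (auto simp: le_nat_floor)
qed simp

lemma finite_active_idx [simp]: "finite (active_idx j)"
  by (simp add: active_idx_def)

lemma active_idx_subset: "active_idx j \<subseteq> spin_indices s"
  by (auto simp: active_idx_def active_def spin_indices_def)

lemma bw_bounds: "0 \<le> bw j l" "bw j l \<le> 1"
  by (auto simp: bw_def window_nonneg window_le_1)

lemma bw_outside: "first_multipole s \<le> l \<Longrightarrow> l \<notin> active j \<Longrightarrow> bw j l = 0"
proof -
  assume "first_multipole s \<le> l" "l \<notin> active j"
  then have "B * B ^ j < sqrt (spin_eigenvalue s l)" by (auto simp: active_def)
  then have "B < sqrt (spin_eigenvalue s l) / B ^ j" using B by (simp add: field_simps)
  then show "bw j l = 0" unfolding bw_def by (intro window_support) auto
qed

lemma bw_lower: "first_multipole s \<le> l \<Longrightarrow> bw j l \<noteq> 0 \<Longrightarrow> B ^ j / (3 * B) \<le> real l"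
proof -
  assume l: "first_multipole s \<le> l" and nz: "bw j l \<noteq> 0"
  then have "1 / B \<le> sqrt (spin_eigenvalue s l) / B ^ j"
    unfolding bw_def using window_support by fastforce
  then have "B ^ j / B \<le> sqrt (spin_eigenvalue s l)" using B by (simp add: field_simps)
  also have "\<dots> \<le> sqrt ((3 * real l)\<^sup>2)" by (intro real_sqrt_le_mono spin_eigenvalue_bounds l)
  also have "\<dots> = 3 * real l" by (simp only: real_sqrt_abs)
  finally show ?thesis by (simp add: field_simps)
qed

lemma spin_needlet_eq:
  "spin_needlet B b \<xi> w s j k x = of_real (sqrt (w j k)) *
     (\<Sum>p\<in>active_idx j. of_real (bw j (fst p)) * spin_harmonic s (fst p) (snd p) x * cnj (spin_harmonic s (fst p) (snd p) (\<xi> j k)))"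
proof -
  define h where "h l = (\<Sum>m = - int l..int l. spin_harmonic s l m x * cnj (spin_harmonic s l m (\<xi> j k)))" for l
  have "(\<Sum>\<^sub>\<infinity>l\<in>{first_multipole s..}. of_real (bw j l) * h l) = (\<Sum>\<^sub>\<infinity>l\<in>active j. of_real (bw j l) * h l)"
    by (rule infsum_cong_neutral) (auto simp: bw_outside, auto simp: active_def)
  also have "\<dots> = (\<Sum>l\<in>active j. of_real (bw j l) * h l)" by simp
  also have "\<dots> = (\<Sum>p\<in>active_idx j. of_real (bw j (fst p)) * spin_harmonic s (fst p) (snd p) x * cnj (spin_harmonic s (fst p) (snd p) (\<xi> j k)))"
    unfolding active_idx_def h_def sum_distrib_left by (subst sum.Sigma) (auto simp: case_prod_beta mult.assoc)
  finally show ?thesis unfolding spin_needlet_def h_def bw_def by simp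
qed

lemma measurable_spin_needlet [measurable]: "spin_needlet B b \<xi> w s j k \<in> borel_measurable sphere_measure"
  unfolding spin_needlet_eq[abs_def] by (intro borel_measurable_times borel_measurable_sum measurable_spin_harmonic_sphere) auto

lemma weight_pos: "k < K j \<Longrightarrow> 0 < w j k"
  using cubature by (simp add: cubature_system_def)

lemma cubature_orthonormal:
  assumes "p \<in> active_idx j" "q \<in> active_idx j"
  shows "(\<Sum>k<K j. of_real (w j k) * spin_harmonic s (fst p) (snd p) (\<xi> j k) *
           cnj (spin_harmonic s (fst q) (snd q) (\<xi> j k))) = (if p = q then 1 else 0)"
proof -
  have *: "\<forall>j l l' m m'.
        nat \<bar>s\<bar> \<le> l \<longrightarrow> nat \<bar>s\<bar> \<le> l' \<longrightarrow> \<bar>m\<bar> \<le> int l \<longrightarrow> \<bar>m'\<bar> \<le> int l' \<longrightarrow>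
        sqrt (spin_eigenvalue s l) \<le> B ^ (j + 1) \<longrightarrow>
        sqrt (spin_eigenvalue s l') \<le> B ^ (j + 1) \<longrightarrow>
        (\<Sum>k<K j. of_real (w j k) * spin_harmonic s l m (\<xi> j k) *
           cnj (spin_harmonic s l' m' (\<xi> j k))) = (if l = l' \<and> m = m' then 1 else 0)"
    using cubature unfolding cubature_system_def by (elim conjE) assumption
  have "nat \<bar>s\<bar> \<le> fst p" "nat \<bar>s\<bar> \<le> fst q" "\<bar>snd p\<bar> \<le> int (fst p)" "\<bar>snd q\<bar> \<le> int (fst q)"
    "sqrt (spin_eigenvalue s (fst p)) \<le> B ^ (j + 1)" "sqrt (spin_eigenvalue s (fst q)) \<le> B ^ (j + 1)"
    using assms by (auto simp: active_idx_def active_def first_multipole_def)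
  from *[rule_format, OF this] show ?thesis by (simp add: prod_eq_iff)
qed

text \<open>A discrete Parseval identity. The vector \<open>z\<close> is arbitrary because it is
  applied both to the coefficients of one field and to those of signal plus noise.\<close>

lemma cubature_identity:
  "(\<Sum>k<K j. (cmod (of_real (sqrt (w j k)) *
      (\<Sum>p\<in>active_idx j. of_real (bw j (fst p)) * spin_harmonic s (fst p) (snd p) (\<xi> j k) * z p)))\<^sup>2) =
    (\<Sum>p\<in>active_idx j. (bw j (fst p))\<^sup>2 * (cmod (z p))\<^sup>2)"
proof -
  define Y where "Y p k = spin_harmonic s (fst p) (snd p) (\<xi> j k)" for p k
  have orth: "(\<Sum>k<K j. of_real (w j k) * Y p k * cnj (Y q k)) = (if p = q then 1 else 0)"
    if "p \<in> active_idx j" "q \<in> active_idx j" for p q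
    unfolding Y_def using that by (rule cubature_orthonormal)
  define c where "c p = of_real (bw j (fst p)) * z p" for p
  have "complex_of_real (\<Sum>k<K j. (cmod (of_real (sqrt (w j k)) * (\<Sum>p\<in>active_idx j. of_real (bw j (fst p)) * Y p k * z p)))\<^sup>2) =
     (\<Sum>k<K j. of_real (w j k) * (\<Sum>p\<in>active_idx j. \<Sum>q\<in>active_idx j. (c p * Y p k) * cnj (c q * Y q k)))"
    unfolding of_real_sum
  proof (intro sum.cong refl)
    fix k assume "k \<in> {..<K j}"
    then have w: "0 < w j k" using weight_pos by simp
    have "complex_of_real ((cmod (of_real (sqrt (w j k)) * (\<Sum>p\<in>active_idx j. of_real (bw j (fst p)) * Y p k * z p)))\<^sup>2) =
       of_real (w j k) * of_real ((cmod (\<Sum>p\<in>active_idx j. c p * Y p k))\<^sup>2)"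
      using w by (simp add: norm_mult power_mult_distrib c_def mult_ac)
    also have "of_real ((cmod (\<Sum>p\<in>active_idx j. c p * Y p k))\<^sup>2) = (\<Sum>p\<in>active_idx j. \<Sum>q\<in>active_idx j. (c p * Y p k) * cnj (c q * Y q k))"
      unfolding complex_norm_square cnj_sum sum_product ..
    finally show "complex_of_real ((cmod (of_real (sqrt (w j k)) * (\<Sum>p\<in>active_idx j. of_real (bw j (fst p)) * Y p k * z p)))\<^sup>2) =
       of_real (w j k) * (\<Sum>p\<in>active_idx j. \<Sum>q\<in>active_idx j. (c p * Y p k) * cnj (c q * Y q k))" .
  qed
  also have "\<dots> = (\<Sum>p\<in>active_idx j. \<Sum>q\<in>active_idx j. c p * cnj (c q) * (\<Sum>k<K j. of_real (w j k) * Y p k * cnj (Y q k)))"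
    unfolding sum_distrib_left
    by (subst sum.swap, intro sum.cong refl, subst sum.swap, intro sum.cong refl) (simp add: mult_ac)
  also have "\<dots> = (\<Sum>p\<in>active_idx j. \<Sum>q\<in>active_idx j. c p * cnj (c q) * (if p = q then 1 else 0))"
    by (intro sum.cong refl) (simp only: orth)
  also have "\<dots> = (\<Sum>p\<in>active_idx j. c p * cnj (c p))"
    by (intro sum.cong refl) (simp add: if_distrib sum.delta' cong: if_cong)
  also have "\<dots> = complex_of_real (\<Sum>p\<in>active_idx j. (bw j (fst p))\<^sup>2 * (cmod (z p))\<^sup>2)"
    unfolding complex_norm_square[symmetric] of_real_sum
    by (simp add: c_def norm_mult power_mult_distrib bw_bounds)
  finally show ?thesis unfolding Y_def of_real_eq_iff .
qed

text \<open>With l the floor of B^j, e_ls / B^(2 j) tends to 1, because l / B^j does and the linear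
  and constant terms of e_ls are of lower order. Continuity and \<open>window_1\<close> make the
  weight tend to 1; one half is a convenient threshold.\<close>

lemma bump_multipole:
  "\<forall>\<^sub>F j in sequentially. first_multipole s \<le> nat \<lfloor>B ^ j\<rfloor> \<and> 1 / 2 \<le> bw j (nat \<lfloor>B ^ j\<rfloor>)"
proof -
  define l where "l j = nat \<lfloor>B ^ j\<rfloor>" for j
  have x: "filterlim (\<lambda>j. B ^ j) at_top sequentially"
    by (rule filterlim_at_infinity_imp_filterlim_at_top[OF filterlim_realpow_sequentially_gt1]) (use B in auto)
  have x0: "0 < B ^ j" for j using B by simp
  have l: "B ^ j - 1 \<le> real (l j)" "real (l j) \<le> B ^ j" for j
    using x0[of j] by (auto simp: l_def)
  have inv: "(\<lambda>j. 1 / B ^ j) \<longlonglongrightarrow> 0"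
    using tendsto_inverse_0_at_top[OF x] by (simp add: inverse_eq_divide)
  have lx: "(\<lambda>j. real (l j) / B ^ j) \<longlonglongrightarrow> 1"
  proof (rule tendsto_sandwich)
    show "(\<lambda>j. 1 - 1 / B ^ j) \<longlonglongrightarrow> 1" using tendsto_diff[OF tendsto_const inv, of 1] by simp
    have "1 - 1 / B ^ j \<le> real (l j) / B ^ j" for j
    proof -
      have "1 - 1 / B ^ j = (B ^ j - 1) / B ^ j" using B by (simp add: diff_divide_distrib)
      then show ?thesis using l(1)[of j] x0[of j] by (simp add: divide_right_mono)
    qed
    then show "\<forall>\<^sub>F j in sequentially. 1 - 1 / B ^ j \<le> real (l j) / B ^ j" by simp
    show "\<forall>\<^sub>F j in sequentially. real (l j) / B ^ j \<le> 1"
      using l x0 by (intro always_eventually allI) (simp add: field_simps)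
  qed simp
  have "(\<lambda>j. (real (l j) / B ^ j)\<^sup>2 + (real (l j) / B ^ j) * (1 / B ^ j) - ((real_of_int s)\<^sup>2 + real_of_int s) * (1 / B ^ j)\<^sup>2) \<longlonglongrightarrow>
      1\<^sup>2 + 1 * 0 - ((real_of_int s)\<^sup>2 + real_of_int s) * 0\<^sup>2"
    by (intro tendsto_intros lx inv)
  moreover have "(real (l j) / B ^ j)\<^sup>2 + (real (l j) / B ^ j) * (1 / B ^ j) - ((real_of_int s)\<^sup>2 + real_of_int s) * (1 / B ^ j)\<^sup>2 =
      spin_eigenvalue s (l j) / (B ^ j)\<^sup>2" for j
  proof -
    have "spin_eigenvalue s (l j) = (real (l j))\<^sup>2 + real (l j) - ((real_of_int s)\<^sup>2 + real_of_int s)"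
      by (simp add: spin_eigenvalue_def power2_eq_square algebra_simps)
    then show ?thesis by (simp add: power_divide power2_eq_square add_divide_distrib diff_divide_distrib)
  qed
  ultimately have "(\<lambda>j. spin_eigenvalue s (l j) / (B ^ j)\<^sup>2) \<longlonglongrightarrow> 1" by simp
  then have "(\<lambda>j. sqrt (spin_eigenvalue s (l j) / (B ^ j)\<^sup>2)) \<longlonglongrightarrow> sqrt 1" by (rule tendsto_real_sqrt)
  then have "(\<lambda>j. sqrt (spin_eigenvalue s (l j)) / B ^ j) \<longlonglongrightarrow> 1" using B by (simp add: real_sqrt_divide)
  then have "(\<lambda>j. b (sqrt (spin_eigenvalue s (l j)) / B ^ j)) \<longlonglongrightarrow> b 1"
    by (rule isCont_tendsto_compose[OF window_continuous])
  then have "\<forall>\<^sub>F j in sequentially. 1 / 2 < bw j (l j)"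
    unfolding bw_def window_1 by (rule order_tendstoD) simp
  moreover have "\<forall>\<^sub>F j in sequentially. real (first_multipole s) \<le> B ^ j"
    using x by (simp add: filterlim_at_top)
  ultimately show ?thesis
    by eventually_elim (auto simp: l_def le_nat_floor)
qed

end

section \<open>Power-law spectra and needlet coefficients\<close>

lemma regular_spectrum_bounds:
  assumes "regular_spectrum s \<alpha> c g C"
  shows "0 < c" "first_multipole s \<le> l \<Longrightarrow> inverse c * real l powr (- \<alpha>) \<le> C l"
    "first_multipole s \<le> l \<Longrightarrow> C l \<le> c * real l powr (- \<alpha>)"
proof -
  have *: "C l = real l powr (- \<alpha>) * g (real l)" "0 < C l" "inverse c \<le> g (real l)" "g (real l) \<le> c"
    if "first_multipole s \<le> l" for l
    using assms that unfolding regular_spectrum_def by blast+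
  have "0 < g (real (first_multipole s))"
    using *(1,2)[of "first_multipole s"] by (simp add: zero_less_mult_iff)
  then show "0 < c" using *(4)[of "first_multipole s"] by simp
  show "first_multipole s \<le> l \<Longrightarrow> inverse c * real l powr (- \<alpha>) \<le> C l"
    using *(1,3)[of l] by (simp add: mult.commute mult_right_mono)
  show "first_multipole s \<le> l \<Longrightarrow> C l \<le> c * real l powr (- \<alpha>)"
    using *(1,4)[of l] by (simp add: mult.commute mult_right_mono)
qed

text \<open>The 2 l + 1 orders raise the exponent to 1 - \<alpha>, which is below -1 exactly when
  \<alpha> > 2.\<close>

lemma regular_spectrum_summable:
  assumes C: "regular_spectrum s \<alpha> c g C" and \<alpha>: "2 < \<alpha>"
  shows "summable (\<lambda>l. (2 * real l + 1) * C l)"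
proof (rule summable_comparison_test_ev)
  show "summable (\<lambda>l. 3 * c * real l powr (1 - \<alpha>))"
    using \<alpha> by (intro summable_mult) (simp add: summable_real_powr_iff)
  show "\<forall>\<^sub>F l in sequentially. norm ((2 * real l + 1) * C l) \<le> 3 * c * real l powr (1 - \<alpha>)"
    using eventually_ge_at_top[of "first_multipole s"]
  proof eventually_elim
    case (elim l)
    have l: "1 \<le> real l" using elim by (simp add: first_multipole_def)
    have C0: "0 \<le> C l" using regular_spectrum_bounds(1,2)[OF C] elim
      by (meson inverse_nonnegative_iff_nonnegative less_imp_le mult_nonneg_nonneg order_trans powr_ge_zero)
    have "(2 * real l + 1) * C l \<le> (3 * real l) * (c * real l powr (- \<alpha>))"
      using l C0 regular_spectrum_bounds(3)[OF C elim] by (intro mult_mono) auto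
    also have "\<dots> = 3 * c * real l powr (1 - \<alpha>)"
      using l by (simp add: powr_diff powr_minus field_simps)
    finally show ?case using C0 l by simp
  qed
qed

locale needlet_field = needlet_system B b s K \<xi> w + spin_field M s C a T
  for B b s K \<xi> w M C a T
begin

text \<open>Integrability belongs to the conclusion because the coefficient of signal plus noise is
  split by additivity of the integral, path by path.\<close>

lemma AE_needlet_coeff:
  "AE \<omega> in M. integrable sphere_measure (\<lambda>x. T x \<omega> * cnj (spin_needlet B b \<xi> w s j k x)) \<and>
     needlet_coeff B b \<xi> w s T j k \<omega> =
       of_real (sqrt (w j k)) * (\<Sum>p\<in>active_idx j. of_real (bw j (fst p)) * Y p (\<xi> j k) * a p \<omega>)"
proof -
  have "AE \<omega> in M. \<forall>p\<in>active_idx j. (LINT x|sphere_measure. T x \<omega> * cnj (Y p x)) = a p \<omega>"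
    using AE_field_coefficient active_idx_subset[of j] by (intro AE_finite_allI) auto
  then show ?thesis
    using AE_integrable_path_square AE_space
  proof eventually_elim
    case (elim \<omega>)
    define c where "c p = of_real (sqrt (w j k)) * (of_real (bw j (fst p)) * Y p (\<xi> j k))" for p
    have eq: "T x \<omega> * cnj (spin_needlet B b \<xi> w s j k x) = (\<Sum>p\<in>active_idx j. c p * (T x \<omega> * cnj (Y p x)))" for x
      unfolding spin_needlet_eq c_def by (simp add: sum_distrib_left sum_distrib_right mult_ac)
    have int: "integrable sphere_measure (\<lambda>x. T x \<omega> * cnj (Y p x))" for p
      using integrable_path_mult elim by blast
    have "needlet_coeff B b \<xi> w s T j k \<omega> = (\<Sum>p\<in>active_idx j. c p * (LINT x|sphere_measure. T x \<omega> * cnj (Y p x)))"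
      unfolding needlet_coeff_def eq using int by (subst Bochner_Integration.integral_sum) auto
    also have "\<dots> = (\<Sum>p\<in>active_idx j. c p * a p \<omega>)" using elim(1) by (intro sum.cong refl) simp
    also have "\<dots> = of_real (sqrt (w j k)) * (\<Sum>p\<in>active_idx j. of_real (bw j (fst p)) * Y p (\<xi> j k) * a p \<omega>)"
      by (simp add: c_def sum_distrib_left mult.assoc)
    finally show ?case unfolding eq using int by auto
  qed
qed

lemma measurable_needlet_coeff [measurable]: "needlet_coeff B b \<xi> w s T j k \<in> borel_measurable M"
  unfolding needlet_coeff_def[abs_def]
  by (rule sphere.borel_measurable_lebesgue_integral) (simp add: case_prod_beta')

lemma sum_needlet_power:
  "(\<Sum>k<K j. expectation (\<lambda>\<omega>. (cmod (needlet_coeff B b \<xi> w s T j k \<omega>))\<^sup>2)) = (\<Sum>p\<in>active_idx j. (bw j (fst p))\<^sup>2 * C (fst p))"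
proof -
  define \<beta> where "\<beta> k \<omega> = (\<Sum>p\<in>active_idx j. (of_real (sqrt (w j k)) * (of_real (bw j (fst p)) * Y p (\<xi> j k))) * a p \<omega>)" for k \<omega>
  have \<beta>: "\<beta> k \<omega> = of_real (sqrt (w j k)) * (\<Sum>p\<in>active_idx j. of_real (bw j (fst p)) * Y p (\<xi> j k) * a p \<omega>)" for k \<omega>
    by (simp add: \<beta>_def sum_distrib_left mult.assoc)
  have int: "integrable M (\<lambda>\<omega>. (cmod (\<beta> k \<omega>))\<^sup>2)" for k
    unfolding \<beta>_def by (intro square_moment_linear_combination active_idx_subset) simp
  have m: "\<beta> k \<in> borel_measurable M" for k
    unfolding \<beta>_def using active_idx_subset by (intro borel_measurable_sum borel_measurable_times) (auto intro: coeff_measurable)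
  have "(\<Sum>k<K j. expectation (\<lambda>\<omega>. (cmod (needlet_coeff B b \<xi> w s T j k \<omega>))\<^sup>2)) = (\<Sum>k<K j. expectation (\<lambda>\<omega>. (cmod (\<beta> k \<omega>))\<^sup>2))"
  proof (intro sum.cong refl integral_cong_AE)
    fix k
    show "AE \<omega> in M. (cmod (needlet_coeff B b \<xi> w s T j k \<omega>))\<^sup>2 = (cmod (\<beta> k \<omega>))\<^sup>2"
      using AE_needlet_coeff[of j k] by eventually_elim (simp add: \<beta>)
  qed (use m in measurable)
  also have "\<dots> = expectation (\<lambda>\<omega>. \<Sum>k<K j. (cmod (\<beta> k \<omega>))\<^sup>2)"
    using int by (intro Bochner_Integration.integral_sum[symmetric]) auto
  also have "\<dots> = expectation (\<lambda>\<omega>. \<Sum>p\<in>active_idx j. (bw j (fst p))\<^sup>2 * (cmod (a p \<omega>))\<^sup>2)"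
    unfolding \<beta> cubature_identity ..
  also have "\<dots> = (\<Sum>p\<in>active_idx j. (bw j (fst p))\<^sup>2 * expectation (\<lambda>\<omega>. (cmod (a p \<omega>))\<^sup>2))"
    using integrable_coeff_square active_idx_subset[of j]
    by (subst Bochner_Integration.integral_sum) (auto intro!: integrable_mult_right)
  also have "\<dots> = (\<Sum>p\<in>active_idx j. (bw j (fst p))\<^sup>2 * C (fst p))"
  proof (intro sum.cong refl)
    fix p assume "p \<in> active_idx j"
    then have "{p} \<subseteq> spin_indices s" using active_idx_subset by auto
    from square_moment_linear_combination(1)[OF _ this, of "\<lambda>_. 1"]
    show "(bw j (fst p))\<^sup>2 * expectation (\<lambda>\<omega>. (cmod (a p \<omega>))\<^sup>2) = (bw j (fst p))\<^sup>2 * C (fst p)" by simp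
  qed
  finally show ?thesis .
qed

end

section \<open>The auto-power estimator\<close>

text \<open>Field 0 is the signal and \<open>1..D\<close> are the noises. With \<mu> the slower of
  the two decay exponents, all spectra are bounded above at rate \<mu>, but the lower bound is asked
  of just one of them, which suffices for the variance.\<close>

locale noisy_observation = needlet_system B b s K \<xi> w + prob_space M
  for B b s K \<xi> w and M :: "'w measure" +
  fixes D :: nat and Cs :: "nat \<Rightarrow> nat \<Rightarrow> real" and A :: "nat \<Rightarrow> nat \<times> int \<Rightarrow> 'w \<Rightarrow> complex"
    and fld :: "nat \<Rightarrow> real ^ 3 \<Rightarrow> 'w \<Rightarrow> complex" and \<mu> \<kappa> \<kappa>' :: real
  assumes D: "1 \<le> D"
    and fields: "\<And>i. i \<in> {0..D} \<Longrightarrow> spin_field M s (Cs i) (A i) (fld i)"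
    and indep: "indep_vars (\<lambda>_. Pi\<^sub>M (sphere 0 1) (\<lambda>_. borel)) (\<lambda>i. field_element (fld i)) {0..D}"
    and \<mu>: "0 < \<mu>" and \<kappa>: "0 < \<kappa>"
    and spectrum_upper: "\<And>i l. i \<le> D \<Longrightarrow> first_multipole s \<le> l \<Longrightarrow> Cs i l \<le> \<kappa>' * real l powr (- \<mu>)"
    and spectrum_lower: "\<exists>i\<le>D. \<forall>l\<ge>first_multipole s. \<kappa> * real l powr (- \<mu>) \<le> Cs i l"
begin

definition coeff_part :: "nat \<times> int \<Rightarrow> nat \<times> bool \<Rightarrow> 'w \<Rightarrow> real" where
  "coeff_part p = (\<lambda>(i, b) \<omega>. if b then Re (A i p \<omega>) else Im (A i p \<omega>))"

definition quad_term :: "nat \<times> int \<Rightarrow> 'w \<Rightarrow> real" where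
  "quad_term p \<omega> = 1 / real D * (\<Sum>r = 1..D. \<Sum>b\<in>UNIV. (coeff_part p (0, b) \<omega> + coeff_part p (r, b) \<omega>)\<^sup>2 - Cs 0 (fst p) / 2 - Cs r (fst p) / 2)"

definition quad_variance :: "nat \<times> int \<Rightarrow> real" where
  "quad_variance p = expectation (\<lambda>\<omega>. (quad_term p \<omega>)\<^sup>2)"

definition total_variance :: "nat \<Rightarrow> real" where
  "total_variance j = (\<Sum>p\<in>active_idx j. bw j (fst p) ^ 4 * quad_variance p)"

lemma quad_term_eq: "quad_term p \<omega> = 1 / real D * (\<Sum>r = 1..D. (cmod (A 0 p \<omega> + A r p \<omega>))\<^sup>2 - Cs 0 (fst p) - Cs r (fst p))"
  by (simp add: quad_term_def UNIV_bool coeff_part_def cmod_power2 algebra_simps)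

lemma indep_coeff_parts:
  assumes "finite F" "F \<subseteq> spin_indices s"
  shows "indep_vars (\<lambda>_. borel) (\<lambda>(p, j). coeff_part p j) (F \<times> {0..D} \<times> UNIV)"
  using independent_coefficient_parts[OF fields indep _ assms]
  by (simp add: coeff_part_def case_prod_unfold)

lemma quadratic:
  assumes p: "p \<in> spin_indices s"
  shows "signal_noise_quadratic M (coeff_part p) (\<lambda>i. Cs i (fst p) / 2) D"
proof
  show "1 \<le> D" by (rule D)
  have ind: "indep_vars (\<lambda>_. borel) (\<lambda>(p, j). coeff_part p j) ({p} \<times> {0..D} \<times> UNIV)"
    using p by (intro indep_coeff_parts) auto
  \<comment> \<open>Grouping into singleton blocks and projecting each block on its only entry
    renames the indices from \<open>(p, j)\<close> to \<open>j\<close>.\<close>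
  have "indep_vars (\<lambda>j. Pi\<^sub>M {(p, j)} (\<lambda>_. borel)) (\<lambda>j \<omega>. restrict (\<lambda>q. (\<lambda>(p, j). coeff_part p j) q \<omega>) {(p, j)}) ({0..D} \<times> UNIV)"
    by (rule indep_vars_restrict[OF ind]) (auto simp: disjoint_family_on_def)
  then have "indep_vars (\<lambda>_. borel) (\<lambda>j \<omega>. (restrict (\<lambda>q. (\<lambda>(p, j). coeff_part p j) q \<omega>) {(p, j)}) (p, j)) ({0..D} \<times> UNIV)"
    by (rule indep_vars_compose2[where Y = "\<lambda>j f. f (p, j)"]) (rule measurable_component_singleton, simp)
  then show "indep_vars (\<lambda>_. borel) (coeff_part p) ({0..D} \<times> UNIV)" by simp
  fix i b assume i: "i \<le> D"
  interpret spin_field M s "Cs i" "A i" "fld i" using fields i by simp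
  have F: "finite {p}" "{p} \<subseteq> spin_indices s" using p by auto
  have eq: "coeff_part p (i, b) = (\<lambda>\<omega>. \<Sum>q\<in>{p}. Re ((if b then 1 else - \<i>) * A i q \<omega>))"
    by (auto simp: coeff_part_def)
  show "normal_rv M (coeff_part p (i, b))" unfolding eq by (rule linear_combination_normal[OF F])
  show "expectation (coeff_part p (i, b)) = 0" unfolding eq by (rule real_linear_combination(1)[OF F])
  show "expectation (\<lambda>\<omega>. (coeff_part p (i, b) \<omega>)\<^sup>2) = Cs i (fst p) / 2"
    unfolding eq using real_linear_combination(2)[OF F, of "\<lambda>_. if b then 1 else - \<i>"] by simp
qed

lemma quad_term_moments:
  assumes p: "p \<in> spin_indices s"
  shows "quad_term p \<in> borel_measurable M" "expectation (quad_term p) = 0" "integrable M (\<lambda>\<omega>. (quad_term p \<omega>)\<^sup>2)"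
    "integrable M (\<lambda>\<omega>. quad_term p \<omega> ^ 4)"
    "expectation (\<lambda>\<omega>. quad_term p \<omega> ^ 4) \<le> quad_const D * (\<kappa>' * real (fst p) powr (- \<mu>)) ^ 4"
    "\<kappa>\<^sup>2 / (2 * (real D)\<^sup>2) * (real (fst p) powr (- \<mu>))\<^sup>2 \<le> quad_variance p"
proof -
  interpret q: signal_noise_quadratic M "coeff_part p" "\<lambda>i. Cs i (fst p) / 2" D by (rule quadratic[OF p])
  have quad_term: "quad_term p = q.quad" by (simp add: quad_term_def[abs_def] q.quad_def[abs_def])
  have fm: "first_multipole s \<le> fst p" using p by (auto simp: spin_indices_def)
  have m: "Cs i (fst p) / 2 \<le> \<kappa>' * real (fst p) powr (- \<mu>)" if "i \<le> D" for i
    using spectrum_upper[OF that fm] q.v_nonneg[OF that] by simp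
  show "quad_term p \<in> borel_measurable M" "expectation (quad_term p) = 0" "integrable M (\<lambda>\<omega>. (quad_term p \<omega>)\<^sup>2)"
    unfolding quad_term by (rule q.measurable_quad q.expectation_quad q.integrable_quad_square)+
  show "integrable M (\<lambda>\<omega>. quad_term p \<omega> ^ 4)" "expectation (\<lambda>\<omega>. quad_term p \<omega> ^ 4) \<le> quad_const D * (\<kappa>' * real (fst p) powr (- \<mu>)) ^ 4"
    unfolding quad_term using q.fourth_moment_quad[OF m] by auto
  obtain i where i: "i \<le> D" "\<kappa> * real (fst p) powr (- \<mu>) \<le> Cs i (fst p)"
    using spectrum_lower fm by blast
  have "\<kappa>\<^sup>2 / (2 * (real D)\<^sup>2) * (real (fst p) powr (- \<mu>))\<^sup>2 = (\<kappa> * real (fst p) powr (- \<mu>))\<^sup>2 / (2 * (real D)\<^sup>2)"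
    by (simp add: power_mult_distrib)
  also have "\<dots> \<le> (Cs i (fst p))\<^sup>2 / (2 * (real D)\<^sup>2)"
    using i \<kappa> by (intro divide_right_mono power_mono) auto
  \<comment> \<open>Real and imaginary part have variance \<open>Cs i / 2\<close> each; this turns
    the bound 2 v^2 / D^2 into C^2 / (2 D^2).\<close>
  also have "\<dots> = 2 * (Cs i (fst p) / 2)\<^sup>2 / (real D)\<^sup>2" by (simp add: power_divide)
  also have "\<dots> \<le> quad_variance p" unfolding quad_variance_def quad_term by (rule q.second_moment_quad[OF i(1)])
  finally show "\<kappa>\<^sup>2 / (2 * (real D)\<^sup>2) * (real (fst p) powr (- \<mu>))\<^sup>2 \<le> quad_variance p" .
qed

lemma quad_variance_nonneg: "0 \<le> quad_variance p"
  by (simp add: quad_variance_def)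

lemma quad_const_nonneg: "0 \<le> quad_const D"
  by (simp add: quad_const_def)

text \<open>The squared second moment is at most the fourth moment, so the bound needed for
  Lyapunov's condition also controls the variance.\<close>

lemma quad_variance_upper:
  assumes p: "p \<in> spin_indices s"
  shows "quad_variance p \<le> sqrt (quad_const D) * (\<kappa>' * real (fst p) powr (- \<mu>))\<^sup>2"
proof (rule power2_le_imp_le)
  have "(quad_variance p)\<^sup>2 \<le> expectation (\<lambda>\<omega>. quad_term p \<omega> ^ 4)"
    unfolding quad_variance_def by (rule square_second_moment_le[OF quad_term_moments(1)[OF p] quad_term_moments(4)[OF p]])
  also have "\<dots> \<le> quad_const D * (\<kappa>' * real (fst p) powr (- \<mu>)) ^ 4" by (rule quad_term_moments(5)[OF p])
  also have "\<dots> = (sqrt (quad_const D) * (\<kappa>' * real (fst p) powr (- \<mu>))\<^sup>2)\<^sup>2"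
    using quad_const_nonneg by (simp add: power_mult_distrib flip: power_mult)
  finally show "(quad_variance p)\<^sup>2 \<le> (sqrt (quad_const D) * (\<kappa>' * real (fst p) powr (- \<mu>))\<^sup>2)\<^sup>2" .
  show "0 \<le> sqrt (quad_const D) * (\<kappa>' * real (fst p) powr (- \<mu>))\<^sup>2"
    using quad_const_nonneg by simp
qed

text \<open>\<open>quad_term p\<close> is a measurable function of the block of real and imaginary
  parts of all fields at \<open>p\<close>, and blocks of different \<open>p\<close> are
  disjoint.\<close>

lemma indep_quad_term: "indep_vars (\<lambda>_. borel) quad_term (active_idx j)"
proof -
  have ind: "indep_vars (\<lambda>_. borel) (\<lambda>(p, i). coeff_part p i) (active_idx j \<times> {0..D} \<times> UNIV)"
    by (intro indep_coeff_parts active_idx_subset) simp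
  define Y where "Y p f = 1 / real D * (\<Sum>r = 1..D. \<Sum>b\<in>UNIV. (f (p, 0, b) + f (p, r, b))\<^sup>2 - Cs 0 (fst p) / 2 - Cs r (fst p) / 2)"
    for p :: "nat \<times> int" and f :: "(nat \<times> int) \<times> nat \<times> bool \<Rightarrow> real"
  have "indep_vars (\<lambda>p. Pi\<^sub>M ({p} \<times> {0..D} \<times> UNIV) (\<lambda>_. borel))
     (\<lambda>p \<omega>. restrict (\<lambda>q. (\<lambda>(p, i). coeff_part p i) q \<omega>) ({p} \<times> {0..D} \<times> UNIV)) (active_idx j)"
    by (rule indep_vars_restrict[OF ind]) (auto simp: disjoint_family_on_def)
  then have "indep_vars (\<lambda>_. borel) (\<lambda>p \<omega>. Y p (restrict (\<lambda>q. (\<lambda>(p, i). coeff_part p i) q \<omega>) ({p} \<times> {0..D} \<times> UNIV))) (active_idx j)"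
  proof (rule indep_vars_compose2)
    fix p :: "nat \<times> int"
    have "(\<lambda>f. f (p, i, b)) \<in> borel_measurable (Pi\<^sub>M ({p} \<times> {0..D} \<times> UNIV) (\<lambda>_. borel))" if "i \<le> D" for i b
      using that by (intro measurable_component_singleton) auto
    then show "Y p \<in> borel_measurable (Pi\<^sub>M ({p} \<times> {0..D} \<times> UNIV) (\<lambda>_. borel))"
      unfolding Y_def[abs_def]
      by (intro borel_measurable_times borel_measurable_sum borel_measurable_diff borel_measurable_power borel_measurable_add) auto
  qed
  moreover have "Y p (restrict (\<lambda>q. (\<lambda>(p, i). coeff_part p i) q \<omega>) ({p} \<times> {0..D} \<times> UNIV)) = quad_term p \<omega>" for p \<omega>
    by (simp add: Y_def quad_term_def)
  ultimately show ?thesis by simp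
qed

definition estimator :: "nat \<Rightarrow> 'w \<Rightarrow> real" where
  "estimator j = auto_power_estimator M B b K \<xi> w s D (fld 0) fld j"

definition signal_power :: "nat \<Rightarrow> real" where
  "signal_power j = needlet_power M B b K \<xi> w s (fld 0) j"

lemma needlet_field: "i \<le> D \<Longrightarrow> needlet_field B b s K \<xi> w M (Cs i) (A i) (fld i)"
  using fields[of i] by (intro needlet_field.intro needlet_system_axioms) simp

lemma measurable_needlet_coeff_sum:
  assumes "r \<le> D"
  shows "needlet_coeff B b \<xi> w s (\<lambda>x \<omega>. fld 0 x \<omega> + fld r x \<omega>) j k \<in> borel_measurable M"
proof -
  interpret P: needlet_field B b s K \<xi> w M "Cs 0" "A 0" "fld 0" by (rule needlet_field) simp
  interpret N: needlet_field B b s K \<xi> w M "Cs r" "A r" "fld r" by (rule needlet_field) (rule assms)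
  note [measurable] = P.T_joint' N.T_joint'
  show ?thesis
    unfolding needlet_coeff_def[abs_def]
    by (rule sphere.borel_measurable_lebesgue_integral) (simp add: case_prod_beta')
qed

lemma measurable_estimator [measurable]: "estimator j \<in> borel_measurable M"
  unfolding estimator_def auto_power_estimator_def[abs_def]
proof (intro borel_measurable_times borel_measurable_sum borel_measurable_diff borel_measurable_power)
  fix k r assume "r \<in> {1..D}"
  then have "r \<le> D" by simp
  note [measurable] = measurable_needlet_coeff_sum[OF this, of j k]
  show "(\<lambda>\<omega>. cmod (needlet_coeff B b \<xi> w s (\<lambda>x \<omega>. fld 0 x \<omega> + fld r x \<omega>) j k \<omega>)) \<in> borel_measurable M"
    by measurable
qed auto

lemma AE_sum_needlet_coeff:
  assumes r: "r \<le> D"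
  shows "AE \<omega> in M. (\<Sum>k<K j. (cmod (needlet_coeff B b \<xi> w s (\<lambda>x \<omega>. fld 0 x \<omega> + fld r x \<omega>) j k \<omega>))\<^sup>2) =
     (\<Sum>p\<in>active_idx j. (bw j (fst p))\<^sup>2 * (cmod (A 0 p \<omega> + A r p \<omega>))\<^sup>2)"
proof -
  interpret P: needlet_field B b s K \<xi> w M "Cs 0" "A 0" "fld 0" by (rule needlet_field) simp
  interpret N: needlet_field B b s K \<xi> w M "Cs r" "A r" "fld r" by (rule needlet_field) (rule r)
  have "AE \<omega> in M. \<forall>k\<in>{..<K j}. needlet_coeff B b \<xi> w s (\<lambda>x \<omega>. fld 0 x \<omega> + fld r x \<omega>) j k \<omega> =
     of_real (sqrt (w j k)) * (\<Sum>p\<in>active_idx j. of_real (bw j (fst p)) * spin_harmonic s (fst p) (snd p) (\<xi> j k) * (A 0 p \<omega> + A r p \<omega>))"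
  proof (rule AE_finite_allI)
    fix k
    show "AE \<omega> in M. needlet_coeff B b \<xi> w s (\<lambda>x \<omega>. fld 0 x \<omega> + fld r x \<omega>) j k \<omega> =
     of_real (sqrt (w j k)) * (\<Sum>p\<in>active_idx j. of_real (bw j (fst p)) * spin_harmonic s (fst p) (snd p) (\<xi> j k) * (A 0 p \<omega> + A r p \<omega>))"
      using P.AE_needlet_coeff[of j k] N.AE_needlet_coeff[of j k]
    proof eventually_elim
      case (elim \<omega>)
      have "needlet_coeff B b \<xi> w s (\<lambda>x \<omega>. fld 0 x \<omega> + fld r x \<omega>) j k \<omega> =
         needlet_coeff B b \<xi> w s (fld 0) j k \<omega> + needlet_coeff B b \<xi> w s (fld r) j k \<omega>"
        unfolding needlet_coeff_def distrib_right
        using elim by (intro Bochner_Integration.integral_add) blast+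
      then show ?case
        using elim by (simp add: distrib_left sum.distrib)
    qed
  qed simp
  then show ?thesis
  proof eventually_elim
    case (elim \<omega>)
    then show ?case
      by (subst cubature_identity[symmetric]) (intro sum.cong refl, simp)
  qed
qed

lemma AE_estimator: "AE \<omega> in M. estimator j \<omega> - signal_power j = (\<Sum>p\<in>active_idx j. (bw j (fst p))\<^sup>2 * quad_term p \<omega>)"
proof -
  have signal_power: "signal_power j = (\<Sum>p\<in>active_idx j. (bw j (fst p))\<^sup>2 * Cs 0 (fst p))"
  proof -
    interpret P: needlet_field B b s K \<xi> w M "Cs 0" "A 0" "fld 0" by (rule needlet_field) simp
    show ?thesis unfolding signal_power_def needlet_power_def by (rule P.sum_needlet_power)
  qed
  have noise: "(\<Sum>k<K j. LINT \<omega>|M. (cmod (needlet_coeff B b \<xi> w s (fld r) j k \<omega>))\<^sup>2) = (\<Sum>p\<in>active_idx j. (bw j (fst p))\<^sup>2 * Cs r (fst p))"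
    if "r \<le> D" for r
  proof -
    interpret N: needlet_field B b s K \<xi> w M "Cs r" "A r" "fld r" by (rule needlet_field) (rule that)
    show ?thesis by (rule N.sum_needlet_power)
  qed
  have "AE \<omega> in M. \<forall>r\<in>{1..D}. (\<Sum>k<K j. (cmod (needlet_coeff B b \<xi> w s (\<lambda>x \<omega>. fld 0 x \<omega> + fld r x \<omega>) j k \<omega>))\<^sup>2) =
     (\<Sum>p\<in>active_idx j. (bw j (fst p))\<^sup>2 * (cmod (A 0 p \<omega> + A r p \<omega>))\<^sup>2)"
    by (rule AE_finite_allI) (auto intro!: AE_sum_needlet_coeff)
  then show ?thesis
  proof eventually_elim
    case (elim \<omega>)
    have "estimator j \<omega> = 1 / real D * (\<Sum>r = 1..D. (\<Sum>k<K j. (cmod (needlet_coeff B b \<xi> w s (\<lambda>x \<omega>. fld 0 x \<omega> + fld r x \<omega>) j k \<omega>))\<^sup>2) -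
        (\<Sum>k<K j. LINT \<omega>|M. (cmod (needlet_coeff B b \<xi> w s (fld r) j k \<omega>))\<^sup>2))"
      unfolding estimator_def auto_power_estimator_def by (subst sum.swap) (simp only: sum_subtractf)
    also have "\<dots> = 1 / real D * (\<Sum>r = 1..D. \<Sum>p\<in>active_idx j. (bw j (fst p))\<^sup>2 * ((cmod (A 0 p \<omega> + A r p \<omega>))\<^sup>2 - Cs r (fst p)))"
      using elim noise by (intro arg_cong2[where f = "(*)"] sum.cong refl) (simp add: sum_subtractf right_diff_distrib)
    also have "\<dots> = (\<Sum>p\<in>active_idx j. (bw j (fst p))\<^sup>2 * (1 / real D * (\<Sum>r = 1..D. (cmod (A 0 p \<omega> + A r p \<omega>))\<^sup>2 - Cs r (fst p))))"
      by (subst sum.swap) (simp add: sum_distrib_left mult_ac)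
    finally have "estimator j \<omega> - signal_power j = (\<Sum>p\<in>active_idx j. (bw j (fst p))\<^sup>2 * (1 / real D * (\<Sum>r = 1..D. (cmod (A 0 p \<omega> + A r p \<omega>))\<^sup>2 - Cs r (fst p)) - Cs 0 (fst p)))"
      by (simp add: signal_power sum_subtractf right_diff_distrib)
    also have "\<dots> = (\<Sum>p\<in>active_idx j. (bw j (fst p))\<^sup>2 * quad_term p \<omega>)"
    proof (intro sum.cong refl arg_cong2[where f = "(*)"])
      fix p
      \<comment> \<open>The signal power is subtracted once, whereas \<open>quad_term\<close>
        subtracts it in each of the \<open>D\<close> channels before averaging.\<close>
      have "(\<Sum>r = 1..D. (cmod (A 0 p \<omega> + A r p \<omega>))\<^sup>2 - Cs 0 (fst p) - Cs r (fst p)) =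
         (\<Sum>r = 1..D. (cmod (A 0 p \<omega> + A r p \<omega>))\<^sup>2 - Cs r (fst p)) - real D * Cs 0 (fst p)"
        by (simp add: sum_subtractf)
      then show "1 / real D * (\<Sum>r = 1..D. (cmod (A 0 p \<omega> + A r p \<omega>))\<^sup>2 - Cs r (fst p)) - Cs 0 (fst p) = quad_term p \<omega>"
        unfolding quad_term_eq using D by (simp only: right_diff_distrib) simp
    qed
    finally show ?case .
  qed
qed

lemma quad_term_active:
  assumes "p \<in> active_idx j"
  shows "quad_term p \<in> borel_measurable M" "integrable M (quad_term p)" "integrable M (\<lambda>\<omega>. (quad_term p \<omega>)\<^sup>2)" "expectation (quad_term p) = 0"
proof -
  have p: "p \<in> spin_indices s" using assms active_idx_subset by blast
  show m: "quad_term p \<in> borel_measurable M" and i2: "integrable M (\<lambda>\<omega>. (quad_term p \<omega>)\<^sup>2)" and "expectation (quad_term p) = 0"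
    by (rule quad_term_moments[OF p])+
  show "integrable M (quad_term p)" by (rule square_integrable_imp_integrable[OF m i2])
qed

text \<open>The quadratic terms are centred, so the estimator is unbiased and centring at
  \<open>signal_power\<close> is centring at the mean. Independence removes the mixed terms; the
  squared weights \<open>bw ^ 2\<close> become fourth powers.\<close>

lemma variance_estimator: "variance (estimator j) = total_variance j"
proof -
  define S where "S \<omega> = (\<Sum>p\<in>active_idx j. (bw j (fst p))\<^sup>2 * quad_term p \<omega>)" for \<omega>
  have S [measurable]: "S \<in> borel_measurable M"
    unfolding S_def[abs_def] by (intro borel_measurable_sum borel_measurable_times) (auto intro: quad_term_active)
  have AE: "AE \<omega> in M. estimator j \<omega> = signal_power j + S \<omega>" using AE_estimator[of j] by (auto simp: S_def elim!: eventually_mono)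
  have intS: "integrable M S" unfolding S_def by (intro Bochner_Integration.integrable_sum integrable_mult_right quad_term_active)
  have "expectation S = 0"
    unfolding S_def by (subst Bochner_Integration.integral_sum) (auto intro!: integrable_mult_right quad_term_active sum.neutral simp: quad_term_active)
  moreover have "expectation (estimator j) = expectation (\<lambda>\<omega>. signal_power j + S \<omega>)"
    using AE by (intro integral_cong_AE) auto
  ultimately have E: "expectation (estimator j) = signal_power j" using intS by (simp add: prob_space)
  have "variance (estimator j) = expectation (\<lambda>\<omega>. (S \<omega>)\<^sup>2)"
    unfolding E using AE by (intro integral_cong_AE) (auto elim!: eventually_mono)
  also have "\<dots> = expectation (\<lambda>\<omega>. \<Sum>p\<in>active_idx j. \<Sum>q\<in>active_idx j. (bw j (fst p))\<^sup>2 * (bw j (fst q))\<^sup>2 * (quad_term p \<omega> * quad_term q \<omega>))"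
    by (simp add: S_def power2_eq_square sum_product mult_ac)
  also have "\<dots> = (\<Sum>p\<in>active_idx j. \<Sum>q\<in>active_idx j. (bw j (fst p))\<^sup>2 * (bw j (fst q))\<^sup>2 * expectation (\<lambda>\<omega>. quad_term p \<omega> * quad_term q \<omega>))"
  proof -
    have "integrable M (\<lambda>\<omega>. quad_term p \<omega> * quad_term q \<omega>)" if "p \<in> active_idx j" "q \<in> active_idx j" for p q
      using that quad_term_active by (intro integrable_mult_square_integrable) auto
    then show ?thesis
      by (rule integral_double_sum)
  qed
  also have "\<dots> = (\<Sum>p\<in>active_idx j. \<Sum>q\<in>active_idx j. if q = p then bw j (fst p) ^ 4 * quad_variance p else 0)"
  proof (intro sum.cong refl)
    fix p q assume pq: "p \<in> active_idx j" "q \<in> active_idx j"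
    show "(bw j (fst p))\<^sup>2 * (bw j (fst q))\<^sup>2 * expectation (\<lambda>\<omega>. quad_term p \<omega> * quad_term q \<omega>) = (if q = p then bw j (fst p) ^ 4 * quad_variance p else 0)"
    proof (cases "q = p")
      case True
      then show ?thesis by (simp add: quad_variance_def power2_eq_square eval_nat_numeral)
    next
      case False
      have J: "finite {p, q}" "{p, q} \<subseteq> active_idx j" "p \<in> {p, q}" using pq by auto
      have "expectation (\<lambda>\<omega>. \<Prod>i\<in>{p, q}. quad_term i \<omega>) = 0"
        by (rule expectation_product_zero(2)[OF indep_quad_term J, of "\<lambda>_ x. x"]) (use pq quad_term_active in auto)
      then have "expectation (\<lambda>\<omega>. quad_term p \<omega> * quad_term q \<omega>) = 0" using False by simp
      then show ?thesis using False by simp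
    qed
  qed
  also have "\<dots> = total_variance j" by (simp add: total_variance_def)
  finally show ?thesis .
qed

section \<open>Growth of the variance and Lyapunov's condition\<close>

definition decay :: "nat \<Rightarrow> real" where "decay j = (B ^ j) powr (- \<mu>)"

text \<open>A multipole of nonzero weight is at least B^j / (3 B), so its spectrum is at most
  \<kappa>' (3 B)^\<mu> times \<open>decay j\<close>.\<close>

definition m_const :: real where "m_const = \<kappa>' * (3 * B) powr \<mu>"

lemma decay_pos: "0 < decay j"
  using B by (simp add: decay_def)

lemma \<kappa>'_nonneg: "0 \<le> \<kappa>'"
proof -
  obtain i where i: "i \<le> D" "\<kappa> * real (first_multipole s) powr (- \<mu>) \<le> Cs i (first_multipole s)"
    using spectrum_lower by blast
  have "0 < real (first_multipole s) powr (- \<mu>)" by (simp add: first_multipole_def)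
  moreover have "\<kappa> * real (first_multipole s) powr (- \<mu>) \<le> \<kappa>' * real (first_multipole s) powr (- \<mu>)"
    using i spectrum_upper[OF i(1), of "first_multipole s"] by simp
  ultimately have "\<kappa> \<le> \<kappa>'" by simp
  then show ?thesis using \<kappa> by simp
qed

lemma active_scale:
  assumes p: "p \<in> active_idx j" and nz: "bw j (fst p) \<noteq> 0"
  shows "(\<kappa>' * real (fst p) powr (- \<mu>))\<^sup>2 \<le> (m_const * decay j)\<^sup>2"
proof -
  have "first_multipole s \<le> fst p" using p by (auto simp: active_idx_def active_def)
  from bw_lower[OF this nz] have l: "B ^ j / (3 * B) \<le> real (fst p)" .
  have "real (fst p) powr (- \<mu>) \<le> (B ^ j / (3 * B)) powr (- \<mu>)"
    using l B \<mu> by (intro powr_mono2') auto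
  also have "\<dots> = (3 * B) powr \<mu> * decay j"
    using B by (simp add: decay_def powr_divide powr_minus field_simps)
  finally have "\<kappa>' * real (fst p) powr (- \<mu>) \<le> m_const * decay j"
    using \<kappa>'_nonneg by (simp add: m_const_def mult.assoc mult_left_mono)
  then show ?thesis using \<kappa>'_nonneg by (intro power_mono) auto
qed

lemma total_variance_upper: "total_variance j \<le> real (card (active_idx j)) * (sqrt (quad_const D) * (m_const * decay j)\<^sup>2)"
  unfolding total_variance_def
proof (rule sum_bounded_above)
  fix p assume p: "p \<in> active_idx j"
  show "bw j (fst p) ^ 4 * quad_variance p \<le> sqrt (quad_const D) * (m_const * decay j)\<^sup>2"
  proof (cases "bw j (fst p) = 0")
    case True
    then show ?thesis using quad_const_nonneg by simp
  next
    case False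
    have "bw j (fst p) ^ 4 * quad_variance p \<le> 1 * quad_variance p"
      using bw_bounds quad_variance_nonneg by (intro mult_right_mono power_le_one) auto
    also have "\<dots> \<le> sqrt (quad_const D) * (\<kappa>' * real (fst p) powr (- \<mu>))\<^sup>2"
      using quad_variance_upper[OF subsetD[OF active_idx_subset p]] by simp
    also have "\<dots> \<le> sqrt (quad_const D) * (m_const * decay j)\<^sup>2"
      using active_scale[OF p False] quad_const_nonneg by (intro mult_left_mono) auto
    finally show ?thesis .
  qed
qed

lemma card_active_idx: "real (card (active_idx j)) \<le> 2 * ((upper_const + 1) * B ^ j)\<^sup>2"
proof -
  define N where "N = nat \<lfloor>upper_const * B ^ j\<rfloor>"
  have c0: "0 \<le> upper_const" by (simp add: upper_const_def)
  have "l \<le> N" if "l \<in> active j" for l using active_le[OF that] by (simp add: N_def le_nat_floor)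
  then have "active_idx j \<subseteq> {..N} \<times> {- int N..int N}"
    by (fastforce simp: active_idx_def)
  then have "card (active_idx j) \<le> card ({..N} \<times> {- int N..int N})" by (intro card_mono) auto
  also have "\<dots> = (N + 1) * (2 * N + 1)"
  proof -
    have "card {- int N..int N} = 2 * N + 1" by (simp only: card_atLeastAtMost_int)
    then show ?thesis by (simp only: card_cartesian_product card_atMost) simp
  qed
  finally have "real (card (active_idx j)) \<le> real ((N + 1) * (2 * N + 1))" by (simp only: of_nat_le_iff)
  also have "\<dots> \<le> 2 * (real N + 1)\<^sup>2" by (simp add: power2_eq_square algebra_simps)
  also have "\<dots> \<le> 2 * ((upper_const + 1) * B ^ j)\<^sup>2"
  proof (intro mult_left_mono power_mono)
    have "real N \<le> upper_const * B ^ j" unfolding N_def using c0 B by (intro of_nat_floor) auto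
    moreover have "1 \<le> B ^ j" using B by (simp add: one_le_power)
    ultimately show "real N + 1 \<le> (upper_const + 1) * B ^ j" by (simp add: distrib_right)
  qed auto
  finally show ?thesis .
qed

text \<open>At most of order B^(2 j) active indices, each with variance at most of order B^(- 2
  \<mu> j).\<close>

lemma total_variance_bigo: "total_variance \<in> O(\<lambda>j. B powr (2 * (1 - \<mu>) * real j))"
proof (rule bigoI)
  define c where "c = 2 * (upper_const + 1)\<^sup>2 * (sqrt (quad_const D) * m_const\<^sup>2)"
  have "norm (total_variance j) \<le> c * norm (B powr (2 * (1 - \<mu>) * real j))" for j
  proof -
    have "total_variance j \<le> 2 * ((upper_const + 1) * B ^ j)\<^sup>2 * (sqrt (quad_const D) * (m_const * decay j)\<^sup>2)"
      by (rule order_trans[OF total_variance_upper mult_right_mono[OF card_active_idx]]) (simp add: quad_const_nonneg)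
    also have "\<dots> = c * (B ^ j * decay j)\<^sup>2" by (simp add: c_def power_mult_distrib)
    also have "(B ^ j * decay j)\<^sup>2 = B powr (2 * (1 - \<mu>) * real j)"
    proof -
      have Bj: "B ^ j = B powr real j" using B by (simp add: powr_realpow)
      have "B ^ j * decay j = B powr real j * B powr (real j * (- \<mu>))"
        unfolding decay_def Bj powr_powr ..
      also have "\<dots> = B powr (real j * (1 - \<mu>))" by (simp add: powr_add[symmetric] algebra_simps)
      finally have "(B ^ j * decay j)\<^sup>2 = B powr (real j * (1 - \<mu>)) * B powr (real j * (1 - \<mu>))"
        by (simp add: power2_eq_square)
      also have "\<dots> = B powr (2 * (1 - \<mu>) * real j)" by (simp add: powr_add[symmetric] algebra_simps)
      finally show ?thesis .
    qed
    finally show ?thesis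
      using quad_variance_nonneg bw_bounds by (simp add: total_variance_def sum_nonneg)
  qed
  then show "\<forall>\<^sub>F j in sequentially. norm (total_variance j) \<le> c * norm (B powr (2 * (1 - \<mu>) * real j))" by simp
qed

definition v_const :: real where "v_const = \<kappa>\<^sup>2 / (2 * (real D)\<^sup>2)"

lemma v_const_pos: "0 < v_const"
  using \<kappa> D by (simp add: v_const_def)

lemma total_variance_lower: "\<forall>\<^sub>F j in sequentially. v_const / 16 * B ^ j * (decay j)\<^sup>2 \<le> total_variance j"
  using bump_multipole
proof eventually_elim
  case (elim j)
  define l where "l = nat \<lfloor>B ^ j\<rfloor>"
  have fm: "first_multipole s \<le> l" and b: "1 / 2 \<le> bw j l" using elim by (auto simp: l_def)
  have "l \<in> active j" using bw_outside[OF fm, of j] b by auto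
  then have sub: "{l} \<times> {- int l..int l} \<subseteq> active_idx j" by (auto simp: active_idx_def)
  have x: "0 < B ^ j" using B by simp
  \<comment> \<open>The number of orders 2 l + 1 exceeds B^j because l + 1 does, and l \<le> B^j
    makes \<open>decay j\<close> a lower bound for the spectral factor at l. The 16 in the claim is
    the fourth power of the weight bound 1 / 2.\<close>
  have lx: "real l \<le> B ^ j" "B ^ j \<le> 2 * real l + 1" "1 \<le> real l"
    using x fm by (auto simp: l_def first_multipole_def) linarith+
  have "decay j \<le> real l powr (- \<mu>)" unfolding decay_def using lx \<mu> by (intro powr_mono2') auto
  then have yl: "(decay j)\<^sup>2 \<le> (real l powr (- \<mu>))\<^sup>2" using decay_pos[of j] by (intro power_mono) auto
  have b4: "1 / 16 \<le> bw j l ^ 4" using power_mono[OF b, of 4] by (simp add: power_divide)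
  have "v_const / 16 * B ^ j * (decay j)\<^sup>2 \<le> v_const / 16 * (2 * real l + 1) * (decay j)\<^sup>2"
    using lx v_const_pos by (intro mult_right_mono mult_left_mono) auto
  also have "\<dots> = (\<Sum>p\<in>{l} \<times> {- int l..int l}. 1 / 16 * (v_const * (decay j)\<^sup>2))"
    by (simp add: card_cartesian_product)
  also have "\<dots> \<le> (\<Sum>p\<in>{l} \<times> {- int l..int l}. bw j (fst p) ^ 4 * quad_variance p)"
  proof (rule sum_mono)
    fix p assume p: "p \<in> {l} \<times> {- int l..int l}"
    then have "p \<in> spin_indices s" using sub active_idx_subset by blast
    from quad_term_moments(6)[OF this] have "v_const * (real l powr (- \<mu>))\<^sup>2 \<le> quad_variance p" using p by (auto simp: v_const_def)
    then have "v_const * (decay j)\<^sup>2 \<le> quad_variance p" using yl v_const_pos by (meson mult_left_mono order_trans less_imp_le)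
    then show "1 / 16 * (v_const * (decay j)\<^sup>2) \<le> bw j (fst p) ^ 4 * quad_variance p"
      using b4 p v_const_pos by (intro mult_mono) auto
  qed
  also have "\<dots> \<le> total_variance j"
    unfolding total_variance_def by (intro sum_mono2 sub) (auto simp: quad_variance_nonneg)
  finally show ?case .
qed

text \<open>Of the fourth power of the scale \<open>m\<close>, one square is bounded uniformly by
  the level, the other by the variance of the same term. The sum thus inherits the total variance as
  a factor, and Lyapunov's quotient loses one power of it.\<close>

lemma fourth_moment_sum:
  "(\<Sum>p\<in>active_idx j. bw j (fst p) ^ 8 * expectation (\<lambda>\<omega>. quad_term p \<omega> ^ 4)) \<le>
     quad_const D * (\<kappa>'\<^sup>2 / v_const) * (m_const * decay j)\<^sup>2 * total_variance j"
  unfolding total_variance_def sum_distrib_left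
proof (rule sum_mono)
  fix p assume p: "p \<in> active_idx j"
  then have ps: "p \<in> spin_indices s" using active_idx_subset by blast
  define m where "m = \<kappa>' * real (fst p) powr (- \<mu>)"
  show "bw j (fst p) ^ 8 * expectation (\<lambda>\<omega>. quad_term p \<omega> ^ 4) \<le>
     quad_const D * (\<kappa>'\<^sup>2 / v_const) * (m_const * decay j)\<^sup>2 * (bw j (fst p) ^ 4 * quad_variance p)"
  proof (cases "bw j (fst p) = 0")
    case False
    have quad_variance: "m\<^sup>2 \<le> \<kappa>'\<^sup>2 / v_const * quad_variance p"
    proof -
      have "v_const * (real (fst p) powr (- \<mu>))\<^sup>2 \<le> quad_variance p" using quad_term_moments(6)[OF ps] by (simp add: v_const_def)
      then have "(real (fst p) powr (- \<mu>))\<^sup>2 \<le> quad_variance p / v_const" using v_const_pos by (simp add: field_simps)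
      then have "\<kappa>'\<^sup>2 * (real (fst p) powr (- \<mu>))\<^sup>2 \<le> \<kappa>'\<^sup>2 * (quad_variance p / v_const)" by (intro mult_left_mono) auto
      then show ?thesis by (simp add: m_def power_mult_distrib)
    qed
    have "bw j (fst p) ^ 8 \<le> bw j (fst p) ^ 4" using bw_bounds by (intro power_decreasing) auto
    then have "bw j (fst p) ^ 8 * expectation (\<lambda>\<omega>. quad_term p \<omega> ^ 4) \<le> bw j (fst p) ^ 4 * (quad_const D * m ^ 4)"
      using quad_term_moments(5)[OF ps] bw_bounds by (intro mult_mono) (auto simp: m_def)
    also have "m ^ 4 = m\<^sup>2 * m\<^sup>2" by (simp flip: power_add)
    also have "bw j (fst p) ^ 4 * (quad_const D * (m\<^sup>2 * m\<^sup>2)) \<le>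
       bw j (fst p) ^ 4 * (quad_const D * ((m_const * decay j)\<^sup>2 * (\<kappa>'\<^sup>2 / v_const * quad_variance p)))"
      using quad_variance active_scale[OF p False] bw_bounds quad_const_nonneg
      by (intro mult_left_mono mult_mono) (auto simp: m_def)
    finally show ?thesis by (simp add: mult_ac)
  qed (simp add: quad_variance_nonneg)
qed

theorem estimator_asymptotic_normality:
  "weak_conv_m (\<lambda>j. distr M borel (\<lambda>\<omega>. (estimator j \<omega> - signal_power j) / sqrt (variance (estimator j)))) std_normal_distribution"
proof -
  define X where "X j p \<omega> = (bw j (fst p))\<^sup>2 / sqrt (total_variance j) * quad_term p \<omega>" for j p \<omega>
  have QM: "p \<in> spin_indices s" if "p \<in> active_idx j" for p j using that active_idx_subset by blast
  \<comment> \<open>Positivity is known only for large \<open>j\<close>, where the multipole of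
    \<open>bump_multipole\<close> is active with weight at least 1 / 2.\<close>
  have total_variance_pos: "\<forall>\<^sub>F j in sequentially. 0 < total_variance j"
    using total_variance_lower
  proof eventually_elim
    case (elim j)
    have "0 < v_const / 16 * B ^ j * (decay j)\<^sup>2" using v_const_pos B decay_pos[of j] by simp
    then show ?case using elim by linarith
  qed
  have "weak_conv_m (\<lambda>j. distr M borel (\<lambda>\<omega>. \<Sum>p\<in>active_idx j. X j p \<omega>)) std_normal_distribution"
  proof (rule lyapunov_central_limit)
    show "finite (active_idx j)" for j by simp
    show "indep_vars (\<lambda>_. borel) (X j) (active_idx j)" for j
      unfolding X_def[abs_def] by (rule indep_vars_compose2[OF indep_quad_term]) auto
    show "integrable M (\<lambda>\<omega>. X j p \<omega> ^ 4)" if "p \<in> active_idx j" for j p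
      unfolding X_def power_mult_distrib by (intro integrable_mult_right quad_term_moments(4) QM[OF that])
    show "expectation (X j p) = 0" if "p \<in> active_idx j" for j p
      unfolding X_def[abs_def] using quad_term_moments(2)[OF QM[OF that]] by simp
    show "\<forall>\<^sub>F j in sequentially. (\<Sum>p\<in>active_idx j. expectation (\<lambda>\<omega>. (X j p \<omega>)\<^sup>2)) = 1"
      using total_variance_pos
    proof eventually_elim
      case (elim j)
      have "(\<Sum>p\<in>active_idx j. expectation (\<lambda>\<omega>. (X j p \<omega>)\<^sup>2)) = (\<Sum>p\<in>active_idx j. bw j (fst p) ^ 4 * quad_variance p / total_variance j)"
        using elim by (intro sum.cong refl) (simp add: X_def quad_variance_def power_mult_distrib power_divide flip: power_mult)
      also have "\<dots> = 1" using elim by (simp add: total_variance_def flip: sum_divide_distrib)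
      finally show ?case .
    qed
    define c where "c = quad_const D * (\<kappa>'\<^sup>2 / v_const) * m_const\<^sup>2 * (16 / v_const)"
    show "(\<lambda>j. \<Sum>p\<in>active_idx j. expectation (\<lambda>\<omega>. X j p \<omega> ^ 4)) \<longlonglongrightarrow> 0"
    proof (rule Lim_null_comparison)
      have "(\<lambda>j. (1 / B) ^ j) \<longlonglongrightarrow> 0" using B by (intro LIMSEQ_realpow_zero) auto
      from tendsto_mult_right_zero[OF this, of c] show "(\<lambda>j. c * (1 / B) ^ j) \<longlonglongrightarrow> 0" .
      show "\<forall>\<^sub>F j in sequentially. norm (\<Sum>p\<in>active_idx j. expectation (\<lambda>\<omega>. X j p \<omega> ^ 4)) \<le> c * (1 / B) ^ j"
        using total_variance_pos total_variance_lower
      proof eventually_elim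
        case (elim j)
        have s4: "sqrt (total_variance j) ^ 4 = (total_variance j)\<^sup>2"
        proof -
          have "sqrt (total_variance j) ^ 4 = ((sqrt (total_variance j))\<^sup>2)\<^sup>2" by (simp flip: power_mult)
          then show ?thesis using elim(1) by simp
        qed
        have "0 \<le> (\<Sum>p\<in>active_idx j. expectation (\<lambda>\<omega>. X j p \<omega> ^ 4))" by (intro sum_nonneg) simp
        then have "norm (\<Sum>p\<in>active_idx j. expectation (\<lambda>\<omega>. X j p \<omega> ^ 4)) = (\<Sum>p\<in>active_idx j. expectation (\<lambda>\<omega>. X j p \<omega> ^ 4))" by simp
        also have "\<dots> = (\<Sum>p\<in>active_idx j. bw j (fst p) ^ 8 * expectation (\<lambda>\<omega>. quad_term p \<omega> ^ 4)) / (total_variance j)\<^sup>2"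
          unfolding sum_divide_distrib X_def power_mult_distrib power_divide s4
          by (intro sum.cong refl) (simp flip: power_mult)
        also have "\<dots> \<le> (quad_const D * (\<kappa>'\<^sup>2 / v_const) * (m_const * decay j)\<^sup>2 * total_variance j) / (total_variance j)\<^sup>2"
          by (intro divide_right_mono fourth_moment_sum) simp
        also have "\<dots> = quad_const D * (\<kappa>'\<^sup>2 / v_const) * m_const\<^sup>2 * ((decay j)\<^sup>2 / total_variance j)"
          using elim(1) by (simp add: power2_eq_square)
        also have "\<dots> \<le> quad_const D * (\<kappa>'\<^sup>2 / v_const) * m_const\<^sup>2 * (16 / v_const * (1 / B) ^ j)"
        proof (rule mult_left_mono)
          \<comment> \<open>The lower variance bound solved for \<open>decay j ^ 2\<close>; the
            factor B^j, from the 2 l + 1 orders of one multipole, produces the geometric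
            decay.\<close>
          have "(decay j)\<^sup>2 = 16 / v_const * (1 / B) ^ j * (v_const / 16 * B ^ j * (decay j)\<^sup>2)"
            using v_const_pos B by (simp add: power_divide)
          also have "\<dots> \<le> 16 / v_const * (1 / B) ^ j * total_variance j"
            using elim(2) v_const_pos B by (intro mult_left_mono) auto
          finally show "(decay j)\<^sup>2 / total_variance j \<le> 16 / v_const * (1 / B) ^ j"
            using elim(1) by (simp add: pos_divide_le_eq)
          show "0 \<le> quad_const D * (\<kappa>'\<^sup>2 / v_const) * m_const\<^sup>2"
            using quad_const_nonneg v_const_pos by simp
        qed
        finally show ?case by (simp add: c_def mult.assoc)
      qed
    qed
  qed
  \<comment> \<open>The representation by quadratic terms holds only a.e., which is enough for
    equality of the laws.\<close>
  moreover have "distr M borel (\<lambda>\<omega>. (estimator j \<omega> - signal_power j) / sqrt (variance (estimator j))) = distr M borel (\<lambda>\<omega>. \<Sum>p\<in>active_idx j. X j p \<omega>)" for j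
  proof (rule distr_cong_AE)
    have "AE \<omega> in M. (estimator j \<omega> - signal_power j) / sqrt (total_variance j) = (\<Sum>p\<in>active_idx j. X j p \<omega>)"
      using AE_estimator[of j] by eventually_elim (simp add: X_def sum_divide_distrib)
    then show "AE \<omega> in M. (estimator j \<omega> - signal_power j) / sqrt (variance (estimator j)) = (\<Sum>p\<in>active_idx j. X j p \<omega>)"
      unfolding variance_estimator .
    show "(\<lambda>\<omega>. \<Sum>p\<in>active_idx j. X j p \<omega>) \<in> borel_measurable M"
      unfolding X_def by (intro borel_measurable_sum borel_measurable_times quad_term_moments(1) QM) auto
  qed auto
  ultimately show ?thesis by (simp only:)
qed

end

lemma gaussian_isotropic_spin_field_expansion:
  assumes "prob_space M" "gaussian_isotropic_spin_field M s C T" "summable (\<lambda>l. (2 * real l + 1) * C l)"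
  obtains a where "spin_field M s C a T"
proof -
  from assms(2) obtain a where "gaussian_spin_coeffs M s C a"
    "\<And>x. x \<in> sphere 0 1 \<Longrightarrow>
           (\<lambda>L. \<integral>\<^sup>+\<omega>. ennreal ((cmod (T x \<omega> -
              (\<Sum>l = first_multipole s..L. \<Sum>m = - int l..int l.
                 a (l, m) \<omega> * spin_harmonic s l m x)))\<^sup>2) \<partial>M) \<longlonglongrightarrow> 0"
    "(\<lambda>(\<omega>, x). T x \<omega>) \<in> borel_measurable (M \<Otimes>\<^sub>M sphere_measure)"
    unfolding gaussian_isotropic_spin_field_def by blast
  then have "spin_field M s C a T"
    using assms by (auto simp: spin_field_def spin_coeffs_def spin_coeffs_axioms_def spin_field_axioms_def)
  then show ?thesis by (rule that)
qed

theorem proposition13: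
  fixes M :: "'w measure"
    and B :: real and b :: "real \<Rightarrow> real" and s :: int
    and K :: "nat \<Rightarrow> nat" and \<xi> :: "nat \<Rightarrow> nat \<Rightarrow> real ^ 3" and w :: "nat \<Rightarrow> nat \<Rightarrow> real"
    and D :: nat
    and P :: "real ^ 3 \<Rightarrow> 'w \<Rightarrow> complex" and N :: "nat \<Rightarrow> real ^ 3 \<Rightarrow> 'w \<Rightarrow> complex"
    and C :: "nat \<Rightarrow> real" and CN :: "nat \<Rightarrow> nat \<Rightarrow> real"
    and g :: "real \<Rightarrow> real" and gN :: "nat \<Rightarrow> real \<Rightarrow> real"
    and \<alpha> \<gamma> c\<^sub>0 c\<^sub>0\<^sub>N :: real
    and \<Gamma>AP :: "nat \<Rightarrow> 'w \<Rightarrow> real" and \<Gamma> :: "nat \<Rightarrow> real"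
  assumes prob: "prob_space M"
    and B: "1 < B" and window: "needlet_window B b" and cubature: "cubature_system B s K \<xi> w"
    and D: "1 \<le> D"
    and P_field: "gaussian_isotropic_spin_field M s C P"
    and N_field: "\<And>r. r \<in> {1..D} \<Longrightarrow> gaussian_isotropic_spin_field M s (CN r) (N r)"
    and indep: "prob_space.indep_vars M (\<lambda>_. Pi\<^sub>M (sphere 0 1) (\<lambda>_. borel))
                  (\<lambda>i. field_element (if i = 0 then P else N i)) {0..D}"
    and \<alpha>: "2 < \<alpha>" and P_spectrum: "regular_spectrum s \<alpha> c\<^sub>0 g C"
    and \<gamma>: "2 < \<gamma>"
    and N_spectrum: "\<And>r. r \<in> {1..D} \<Longrightarrow> regular_spectrum s \<gamma> c\<^sub>0\<^sub>N (gN r) (CN r)"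
  defines "\<Gamma>AP \<equiv> auto_power_estimator M B b K \<xi> w s D P N"
    and "\<Gamma> \<equiv> needlet_power M B b K \<xi> w s P"
  shows "weak_conv_m
           (\<lambda>j. distr M borel
             (\<lambda>\<omega>. (\<Gamma>AP j \<omega> - \<Gamma> j) / sqrt (prob_space.variance M (\<Gamma>AP j))))
           std_normal_distribution
         \<and> (\<lambda>j. prob_space.variance M (\<Gamma>AP j)) \<in> O(\<lambda>j. B powr (2 * (1 - min \<alpha> \<gamma>) * real j))"
proof -
  define fld where "fld i = (if i = 0 then P else N i)" for i
  define Cs where "Cs i = (if i = 0 then C else CN i)" for i
  have "\<exists>a. spin_field M s (Cs i) a (fld i)" if "i \<in> {0..D}" for i
  proof (cases "i = 0")
    case True
    obtain a where "spin_field M s C a P"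
      using gaussian_isotropic_spin_field_expansion[OF prob P_field regular_spectrum_summable[OF P_spectrum \<alpha>]] .
    then show ?thesis using True by (auto simp: Cs_def fld_def)
  next
    case False
    then have i: "i \<in> {1..D}" using that by auto
    obtain a where "spin_field M s (CN i) a (N i)"
      using gaussian_isotropic_spin_field_expansion[OF prob N_field[OF i] regular_spectrum_summable[OF N_spectrum[OF i] \<gamma>]] .
    then show ?thesis using False by (auto simp: Cs_def fld_def)
  qed
  then obtain A where A: "\<And>i. i \<in> {0..D} \<Longrightarrow> spin_field M s (Cs i) (A i) (fld i)" by metis
  define \<mu> where "\<mu> = min \<alpha> \<gamma>"
  \<comment> \<open>The lower constant of whichever spectrum decays more slowly: the signal if
    \<alpha> \<le> \<gamma>, otherwise the noise of channel 1, which exists since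
    \<open>1 \<le> D\<close>.\<close>
  define \<kappa> where "\<kappa> = (if \<alpha> \<le> \<gamma> then inverse c\<^sub>0 else inverse c\<^sub>0\<^sub>N)"
  note P_bounds = regular_spectrum_bounds[OF P_spectrum]
  note N_bounds = regular_spectrum_bounds[OF N_spectrum]
  have one: "1 \<in> {1..D}" using D by simp
  have powr: "real l powr (- \<nu>) \<le> real l powr (- \<mu>)" if "first_multipole s \<le> l" "\<mu> \<le> \<nu>" for l \<nu>
    using that by (intro powr_mono) (auto simp: first_multipole_def)
  interpret noisy_observation B b s K \<xi> w M D Cs A fld \<mu> \<kappa> "max c\<^sub>0 c\<^sub>0\<^sub>N"
  proof (intro noisy_observation.intro needlet_system.intro noisy_observation_axioms.intro)
    show "prob_space.indep_vars M (\<lambda>_. Pi\<^sub>M (sphere 0 1) (\<lambda>_. borel)) (\<lambda>i. field_element (fld i)) {0..D}"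
      using indep unfolding fld_def .
    show "0 < \<mu>" using \<alpha> \<gamma> by (simp add: \<mu>_def)
    show "0 < \<kappa>" using P_bounds(1) N_bounds(1)[OF one] by (simp add: \<kappa>_def)
    show "Cs i l \<le> max c\<^sub>0 c\<^sub>0\<^sub>N * real l powr (- \<mu>)" if "i \<le> D" "first_multipole s \<le> l" for i l
    proof (cases "i = 0")
      case True
      have "C l \<le> c\<^sub>0 * real l powr (- \<alpha>)" using P_bounds(3) that by blast
      also have "\<dots> \<le> max c\<^sub>0 c\<^sub>0\<^sub>N * real l powr (- \<mu>)"
        using P_bounds(1) that by (intro mult_mono powr) (auto simp: \<mu>_def)
      finally show ?thesis using True by (simp add: Cs_def)
    next
      case False
      then have i: "i \<in> {1..D}" using that by auto
      have "CN i l \<le> c\<^sub>0\<^sub>N * real l powr (- \<gamma>)" using N_bounds(3)[OF i] that by blast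
      also have "\<dots> \<le> max c\<^sub>0 c\<^sub>0\<^sub>N * real l powr (- \<mu>)"
        using N_bounds(1)[OF one] that by (intro mult_mono powr) (auto simp: \<mu>_def)
      finally show ?thesis using False by (simp add: Cs_def)
    qed
    show "\<exists>i\<le>D. \<forall>l\<ge>first_multipole s. \<kappa> * real l powr (- \<mu>) \<le> Cs i l"
    proof (cases "\<alpha> \<le> \<gamma>")
      case True
      then show ?thesis
        using P_bounds(2) by (intro exI[of _ 0]) (auto simp: \<kappa>_def \<mu>_def Cs_def)
    next
      case False
      then show ?thesis
        using N_bounds(2)[OF one] D by (intro exI[of _ 1]) (auto simp: \<kappa>_def \<mu>_def Cs_def)
    qed
  qed (use prob B window cubature D A in auto)
  have e: "estimator = \<Gamma>AP"
    unfolding estimator_def[abs_def] \<Gamma>AP_def auto_power_estimator_def[abs_def]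
    by (intro ext arg_cong2[where f = "(*)"] sum.cong refl) (simp add: fld_def)
  have p: "signal_power = \<Gamma>"
    unfolding signal_power_def[abs_def] \<Gamma>_def by (simp add: fld_def)
  have v: "total_variance = (\<lambda>j. variance (estimator j))" by (simp add: variance_estimator fun_eq_iff)
  show ?thesis
    using estimator_asymptotic_normality total_variance_bigo unfolding v e p \<mu>_def by (rule conjI)
qed

end
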